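(* Let $n>1$ be an integer, let $\Gamma=\{(x,y)\in\mathbb{R}^2: x^{2n}+y^{2n}=1\}$ be the Fermat oval, and let $\gamma$ be the dual curve of $\Gamma$ with respect to the origin. Let $\tilde\Gamma\subset\mathbb{C}P^2$ be the projective closure of the complex curve $x^{2n}+y^{2n}=1$. Then $\tilde\Gamma$ is irreducible and non-singular, and the Birkhoff billiard inside $\gamma$ is not integrable, i.e. it does not admit a non-constant polynomial integral on the energy level $\{|v|=1\}$. Moreover $$\gamma=\{(x,y)\in\mathbb{R}^2: |x|^{\frac{2n}{2n-1}}+|y|^{\frac{2n}{2n-1}}=1\},$$ and $\gamma$ is a strictly convex $C^1$ curve in the plane which, as an algebraic curve, has $4$ singular points $(\pm1,0),(0,\pm1)$, corresponding to the $4$ inflection points $(\pm1,0),(0,\pm1)$ of $\Gamma$.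
   Context: Duality: the line $\{\langle \nu,X\rangle=p\}$ with $|\nu|=1$, $p>0$, corresponds to the point $\nu/p$ of the plane. The dual curve of $\Gamma$ consists of the points dual to the tangent lines of $\Gamma$; a point of $\Gamma$ corresponds to the point of $\gamma$ dual to the tangent line of $\Gamma$ there. An inflection point is a smooth point at which the tangent line meets the curve with multiplicity at least $3$. Birkhoff billiard: let $\Omega$ be the domain bounded by $\gamma$. The billiard flow $g^t$ transports a tangent vector $v\in T_q\Omega$ parallel along the straight line in the direction of $v$ until collision with $\gamma$, where it is reflected by $v_+=v_--2N\langle v_-,N\rangle$, with $N$ the unit outward normal to $\gamma$. A polynomial integral on $\{|v|=1\}$ is a function $\Phi(q,v)$, polynomial in the components $(v_x,v_y)$ of $v$ (with coefficients depending on $q\in\Omega$), such that $\Phi\circ g^t=\Phi$ on $\{|v|=1\}$. *)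

theory Defs
  imports
    "HOL-Analysis.Analysis"
    "HOL-Computational_Algebra.Polynomial"
    "HOL-Library.Extended_Nat"
begin

section \<open>Tangent lines and duality in the plane\<close>

type_synonym plane = "real \<times> real"

text \<open>The tangent line at \<open>q\<close> is the limit of the secants of \<open>S\<close> through \<open>q\<close>: the sine of the
  angle between the secant and the line tends to \<open>0\<close>.\<close>

definition tangent_line :: "plane set \<Rightarrow> plane \<Rightarrow> plane set \<Rightarrow> bool" where
  "tangent_line S q L \<longleftrightarrow> q \<in> S \<and> q islimpt S \<and>
     (\<exists>\<nu>. norm \<nu> = 1 \<and> L = {X. \<nu> \<bullet> (X - q) = 0} \<and>
          ((\<lambda>X. \<nu> \<bullet> (X - q) / norm (X - q)) \<longlongrightarrow> 0) (at q within S))"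

definition dual_point :: "plane set \<Rightarrow> plane \<Rightarrow> bool" where
  "dual_point L P \<longleftrightarrow>
     (\<exists>\<nu> p. norm \<nu> = 1 \<and> p > 0 \<and> L = {X. \<nu> \<bullet> X = p} \<and> P = (1 / p) *\<^sub>R \<nu>)"

definition corresponds :: "plane set \<Rightarrow> plane \<Rightarrow> plane \<Rightarrow> bool" where
  "corresponds S q P \<longleftrightarrow> (\<exists>L. tangent_line S q L \<and> dual_point L P)"

definition dual_curve :: "plane set \<Rightarrow> plane set" where
  "dual_curve S = {P. \<exists>q. corresponds S q P}"

definition fermat_oval :: "nat \<Rightarrow> plane set" where
  "fermat_oval n = {(x, y). x ^ (2 * n) + y ^ (2 * n) = 1}"


section \<open>Convexity and smoothness of closed plane curves\<close>

definition strictly_convex_curve :: "plane set \<Rightarrow> bool" where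
  "strictly_convex_curve S \<longleftrightarrow>
     (\<exists>K. compact K \<and> convex K \<and> interior K \<noteq> {} \<and> S = frontier K \<and>
          (\<forall>a\<in>S. \<forall>b\<in>S. a \<noteq> b \<longrightarrow> open_segment a b \<subseteq> interior K))"

text \<open>A simple closed curve with a regular periodic parametrisation of class \<open>C\<^sup>1\<close>.\<close>

definition C1_closed_curve :: "plane set \<Rightarrow> bool" where
  "C1_closed_curve S \<longleftrightarrow>
     (\<exists>(c :: real \<Rightarrow> plane) c' T. T > 0 \<and>
        (\<forall>t. (c has_vector_derivative c' t) (at t)) \<and> continuous_on UNIV c' \<and>
        (\<forall>t. c' t \<noteq> 0) \<and> (\<forall>t. c (t + T) = c t) \<and> inj_on c {0..<T} \<and> S = range c)"


section \<open>Real plane curves as algebraic curves\<close>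

text \<open>A polynomial in \<open>x, y\<close> is a nested univariate one, with \<open>coeff (coeff F i) j\<close> the
  coefficient of \<open>x\<^sup>i y\<^sup>j\<close>.\<close>

definition eval2 :: "real poly poly \<Rightarrow> plane \<Rightarrow> real" where
  "eval2 F = (\<lambda>(x, y). poly (poly F [:x:]) y)"

definition gradient2 :: "real poly poly \<Rightarrow> plane \<Rightarrow> plane" where
  "gradient2 F q = (eval2 (pderiv F) q, eval2 (map_poly pderiv F) q)"

definition vanishing_ideal :: "plane set \<Rightarrow> real poly poly set" where
  "vanishing_ideal S = {F. \<forall>q\<in>S. eval2 F q = 0}"

text \<open>Smooth points of the algebraic curve spanned by \<open>S\<close>, that is, on its Zariski closure, which has
  the same vanishing ideal as \<open>S\<close>: the Jacobian matrix of the ideal has rank at least \<open>1\<close>.\<close>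

definition algebraically_smooth_at :: "plane set \<Rightarrow> plane \<Rightarrow> bool" where
  "algebraically_smooth_at S q \<longleftrightarrow> q \<in> S \<and> (\<exists>F\<in>vanishing_ideal S. gradient2 F q \<noteq> 0)"

definition singular_points :: "plane set \<Rightarrow> plane set" where
  "singular_points S = {q \<in> S. \<not> algebraically_smooth_at S q}"

text \<open>The univariate polynomial \<open>F (q + t w)\<close> in \<open>t\<close>.\<close>

definition restrict_to_line :: "real poly poly \<Rightarrow> plane \<Rightarrow> plane \<Rightarrow> real poly" where
  "restrict_to_line F q w =
     poly (map_poly (\<lambda>g. pcompose g [:snd q, snd w:]) F) [:fst q, fst w:]"

definition vanishing_order :: "real poly \<Rightarrow> enat" where
  "vanishing_order g = (if g = 0 then \<infinity> else enat (order 0 g))"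

text \<open>Intersection multiplicity at \<open>q\<close> of the algebraic curve spanned by \<open>S\<close> with the line
  through \<open>q\<close> in the direction \<open>w \<noteq> 0\<close>. The restriction of the ideal to the line is principal, so
  the multiplicity is the least vanishing order.\<close>

definition intersection_multiplicity :: "plane set \<Rightarrow> plane \<Rightarrow> plane \<Rightarrow> enat" where
  "intersection_multiplicity S q w =
     (INF F\<in>vanishing_ideal S. vanishing_order (restrict_to_line F q w))"

definition inflection_points :: "plane set \<Rightarrow> plane set" where
  "inflection_points S =
     {q. algebraically_smooth_at S q \<and>
         (\<exists>L w. tangent_line S q L \<and> w \<noteq> 0 \<and> q + w \<in> L \<and> intersection_multiplicity S q w \<ge> 3)}"


section \<open>Curves in the complex projective plane\<close>

type_synonym hvec = "complex \<times> complex \<times> complex"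

definition proportional :: "(hvec \<times> hvec) set" where
  "proportional = {((x, y, z), w). \<exists>c. c \<noteq> 0 \<and> w = (c * x, c * y, c * z)}"

definition CP2 :: "hvec set set" where
  "CP2 = (UNIV - {0}) // proportional"

definition affine_point :: "complex \<Rightarrow> complex \<Rightarrow> hvec set" where
  "affine_point x y = proportional `` {(x, y, 1)}"

text \<open>As above, \<open>coeff (coeff (coeff F i) j) k\<close> is the coefficient of \<open>X\<^sup>i Y\<^sup>j Z\<^sup>k\<close>.\<close>

definition eval3 :: "complex poly poly poly \<Rightarrow> hvec \<Rightarrow> complex" where
  "eval3 F = (\<lambda>(x, y, z). poly (poly (poly F [:[:x:]:]) [:y:]) z)"

definition gradient3 :: "complex poly poly poly \<Rightarrow> hvec \<Rightarrow> hvec" where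
  "gradient3 F v =
     (eval3 (pderiv F) v, eval3 (map_poly pderiv F) v, eval3 (map_poly (map_poly pderiv) F) v)"

definition homogeneous :: "complex poly poly poly \<Rightarrow> bool" where
  "homogeneous F \<longleftrightarrow>
     (\<exists>d. \<forall>i j k. coeff (coeff (coeff F i) j) k \<noteq> 0 \<longrightarrow> i + j + k = d)"

definition vanishes_at :: "complex poly poly poly \<Rightarrow> hvec set \<Rightarrow> bool" where
  "vanishes_at F p \<longleftrightarrow> (\<forall>v\<in>p. eval3 F v = 0)"

definition zariski_closed :: "hvec set set \<Rightarrow> bool" where
  "zariski_closed A \<longleftrightarrow>
     (\<exists>\<F>. (\<forall>F\<in>\<F>. homogeneous F) \<and> A = {p \<in> CP2. \<forall>F\<in>\<F>. vanishes_at F p})"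

definition projective_closure :: "(complex \<times> complex) set \<Rightarrow> hvec set set" where
  "projective_closure S =
     \<Inter> {A. zariski_closed A \<and> (\<forall>(x, y)\<in>S. affine_point x y \<in> A)}"

definition irreducible_set :: "hvec set set \<Rightarrow> bool" where
  "irreducible_set A \<longleftrightarrow> A \<noteq> {} \<and>
     (\<forall>B C. zariski_closed B \<longrightarrow> zariski_closed C \<longrightarrow> A \<subseteq> B \<union> C \<longrightarrow> A \<subseteq> B \<or> A \<subseteq> C)"

text \<open>Jacobian criterion for a plane curve; whether the gradient vanishes does not depend on the
  representative \<open>v\<close> of \<open>p\<close>.\<close>

definition nonsingular_curve :: "hvec set set \<Rightarrow> bool" where
  "nonsingular_curve A \<longleftrightarrow>
     (\<forall>p\<in>A. \<exists>F. homogeneous F \<and> (\<forall>r\<in>A. vanishes_at F r) \<and> (\<forall>v\<in>p. gradient3 F v \<noteq> 0))"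

definition fermat_curve :: "nat \<Rightarrow> (complex \<times> complex) set" where
  "fermat_curve n = {(x, y). x ^ (2 * n) + y ^ (2 * n) = 1}"


section \<open>Birkhoff billiards\<close>

text \<open>The billiard table is \<open>inside \<gamma>\<close>, the bounded part of the complement of \<open>\<gamma>\<close>.\<close>

definition outward_normal :: "plane set \<Rightarrow> plane \<Rightarrow> plane \<Rightarrow> bool" where
  "outward_normal \<gamma> p N \<longleftrightarrow> norm N = 1 \<and> tangent_line \<gamma> p {X. N \<bullet> (X - p) = 0} \<and>
     (\<exists>\<epsilon>>0. \<forall>s\<in>{0<..<\<epsilon>}. p + s *\<^sub>R N \<in> outside \<gamma> \<and> p - s *\<^sub>R N \<in> inside \<gamma>)"

definition reflection :: "plane \<Rightarrow> plane \<Rightarrow> plane" where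
  "reflection N v = v - (2 * (v \<bullet> N)) *\<^sub>R N"

text \<open>\<open>billiard_flow \<gamma> (q, v) t (q', v')\<close> means \<open>g\<^sup>t (q, v) = (q', v')\<close>, for \<open>t \<ge> 0\<close> and
  finitely many collisions up to time \<open>t\<close>. At the time of a collision the base point lies on
  \<open>\<gamma>\<close> and the velocity is the outgoing one.\<close>

inductive billiard_flow :: "plane set \<Rightarrow> plane \<times> plane \<Rightarrow> real \<Rightarrow> plane \<times> plane \<Rightarrow> bool"
  for \<gamma> :: "plane set" where
  start: "q \<in> inside \<gamma> \<Longrightarrow> billiard_flow \<gamma> (q, v) 0 (q, v)"
| glide: "\<lbrakk>billiard_flow \<gamma> a t (q, v); u > 0; \<forall>s\<in>{0<..u}. q + s *\<^sub>R v \<in> inside \<gamma>\<rbrakk>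
    \<Longrightarrow> billiard_flow \<gamma> a (t + u) (q + u *\<^sub>R v, v)"
| bounce: "\<lbrakk>billiard_flow \<gamma> a t (q, v); u > 0; \<forall>s\<in>{0<..<u}. q + s *\<^sub>R v \<in> inside \<gamma>;
     q + u *\<^sub>R v \<in> \<gamma>; outward_normal \<gamma> (q + u *\<^sub>R v) N\<rbrakk>
    \<Longrightarrow> billiard_flow \<gamma> a (t + u) (q + u *\<^sub>R v, reflection N v)"

definition polynomial_in_velocity :: "plane set \<Rightarrow> (plane \<Rightarrow> plane \<Rightarrow> real) \<Rightarrow> bool" where
  "polynomial_in_velocity \<Omega> \<Phi> \<longleftrightarrow>
     (\<exists>(d :: nat) (a :: nat \<Rightarrow> nat \<Rightarrow> plane \<Rightarrow> real). \<forall>q\<in>\<Omega>. \<forall>v.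
        \<Phi> q v = (\<Sum>i\<le>d. \<Sum>j\<le>d. a i j q * fst v ^ i * snd v ^ j))"

text \<open>\<open>\<Phi>\<close> is only defined over the open table, so invariance is tested at non-collision times.
  Invariance for \<open>t \<ge> 0\<close> gives it for \<open>t < 0\<close>, since \<open>g\<close> at time \<open>-t\<close> is the inverse of
  \<open>g\<close> at time \<open>t\<close>.\<close>

definition polynomial_integral :: "plane set \<Rightarrow> (plane \<Rightarrow> plane \<Rightarrow> real) \<Rightarrow> bool" where
  "polynomial_integral \<gamma> \<Phi> \<longleftrightarrow> polynomial_in_velocity (inside \<gamma>) \<Phi> \<and>
     (\<forall>q v t q' v'. norm v = 1 \<longrightarrow> billiard_flow \<gamma> (q, v) t (q', v') \<longrightarrow> q' \<in> inside \<gamma> \<longrightarrow>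
        \<Phi> q' v' = \<Phi> q v)"

definition birkhoff_integrable :: "plane set \<Rightarrow> bool" where
  "birkhoff_integrable \<gamma> \<longleftrightarrow>
     (\<exists>\<Phi>. polynomial_integral \<gamma> \<Phi> \<and>
          \<not> (\<exists>c. \<forall>q\<in>inside \<gamma>. \<forall>v. norm v = 1 \<longrightarrow> \<Phi> q v = c))"

end

theory Submission
  imports Defs "HOL-Complex_Analysis.Complex_Analysis"
begin

text \<open>
  Write \<open>N = 2n\<close>. The tangent line of \<open>x\<^sup>N + y\<^sup>N = 1\<close> at \<open>(u, v)\<close> has the equation
  \<open>u\<^bsup>N-1\<^esup> x + v\<^bsup>N-1\<^esup> y = 1\<close>, so duality is the restriction to the oval of the homeomorphism
  \<open>(u, v) \<mapsto> (u\<^bsup>N-1\<^esup>, v\<^bsup>N-1\<^esup>)\<close> of the plane, and the dual curve is a level set of the function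
  \<open>dual_gauge\<close>. Read through this homeomorphism, the inequality of Young says that the gauge lies
  above its tangent planes (\<open>gauge_support\<close>); this yields its differentiability, and with it the
  strict convexity and the smoothness of the dual curve.

  The complex curve is non-singular by its gradient. It is irreducible because it is totally
  ramified over \<open>x = 1\<close>: all \<open>N\<close> sheets over a point near \<open>1\<close> are values of the single holomorphic
  branch \<open>x = (1 - y\<^sup>N)\<^bsup>1/N\<^esup>\<close>, so a polynomial that vanishes on this branch vanishes on the whole
  curve (\<open>vanish_on_branch_imp_vanish\<close>), and of two polynomials with product zero on the curve one
  vanishes on the branch.

  Near \<open>(1, 0)\<close> the dual curve has points of height \<open>v\<^bsup>N-1\<^esup>\<close> at a distance of the exact order
  \<open>v\<^sup>N\<close> from the line \<open>x = 1\<close>. The two orders are different and smaller than the order \<open>2N - 2\<close> of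
  all quadratic terms, so a polynomial that vanishes on the curve has no linear part there. Away
  from the axes the equation of the curve, a product over the roots of unity in which only one
  factor vanishes, has a non-zero gradient.

  The heart is the non-integrability. An integral is constant along straight lines, hence it is a
  function of lines, and by duality a function \<open>F\<close> of the points \<open>r\<close> outside the Fermat oval, the line
  being \<open>r \<bullet> q = 1\<close>. For an even integral, made homogeneous of even degree \<open>2D\<close> in the velocity,
  the lines through a fixed point \<open>q\<close> of the table form a line of the dual plane, and on it
  \<open>F\<close> is a polynomial of degree at most \<open>2D\<close>; a function with this property is a polynomial
  (\<open>line_value_polynomial\<close>), however irregular the coefficients of the integral may be. The
  reflection law at a point of the table boundary becomes a symmetry of \<open>F\<close> on each tangent line of
  the oval:
  \<open>F (d + s w) = (1 + 2\<kappa>s)\<^bsup>2D\<^esup> F (d - s / (1 + 2\<kappa>s) w)\<close> with \<open>d\<close> the point of tangency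
  (\<open>line_value_reflect\<close>).

  To first order in \<open>s\<close> the symmetry says that \<open>F = c \<bar>r\<bar>\<^bsup>2D\<^esup>\<close> on the oval; subtract this polynomial,
  which has the same symmetry. Suppose that the difference vanishes to order exactly \<open>k \<ge> 1\<close>
  along an arc \<open>y = Y(x)\<close> of the oval, with leading coefficient \<open>c\<^sub>k(x)\<close> of \<open>(y - Y(x))\<^sup>k\<close>. Comparing
  the terms of order \<open>2k + 1\<close> in \<open>s\<close> gives a linear differential equation for \<open>c\<^sub>k\<close>, which says that
  \<open>c\<^sub>k\<^sup>3 Y''\<^sup>k = C \<bar>r\<bar>\<^bsup>6(D - k)\<^esup>\<close> for a constant \<open>C\<close>. At the inflection point \<open>(0, 1)\<close> we have \<open>Y'' = 0\<close>, so
  \<open>C = 0\<close> and \<open>c\<^sub>k = 0\<close>. Hence \<open>F = c \<bar>r\<bar>\<^bsup>2D\<^esup>\<close> everywhere, that is, the even integral is constant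
  (\<open>integral_constant\<close>). An arbitrary integral is reduced to even ones: its even part and the square
  of its odd part.
\<close>


section \<open>The complex Fermat curve\<close>

lemma map_poly_additive:
  assumes "f 0 = 0" "\<And>a b. f (a + b) = f a + f b"
  shows "map_poly f (p + q) = map_poly f p + map_poly f q"
  by (rule poly_eqI) (simp add: coeff_map_poly assms)

lemma map_poly_subtractive:
  assumes "f 0 = 0" "\<And>a b. f (a - b) = f a - f b"
  shows "map_poly f (p - q) = map_poly f p - map_poly f q"
  by (rule poly_eqI) (simp add: coeff_map_poly assms)

definition fermat_form :: "nat \<Rightarrow> complex poly poly poly" where
  "fermat_form n = monom 1 (2 * n) + [:monom 1 (2 * n):] - [:[:monom 1 (2 * n):]:]"

lemma eval3_fermat_form: "eval3 (fermat_form n) (x, y, z) = x ^ (2 * n) + y ^ (2 * n) - z ^ (2 * n)"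
  by (simp add: eval3_def fermat_form_def poly_monom poly_const_pow)

lemma gradient3_fermat_form:
  "gradient3 (fermat_form n) (x, y, z) =
    (2 * of_nat n * x ^ (2 * n - 1), 2 * of_nat n * y ^ (2 * n - 1), - (2 * of_nat n * z ^ (2 * n - 1)))"
proof -
  have 1: "pderiv (fermat_form n) = monom (of_nat (2 * n)) (2 * n - 1)"
    by (simp add: fermat_form_def pderiv_add pderiv_diff pderiv_monom pderiv_pCons)
  have 2: "map_poly pderiv (fermat_form n) = [:monom (of_nat (2 * n)) (2 * n - 1):]"
    unfolding fermat_form_def
    by (simp add: map_poly_additive map_poly_subtractive pderiv_add pderiv_diff map_poly_monom map_poly_pCons pderiv_monom pderiv_pCons)
  have a: "map_poly pderiv (p + q) = map_poly pderiv p + map_poly pderiv q"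
    "map_poly pderiv (p - q) = map_poly pderiv p - map_poly pderiv q" for p q :: "complex poly poly"
    by (simp_all add: map_poly_additive map_poly_subtractive pderiv_add pderiv_diff)
  have 3: "map_poly (map_poly pderiv) (fermat_form n) = - [:[:monom (of_nat (2 * n)) (2 * n - 1):]:]"
    unfolding fermat_form_def
    by (simp add: map_poly_additive map_poly_subtractive a map_poly_monom map_poly_pCons pderiv_monom map_poly_1)
  show ?thesis
    unfolding gradient3_def 1 2 3 by (simp add: eval3_def poly_monom poly_const_pow)
qed

lemma homogeneous_fermat_form: "homogeneous (fermat_form n)"
  unfolding homogeneous_def fermat_form_def
  by (intro exI[of _ "2 * n"]) (auto simp: coeff_pCons coeff_1 split: nat.splits if_splits)

lemma eval3_expand:
  "eval3 F (x, y, z) = (\<Sum>i\<le>degree F. \<Sum>j\<le>degree (coeff F i). \<Sum>k\<le>degree (coeff (coeff F i) j).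
     coeff (coeff (coeff F i) j) k * (x ^ i * y ^ j * z ^ k))"
proof -
  have "eval3 F (x, y, z) = (\<Sum>i\<le>degree F. x ^ i * poly (poly (coeff F i) [:y:]) z)"
    by (simp add: eval3_def poly_altdef[of F] poly_sum poly_const_pow mult.commute)
  also have "\<dots> = (\<Sum>i\<le>degree F. x ^ i * (\<Sum>j\<le>degree (coeff F i). y ^ j * poly (coeff (coeff F i) j) z))"
    by (simp add: poly_altdef[of "coeff F _"] poly_sum poly_const_pow mult.commute)
  also have "\<dots> = (\<Sum>i\<le>degree F. x ^ i * (\<Sum>j\<le>degree (coeff F i). y ^ j *
      (\<Sum>k\<le>degree (coeff (coeff F i) j). coeff (coeff (coeff F i) j) k * z ^ k)))"
    by (simp only: poly_altdef[of "coeff (coeff F _) _"])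
  finally show ?thesis by (simp add: sum_distrib_left mult_ac)
qed

lemma eval3_homogeneous:
  assumes "homogeneous F"
  shows "\<exists>d. \<forall>c x y z. eval3 F (c * x, c * y, c * z) = c ^ d * eval3 F (x, y, z)"
proof -
  obtain d where d: "\<And>i j k. coeff (coeff (coeff F i) j) k \<noteq> 0 \<Longrightarrow> i + j + k = d"
    using assms unfolding homogeneous_def by blast
  have t: "coeff (coeff (coeff F i) j) k * ((c * x) ^ i * (c * y) ^ j * (c * z) ^ k)
    = c ^ d * (coeff (coeff (coeff F i) j) k * (x ^ i * y ^ j * z ^ k))" for i j k c x y z
  proof (cases "coeff (coeff (coeff F i) j) k = 0")
    case False
    from d[OF this] have "c ^ d = c ^ i * c ^ j * c ^ k" by (simp flip: power_add)
    then show ?thesis by (simp add: power_mult_distrib mult_ac)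
  qed simp
  have "eval3 F (c * x, c * y, c * z) = c ^ d * eval3 F (x, y, z)" for c x y z
    unfolding eval3_expand sum_distrib_left by (intro sum.cong refl t)
  then show ?thesis by blast
qed

lemma mem_affine_point: "v \<in> affine_point x y \<longleftrightarrow> (\<exists>c. c \<noteq> 0 \<and> v = (c * x, c * y, c))"
  by (auto simp: affine_point_def proportional_def)

lemma vanishes_at_affine_point:
  assumes "homogeneous F"
  shows "vanishes_at F (affine_point x y) \<longleftrightarrow> eval3 F (x, y, 1) = 0"
proof -
  obtain d where d: "\<And>c x y z. eval3 F (c * x, c * y, c * z) = c ^ d * eval3 F (x, y, z)"
    using eval3_homogeneous[OF assms] by blast
  have e: "eval3 F (c * x, c * y, c) = c ^ d * eval3 F (x, y, 1)" for c using d[of c x y 1] by simp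
  show ?thesis unfolding vanishes_at_def Ball_def mem_affine_point
    using e[of 1] by (auto simp: e intro: exI[of _ 1])
qed

lemma affine_point_CP2: "affine_point x y \<in> CP2"
  unfolding CP2_def affine_point_def by (rule quotientI) (simp add: zero_prod_def)

lemma CP2_nonzero:
  assumes "p \<in> CP2" "v \<in> p" shows "v \<noteq> 0"
  using assms by (auto simp: CP2_def quotient_def proportional_def zero_prod_def)

lemma zariski_closed_fermat: "zariski_closed {p \<in> CP2. vanishes_at (fermat_form n) p}"
  unfolding zariski_closed_def using homogeneous_fermat_form by (intro exI[of _ "{fermat_form n}"]) auto

lemma projective_closure_fermat_subset:
  "projective_closure (fermat_curve n) \<subseteq> {p \<in> CP2. vanishes_at (fermat_form n) p}"
  unfolding projective_closure_def
  by (rule Inter_lower) (auto simp: zariski_closed_fermat affine_point_CP2 fermat_curve_def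
     vanishes_at_affine_point[OF homogeneous_fermat_form] eval3_fermat_form)

lemma nonsingular_fermat:
  assumes n: "n > 0"
  shows "nonsingular_curve (projective_closure (fermat_curve n))"
  unfolding nonsingular_curve_def
proof (intro ballI exI[of _ "fermat_form n"] conjI homogeneous_fermat_form)
  fix r assume "r \<in> projective_closure (fermat_curve n)"
  then show "vanishes_at (fermat_form n) r" using projective_closure_fermat_subset by blast
next
  fix p v assume "p \<in> projective_closure (fermat_curve n)" "v \<in> p"
  then have "v \<noteq> 0" using CP2_nonzero projective_closure_fermat_subset by blast
  then show "gradient3 (fermat_form n) v \<noteq> 0"
    using n by (cases v) (auto simp: gradient3_fermat_form zero_prod_def)
qed

text \<open>Division by the equation of the curve, monic in \<open>y\<close>: replacing \<open>y\<^sup>N\<close> by \<open>1 - x\<^sup>N\<close> leaves a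
  remainder of degree less than \<open>N\<close> in \<open>y\<close>.\<close>

lemma reduce_on_fermat_curve:
  fixes a :: "nat \<Rightarrow> nat \<Rightarrow> complex"
  assumes T: "finite T" and N: "N > 0"
  shows "\<exists>r. \<forall>x y. x ^ N + y ^ N = 1 \<longrightarrow>
    (\<Sum>(i, j)\<in>T. a i j * x ^ i * y ^ j) = (\<Sum>l<N. poly (r l) x * y ^ l)"
proof -
  define r where "r = (\<lambda>l. \<Sum>(i, j)\<in>{t \<in> T. snd t mod N = l}. monom (a i j) i * (1 - monom 1 N) ^ (j div N))"
  have "(\<Sum>(i, j)\<in>T. a i j * x ^ i * y ^ j) = (\<Sum>l<N. poly (r l) x * y ^ l)" if xy: "x ^ N + y ^ N = 1" for x y
  proof -
    have yN: "y ^ N = 1 - x ^ N" using xy by (simp add: algebra_simps)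
    have "(\<Sum>l<N. poly (r l) x * y ^ l) = (\<Sum>l<N. \<Sum>t\<in>{t \<in> T. snd t mod N = l}. a (fst t) (snd t) * x ^ fst t * y ^ snd t)"
    proof (intro sum.cong refl)
      fix l
      have "poly (r l) x * y ^ l = (\<Sum>t\<in>{t \<in> T. snd t mod N = l}. a (fst t) (snd t) * x ^ fst t * (1 - x ^ N) ^ (snd t div N) * y ^ l)"
        by (simp add: r_def poly_sum case_prod_beta poly_monom sum_distrib_right)
      also have "\<dots> = (\<Sum>t\<in>{t \<in> T. snd t mod N = l}. a (fst t) (snd t) * x ^ fst t * y ^ snd t)"
      proof (intro sum.cong refl)
        fix t assume "t \<in> {t \<in> T. snd t mod N = l}"
        then have "y ^ snd t = (y ^ N) ^ (snd t div N) * y ^ l"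
          by (metis (mono_tags, lifting) mem_Collect_eq mult_div_mod_eq power_add power_mult)
        then show "a (fst t) (snd t) * x ^ fst t * (1 - x ^ N) ^ (snd t div N) * y ^ l = a (fst t) (snd t) * x ^ fst t * y ^ snd t"
          by (simp add: yN)
      qed
      finally show "poly (r l) x * y ^ l = (\<Sum>t\<in>{t \<in> T. snd t mod N = l}. a (fst t) (snd t) * x ^ fst t * y ^ snd t)" .
    qed
    also have "\<dots> = (\<Sum>t\<in>T. a (fst t) (snd t) * x ^ fst t * y ^ snd t)"
      by (rule sum.group[OF T finite_lessThan]) (use N in auto)
    finally show ?thesis by (simp add: case_prod_beta)
  qed
  then show ?thesis by blast
qed

text \<open>The principal branch of the curve through \<open>(1, 0)\<close>. It depends on \<open>y\<close> only through \<open>y\<^sup>N\<close>, so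
  that it takes the same value at all \<open>N\<close> roots of an equation \<open>y\<^sup>N = c\<close>.\<close>

definition branch :: "nat \<Rightarrow> complex \<Rightarrow> complex" where
  "branch N y = (1 - y ^ N) powr (1 / of_nat N)"

lemma branch_base:
  fixes y :: complex
  assumes "N > 0" "norm y < 1"
  shows "1 - y ^ N \<notin> \<real>\<^sub>\<le>\<^sub>0"
proof
  assume "1 - y ^ N \<in> \<real>\<^sub>\<le>\<^sub>0"
  then have "Re (1 - y ^ N) \<le> 0" by (auto simp: complex_nonpos_Reals_iff)
  then have "1 \<le> Re (y ^ N)" by simp
  also have "\<dots> \<le> norm (y ^ N)" by (rule complex_Re_le_cmod)
  also have "\<dots> < 1" using assms by (simp add: norm_power power_less_one_iff)
  finally show False by simp
qed

lemma branch_power: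
  assumes "N > 0" "norm y < 1"
  shows "branch N y ^ N + y ^ N = 1"
proof -
  have nz: "1 - y ^ N \<noteq> 0" using branch_base[OF assms] by auto
  have "branch N y ^ N = (1 - y ^ N) powr (of_nat N * (1 / of_nat N))"
    unfolding branch_def using nz by (simp add: powr_def exp_of_nat_mult[symmetric])
  then show ?thesis using assms(1) nz by simp
qed

text \<open>All \<open>N\<close> points of the curve over \<open>x = branch N t\<close> lie on the branch, since the roots of
  \<open>w\<^sup>N = t\<^sup>N\<close> again have modulus less than \<open>1\<close> and the same image. So the remainder of the
  polynomial, of degree less than \<open>N\<close> in \<open>y\<close>, has \<open>N\<close> zeros there, and each of its coefficients
  vanishes at infinitely many \<open>x\<close>.\<close>

lemma vanish_on_branch_imp_vanish:
  fixes a :: "nat \<Rightarrow> nat \<Rightarrow> complex"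
  assumes T: "finite T" and N: "N > 0"
    and b: "\<And>y. norm y < 1 \<Longrightarrow> (\<Sum>(i, j)\<in>T. a i j * branch N y ^ i * y ^ j) = 0"
    and xy: "x ^ N + y ^ N = 1"
  shows "(\<Sum>(i, j)\<in>T. a i j * x ^ i * y ^ j) = 0"
proof -
  obtain r where r: "\<And>x y. x ^ N + y ^ N = 1 \<Longrightarrow>
    (\<Sum>(i, j)\<in>T. a i j * x ^ i * y ^ j) = (\<Sum>l<N. poly (r l) x * y ^ l)"
    using reduce_on_fermat_curve[OF T N] by blast
  have z: "poly (r l) (branch N (of_real t)) = 0" if t: "0 < t" "t < 1" and l: "l < N" for t l
  proof -
    define x0 where "x0 = branch N (of_real t)"
    define p where "p = (\<Sum>l<N. monom (poly (r l) x0) l)"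
    \<comment> \<open>The ordinates of the points of the curve over \<open>x0\<close>.\<close>
    let ?W = "{w. w ^ N = complex_of_real t ^ N}"
    have "poly p w = poly 0 w" if w: "w \<in> ?W" for w
    proof -
      from w have "w ^ N = complex_of_real t ^ N" by simp
      then have "norm (w ^ N) = norm (complex_of_real t ^ N)" by (rule arg_cong)
      then have "norm w ^ N = t ^ N" using t by (simp add: norm_power)
      then have "norm w = t" by (rule power_eq_imp_eq_base) (use t N in auto)
      then have w1: "norm w < 1" using t by simp
      have bw: "branch N w = x0" using w by (simp add: branch_def x0_def)
      have "poly p w = (\<Sum>l<N. poly (r l) x0 * w ^ l)" by (simp add: p_def poly_sum poly_monom)
      also have "\<dots> = 0" using r[OF branch_power[OF N w1]] b[OF w1] unfolding bw by simp
      finally show ?thesis by simp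
    qed
    moreover have cW: "card ?W = N" using card_nth_roots[of "complex_of_real t ^ N" N] N t by simp
    moreover have "degree p < N"
    proof -
      have "degree p \<le> N - 1" unfolding p_def
      proof (rule degree_sum_le)
        fix i assume "i \<in> {..<N}"
        then show "degree (monom (poly (r i) x0) i) \<le> N - 1"
          using degree_monom_le[of "poly (r i) x0" i] by simp
      qed simp
      then show ?thesis using N by linarith
    qed
    ultimately have "p = 0" using N by (intro poly_eqI_degree[of ?W]) auto
    then have "coeff p l = 0" by simp
    moreover have "coeff p l = poly (r l) x0" using l by (simp add: p_def coeff_sum)
    ultimately show ?thesis by (simp add: x0_def)
  qed
  have "r l = 0" if l: "l < N" for l
  proof (rule ccontr)
    assume "r l \<noteq> 0"
    then have "finite {x. poly (r l) x = 0}" by (rule poly_roots_finite)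
    moreover have "(\<lambda>t. branch N (of_real t)) ` {0<..<1} \<subseteq> {x. poly (r l) x = 0}" using z l by auto
    ultimately have "finite ((\<lambda>t. branch N (of_real t)) ` {0<..<1})" by (rule finite_subset[rotated])
    moreover have "inj_on (\<lambda>t. branch N (of_real t)) {0<..<1}"
    proof (rule inj_onI)
      fix s t :: real assume st: "s \<in> {0<..<1}" "t \<in> {0<..<1}" "branch N (of_real s) = branch N (of_real t)"
      have e: "complex_of_real (t ^ N) = 1 - branch N (of_real t) ^ N" if "t \<in> {0<..<1}" for t
      proof -
        have "norm (complex_of_real t) < 1" using that by simp
        then have "branch N (of_real t) ^ N + complex_of_real (t ^ N) = 1"
          using branch_power[OF N] by (simp only: of_real_power)
        then show ?thesis by (simp only: eq_diff_eq add.commute)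
      qed
      have "complex_of_real (s ^ N) = of_real (t ^ N)" by (simp only: e[OF st(1)] e[OF st(2)] st(3))
      then have "s ^ N = t ^ N" by (simp only: of_real_eq_iff)
      then show "s = t" by (rule power_eq_imp_eq_base) (use st N in auto)
    qed
    ultimately have "finite {0<..<1::real}" using finite_imageD by blast
    then show False by (simp add: infinite_Ioo)
  qed
  then show ?thesis using r[OF xy] by simp
qed

text \<open>Along the branch the two polynomials are holomorphic functions on a disc with product zero,
  so one of them is zero.\<close>

lemma fermat_curve_prime:
  fixes a b :: "nat \<Rightarrow> nat \<Rightarrow> complex"
  assumes T: "finite T" "finite T'" and N: "N > 0"
    and ab: "\<And>x y. x ^ N + y ^ N = 1 \<Longrightarrow>
      (\<Sum>(i, j)\<in>T. a i j * x ^ i * y ^ j) = 0 \<or> (\<Sum>(i, j)\<in>T'. b i j * x ^ i * y ^ j) = 0"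
  shows "(\<forall>x y. x ^ N + y ^ N = 1 \<longrightarrow> (\<Sum>(i, j)\<in>T. a i j * x ^ i * y ^ j) = 0) \<or>
    (\<forall>x y. x ^ N + y ^ N = 1 \<longrightarrow> (\<Sum>(i, j)\<in>T'. b i j * x ^ i * y ^ j) = 0)"
proof -
  define f where "f = (\<lambda>y. \<Sum>(i, j)\<in>T. a i j * branch N y ^ i * y ^ j)"
  define g where "g = (\<lambda>y. \<Sum>(i, j)\<in>T'. b i j * branch N y ^ i * y ^ j)"
  have hb: "branch N holomorphic_on ball 0 1" unfolding branch_def
    by (intro holomorphic_intros) (use branch_base[OF N] in auto)
  have hol: "f holomorphic_on ball 0 1" "g holomorphic_on ball 0 1"
    unfolding f_def g_def case_prod_beta by (intro holomorphic_intros hb)+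
  have fg: "f y = 0 \<or> g y = 0" if "norm y < 1" for y
    unfolding f_def g_def by (rule ab) (rule branch_power[OF N that])
  have "(\<forall>y\<in>ball 0 1. f y = 0) \<or> (\<forall>y\<in>ball 0 1. g y = 0)"
  proof (rule disjCI)
    assume "\<not> (\<forall>y\<in>ball 0 1. g y = 0)"
    then obtain z where z: "z \<in> ball 0 1" "g z \<noteq> 0" by blast
    \<comment> \<open>Where \<open>g\<close> is not zero, an open set, \<open>f\<close> is zero.\<close>
    define U where "U = ball 0 1 \<inter> g -` (- {0})"
    have "open U" unfolding U_def
      by (rule continuous_open_preimage[OF holomorphic_on_imp_continuous_on[OF hol(2)]]) auto
    moreover have "z \<in> U" using z by (simp add: U_def)
    ultimately have "z islimpt U" by (simp add: interior_limit_point interior_open)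
    show "\<forall>y\<in>ball 0 1. f y = 0"
    proof
      fix y :: complex assume y: "y \<in> ball 0 1"
      show "f y = 0"
        by (rule analytic_continuation[OF hol(1) _ _ _ z(1) \<open>z islimpt U\<close> _ y])
           (use fg in \<open>auto simp: U_def\<close>)
    qed
  qed
  then show ?thesis
  proof
    assume "\<forall>y\<in>ball 0 1. f y = 0"
    then have "f y = 0" if "norm y < 1" for y using that by simp
    then show ?thesis using vanish_on_branch_imp_vanish[OF T(1) N, of a] unfolding f_def by blast
  next
    assume "\<forall>y\<in>ball 0 1. g y = 0"
    then have "g y = 0" if "norm y < 1" for y using that by simp
    then show ?thesis using vanish_on_branch_imp_vanish[OF T(2) N, of b] unfolding g_def by blast
  qed
qed

text \<open>Setting \<open>z = 1\<close> leaves a polynomial in \<open>x, y\<close>, here as a finite sum of monomials.\<close>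

lemma eval3_affine:
  "\<exists>T a. finite T \<and> (\<forall>x y. eval3 F (x, y, 1) = (\<Sum>(i, j)\<in>T. a i j * x ^ i * y ^ j))"
proof (intro exI conjI allI)
  show "finite (SIGMA i:{..degree F}. {..degree (coeff F i)})" by auto
  fix x y
  show "eval3 F (x, y, 1) = (\<Sum>(i, j)\<in>(SIGMA i:{..degree F}. {..degree (coeff F i)}).
    (\<Sum>k\<le>degree (coeff (coeff F i) j). coeff (coeff (coeff F i) j) k) * x ^ i * y ^ j)"
    unfolding eval3_expand by (subst sum.Sigma[symmetric]) (auto simp: sum_distrib_right mult.assoc)
qed

text \<open>If neither closed set contains the curve, each has an equation that is not satisfied on all
  of the affine curve, while the product of the two equations vanishes on it; this contradicts
  \<open>fermat_curve_prime\<close>. Affine points suffice because the closure is the least closed set that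
  contains them.\<close>

lemma irreducible_fermat:
  assumes n: "n > 0"
  shows "irreducible_set (projective_closure (fermat_curve n))"
  unfolding irreducible_set_def
proof (intro conjI allI impI)
  let ?S = "fermat_curve n" let ?A = "projective_closure ?S"
  have mem: "affine_point x y \<in> ?A" if "(x, y) \<in> ?S" for x y
    unfolding projective_closure_def using that by blast
  have least: "?A \<subseteq> B" if "zariski_closed B" "\<And>x y. (x, y) \<in> ?S \<Longrightarrow> affine_point x y \<in> B" for B
    unfolding projective_closure_def by (rule Inter_lower) (use that in auto)
  have "(1, 0) \<in> ?S" using n by (simp add: fermat_curve_def power_0_left)
  then show "?A \<noteq> {}" using mem by blast
  fix B C assume BC: "zariski_closed B" "zariski_closed C" "?A \<subseteq> B \<union> C"
  have separate: "\<exists>F. (\<forall>x' y'. affine_point x' y' \<in> B \<longrightarrow> eval3 F (x', y', 1) = 0) \<and> eval3 F (x, y, 1) \<noteq> 0"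
    if B: "zariski_closed B" and p: "affine_point x y \<notin> B" for B x y
  proof -
    obtain \<F> where F: "\<And>F. F \<in> \<F> \<Longrightarrow> homogeneous F" "B = {p \<in> CP2. \<forall>F\<in>\<F>. vanishes_at F p}"
      using B unfolding zariski_closed_def by blast
    then obtain F where "F \<in> \<F>" "\<not> vanishes_at F (affine_point x y)" using p affine_point_CP2 by blast
    then show ?thesis using F vanishes_at_affine_point by blast
  qed
  show "?A \<subseteq> B \<or> ?A \<subseteq> C"
  proof (rule ccontr)
    assume "\<not> (?A \<subseteq> B \<or> ?A \<subseteq> C)"
    then obtain x1 y1 x2 y2 where 1: "(x1, y1) \<in> ?S" "affine_point x1 y1 \<notin> B"
      and 2: "(x2, y2) \<in> ?S" "affine_point x2 y2 \<notin> C"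
      using least BC by meson
    obtain F where F: "\<And>x y. affine_point x y \<in> B \<Longrightarrow> eval3 F (x, y, 1) = 0" "eval3 F (x1, y1, 1) \<noteq> 0"
      using separate[OF BC(1) 1(2)] by blast
    obtain G where G: "\<And>x y. affine_point x y \<in> C \<Longrightarrow> eval3 G (x, y, 1) = 0" "eval3 G (x2, y2, 1) \<noteq> 0"
      using separate[OF BC(2) 2(2)] by blast
    obtain T a where a: "finite T" "\<And>x y. eval3 F (x, y, 1) = (\<Sum>(i, j)\<in>T. a i j * x ^ i * y ^ j)"
      using eval3_affine[of F] by blast
    obtain T' b where b: "finite T'" "\<And>x y. eval3 G (x, y, 1) = (\<Sum>(i, j)\<in>T'. b i j * x ^ i * y ^ j)"
      using eval3_affine[of G] by blast
    have "eval3 F (x, y, 1) = 0 \<or> eval3 G (x, y, 1) = 0" if "x ^ (2 * n) + y ^ (2 * n) = 1" for x y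
      using mem[of x y] that BC(3) F(1) G(1) by (auto simp: fermat_curve_def)
    then have "(\<forall>x y. x ^ (2 * n) + y ^ (2 * n) = 1 \<longrightarrow> eval3 F (x, y, 1) = 0) \<or>
      (\<forall>x y. x ^ (2 * n) + y ^ (2 * n) = 1 \<longrightarrow> eval3 G (x, y, 1) = 0)"
      unfolding a(2) b(2) by (intro fermat_curve_prime a b) (use n in auto)
    then show False using F(2) G(2) 1(1) 2(1) by (auto simp: fermat_curve_def)
  qed
qed


section \<open>The dual oval as a level set\<close>

text \<open>The inequality of Bernoulli for \<open>t\<^sup>2\<close>, with \<open>t = a / b\<close>, gives Young's inequality together
  with a quadratic gap, from which the case of equality can be read off.\<close>

lemma young_gap:
  fixes a b :: real
  assumes "n > 1"
  shows "2 * real n * a * b ^ (2 * n - 1) + real n * (a - b)\<^sup>2 * b ^ (2 * n - 2)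
     \<le> a ^ (2 * n) + (2 * real n - 1) * b ^ (2 * n)"
proof (cases "b = 0")
  case True
  then show ?thesis using assms by (simp add: power_0_left)
next
  case False
  define t where "t = a / b"
  have a: "a = t * b" using False by (simp add: t_def)
  have "1 + real n * (t\<^sup>2 - 1) \<le> (1 + (t\<^sup>2 - 1)) ^ n"
    by (rule Bernoulli_inequality) simp
  then have 1: "2 * real n * t + real n * (t - 1)\<^sup>2 \<le> t ^ (2 * n) + (2 * real n - 1)"
    unfolding power_mult by (simp add: power2_diff right_diff_distrib) (simp add: algebra_simps)
  obtain k where k: "n = Suc k" using assms by (cases n) auto
  define B where "B = b ^ (2 * n - 2)"
  have B: "b ^ (2 * n - 1) = b * B" "b ^ (2 * n) = b * (b * B)"
    by (simp_all add: B_def k)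
  have "(2 * real n * t + real n * (t - 1)\<^sup>2) * b ^ (2 * n) \<le> (t ^ (2 * n) + (2 * real n - 1)) * b ^ (2 * n)"
    using 1 by (intro mult_right_mono) (auto simp: zero_le_even_power)
  also have "(2 * real n * t + real n * (t - 1)\<^sup>2) * b ^ (2 * n)
      = 2 * real n * a * (b * B) + real n * (a - b)\<^sup>2 * B"
  proof -
    have "(2 * N * t + N * (t - 1)\<^sup>2) * (b * (b * B)) = 2 * N * (t * b) * (b * B) + N * (t * b - b)\<^sup>2 * B" for N
      by (simp add: algebra_simps power2_eq_square)
    then show ?thesis unfolding a B .
  qed
  also have "(t ^ (2 * n) + (2 * real n - 1)) * b ^ (2 * n) = a ^ (2 * n) + (2 * real n - 1) * b ^ (2 * n)"
    unfolding a by (simp add: distrib_right power_mult_distrib)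
  finally show ?thesis unfolding B(1) B_def .
qed

lemma young_strict:
  fixes a b :: real
  assumes "n > 1" "a \<noteq> b"
  shows "2 * real n * a * b ^ (2 * n - 1) < a ^ (2 * n) + (2 * real n - 1) * b ^ (2 * n)"
proof (cases "b = 0")
  case True
  then have "a ^ (2 * n) > 0" using assms by (simp add: zero_less_power_eq)
  then show ?thesis using assms True by (simp add: power_0_left)
next
  case False
  then have "0 < real n * (a - b)\<^sup>2 * b ^ (2 * n - 2)" using assms
    by (intro mult_pos_pos zero_less_power2[THEN iffD2]) (auto simp: zero_less_power_eq)
  then show ?thesis using young_gap[OF assms(1), of a b] by linarith
qed

text \<open>The real odd root and the odd power, for \<open>n > 1\<close> inverse to each other on the whole real
  line, signs included.\<close>

definition oroot :: "nat \<Rightarrow> real \<Rightarrow> real" where "oroot n = root (2 * n - 1)"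
definition opow :: "nat \<Rightarrow> real \<Rightarrow> real" where "opow n u = u ^ (2 * n - 1)"

lemma opow_oroot: "n > 1 \<Longrightarrow> opow n (oroot n x) = x"
  and oroot_opow: "n > 1 \<Longrightarrow> oroot n (opow n u) = u"
  unfolding oroot_def opow_def by (auto intro!: odd_real_root_pow odd_real_root_power_cancel)

lemma continuous_on_oroot: "continuous_on S (oroot n)"
  unfolding oroot_def by (intro continuous_intros)

text \<open>The power \<open>\<bar>x\<bar>\<^bsup>2n/(2n-1)\<^esup>\<close> is an even power of the odd root, so it becomes a polynomial in
  the coordinates of the Fermat oval.\<close>

lemma powr_eq_oroot:
  assumes "n > 1"
  shows "\<bar>x\<bar> powr (2 * real n / (2 * real n - 1)) = oroot n x ^ (2 * n)"
proof (cases "x = 0")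
  case False
  have m: "2 * n - 1 > 0" using assms by simp
  have "oroot n x ^ (2 * n) = \<bar>oroot n x\<bar> ^ (2 * n)" by (simp add: power_even_abs)
  also have "\<bar>oroot n x\<bar> = root (2 * n - 1) \<bar>x\<bar>" using m by (simp add: oroot_def real_root_abs)
  also have "\<dots> = \<bar>x\<bar> powr (1 / real (2 * n - 1))" using m False by (simp add: root_powr_inverse)
  also have "\<dots> ^ (2 * n) = \<bar>x\<bar> powr (1 / real (2 * n - 1) * real (2 * n))"
    by (subst powr_powr[symmetric]) (use False in \<open>simp add: powr_realpow[symmetric]\<close>)
  also have "1 / real (2 * n - 1) * real (2 * n) = 2 * real n / (2 * real n - 1)"
    using assms by (simp add: of_nat_diff)
  finally show ?thesis by simp
qed (use assms in \<open>simp add: oroot_def\<close>)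

definition dual_exponent :: "nat \<Rightarrow> real" where "dual_exponent n = 2 * real n / (2 * real n - 1)"

text \<open>Young's inequality for \<open>a = oroot n c\<close> and \<open>b = oroot n z\<close>.\<close>

lemma oroot_support:
  assumes "n > 1"
  shows "oroot n c ^ (2 * n) + dual_exponent n * oroot n c * (z - c) \<le> oroot n z ^ (2 * n)"
    and "z \<noteq> c \<Longrightarrow> oroot n c ^ (2 * n) + dual_exponent n * oroot n c * (z - c) < oroot n z ^ (2 * n)"
proof -
  define a b where "a = oroot n c" and "b = oroot n z"
  have c: "c = a ^ (2 * n - 1)" and z: "z = b ^ (2 * n - 1)"
    using opow_oroot[OF assms] by (auto simp: a_def b_def opow_def)
  have m: "2 * real n - 1 > 0" using assms by simp
  have pow: "a * a ^ (2 * n - 1) = a ^ (2 * n)" using assms by (simp flip: power_Suc)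
  have eq: "a ^ (2 * n) + dual_exponent n * a * (z - c) = (2 * real n * a * b ^ (2 * n - 1) - a ^ (2 * n)) / (2 * real n - 1)"
    using m pow unfolding dual_exponent_def c z by (simp add: field_simps)
  have "2 * real n * a * b ^ (2 * n - 1) \<le> a ^ (2 * n) + (2 * real n - 1) * b ^ (2 * n)"
    by (rule order_trans[OF _ young_gap[OF assms]]) (simp add: zero_le_even_power)
  then have "a ^ (2 * n) + dual_exponent n * a * (z - c) \<le> b ^ (2 * n)"
    unfolding eq using m by (simp add: field_simps)
  then show "oroot n c ^ (2 * n) + dual_exponent n * oroot n c * (z - c) \<le> oroot n z ^ (2 * n)"
    by (simp add: a_def b_def)
  assume "z \<noteq> c"
  then have "a \<noteq> b" by (auto simp: c z)
  from young_strict[OF assms this] have "a ^ (2 * n) + dual_exponent n * a * (z - c) < b ^ (2 * n)"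
    unfolding eq using m by (simp add: field_simps)
  then show "oroot n c ^ (2 * n) + dual_exponent n * oroot n c * (z - c) < oroot n z ^ (2 * n)"
    by (simp add: a_def b_def)
qed

lemma dual_exponent_pos: "n > 1 \<Longrightarrow> dual_exponent n > 0" by (simp add: dual_exponent_def)

text \<open>A function that lies above affine functions with continuous slope is differentiable with
  this slope. At \<open>0\<close>, where the root itself is not differentiable, the same argument applies.\<close>

lemma oroot_pow_deriv:
  assumes "n > 1"
  shows "((\<lambda>z. oroot n z ^ (2 * n)) has_real_derivative dual_exponent n * oroot n c) (at c)"
  unfolding has_field_derivative_iff
proof -
  let ?q = "\<lambda>z. (oroot n z ^ (2 * n) - oroot n c ^ (2 * n)) / (z - c)"
  \<comment> \<open>Squeeze between the support inequality at \<open>c\<close> and the one at \<open>z\<close>.\<close>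
  have bd: "norm (?q z - dual_exponent n * oroot n c) \<le> dual_exponent n * \<bar>oroot n z - oroot n c\<bar>" if "z \<noteq> c" for z
  proof -
    have 1: "dual_exponent n * oroot n c * (z - c) \<le> oroot n z ^ (2 * n) - oroot n c ^ (2 * n)"
      using oroot_support(1)[OF assms, of c z] by simp
    have 2: "oroot n z ^ (2 * n) - oroot n c ^ (2 * n) \<le> dual_exponent n * oroot n z * (z - c)"
      using oroot_support(1)[OF assms, of z c] by (simp add: algebra_simps)
    have "\<bar>(oroot n z ^ (2 * n) - oroot n c ^ (2 * n)) - dual_exponent n * oroot n c * (z - c)\<bar>
        \<le> dual_exponent n * (oroot n z - oroot n c) * (z - c)"
      using 1 2 by (simp add: algebra_simps)
    also have "\<dots> \<le> dual_exponent n * \<bar>oroot n z - oroot n c\<bar> * \<bar>z - c\<bar>"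
      using abs_ge_self[of "dual_exponent n * (oroot n z - oroot n c) * (z - c)"] dual_exponent_pos[OF assms]
      by (simp add: abs_mult)
    finally have "\<bar>(oroot n z ^ (2 * n) - oroot n c ^ (2 * n)) - dual_exponent n * oroot n c * (z - c)\<bar> / \<bar>z - c\<bar>
        \<le> dual_exponent n * \<bar>oroot n z - oroot n c\<bar>"
      using that by (simp add: divide_le_eq)
    moreover have "?q z - dual_exponent n * oroot n c
      = ((oroot n z ^ (2 * n) - oroot n c ^ (2 * n)) - dual_exponent n * oroot n c * (z - c)) / (z - c)"
      using that by (simp add: field_simps)
    ultimately show ?thesis by simp
  qed
  have "isCont (oroot n) c" unfolding oroot_def by (intro continuous_intros)
  then have "((\<lambda>z. dual_exponent n * \<bar>oroot n z - oroot n c\<bar>) \<longlongrightarrow> dual_exponent n * \<bar>oroot n c - oroot n c\<bar>) (at c)"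
    by (intro tendsto_intros) (simp add: isCont_def)
  then have "((\<lambda>z. dual_exponent n * \<bar>oroot n z - oroot n c\<bar>) \<longlongrightarrow> 0) (at c)" by simp
  then have "((\<lambda>z. ?q z - dual_exponent n * oroot n c) \<longlongrightarrow> 0) (at c)"
    by (rule Lim_null_comparison[rotated]) (use bd in \<open>auto simp: eventually_at_filter\<close>)
  then show "(?q \<longlongrightarrow> dual_exponent n * oroot n c) (at c)" by (simp add: LIM_zero_iff)
qed

definition dual_gauge :: "nat \<Rightarrow> plane \<Rightarrow> real" where
  "dual_gauge n P = oroot n (fst P) ^ (2 * n) + oroot n (snd P) ^ (2 * n)"

text \<open>At a point of the dual curve this is the corresponding point of the Fermat oval; up to the
  factor \<open>dual_exponent n\<close> it is also the gradient of the gauge.\<close>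

definition dual_vec :: "nat \<Rightarrow> plane \<Rightarrow> plane" where
  "dual_vec n P = (oroot n (fst P), oroot n (snd P))"

definition pow_map :: "nat \<Rightarrow> plane \<Rightarrow> plane" where
  "pow_map n q = (opow n (fst q), opow n (snd q))"

lemma pow_map_dual_vec: "n > 1 \<Longrightarrow> pow_map n (dual_vec n P) = P"
  and dual_vec_pow_map: "n > 1 \<Longrightarrow> dual_vec n (pow_map n q) = q"
  by (simp_all add: pow_map_def dual_vec_def opow_oroot oroot_opow)

lemma gauge_support:
  assumes "n > 1"
  shows "dual_gauge n C + dual_exponent n * (dual_vec n C \<bullet> (Z - C)) \<le> dual_gauge n Z"
    and "Z \<noteq> C \<Longrightarrow> dual_gauge n C + dual_exponent n * (dual_vec n C \<bullet> (Z - C)) < dual_gauge n Z"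
proof -
  note s = oroot_support[OF assms, where c="fst C" and z="fst Z"] oroot_support[OF assms, where c="snd C" and z="snd Z"]
  have e: "dual_exponent n * (dual_vec n C \<bullet> (Z - C)) = dual_exponent n * oroot n (fst C) * (fst Z - fst C) + dual_exponent n * oroot n (snd C) * (snd Z - snd C)"
    by (simp add: dual_vec_def inner_prod_def algebra_simps)
  show "dual_gauge n C + dual_exponent n * (dual_vec n C \<bullet> (Z - C)) \<le> dual_gauge n Z"
    unfolding e dual_gauge_def using s(1,3) by linarith
  assume "Z \<noteq> C"
  then have "fst Z \<noteq> fst C \<or> snd Z \<noteq> snd C" by (simp add: prod_eq_iff)
  then show "dual_gauge n C + dual_exponent n * (dual_vec n C \<bullet> (Z - C)) < dual_gauge n Z"
    unfolding e dual_gauge_def using s by (smt (verit))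
qed

lemma dual_vec_inner: "n > 1 \<Longrightarrow> dual_vec n P \<bullet> P = dual_gauge n P"
proof -
  assume n: "n > 1"
  have "oroot n x * x = oroot n x ^ (2 * n)" for x
  proof -
    have "oroot n x * x = oroot n x * oroot n x ^ (2 * n - 1)" using opow_oroot[OF n, of x] by (simp add: opow_def)
    also have "\<dots> = oroot n x ^ (2 * n)" using n by (simp flip: power_Suc)
    finally show ?thesis .
  qed
  then show ?thesis by (simp add: dual_vec_def inner_prod_def dual_gauge_def)
qed

lemma gauge_deriv:
  assumes "n > 1"
  shows "(dual_gauge n has_derivative (\<lambda>w. dual_exponent n * (dual_vec n P \<bullet> w))) (at P)"
proof -
  have d: "((\<lambda>z. oroot n z ^ (2 * n)) has_derivative (\<lambda>h. dual_exponent n * oroot n c * h)) (at c)" for c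
    using oroot_pow_deriv[OF assms, of c] by (simp add: has_field_derivative_def)
  have 1: "((\<lambda>P::plane. oroot n (fst P) ^ (2 * n)) has_derivative (\<lambda>w. dual_exponent n * oroot n (fst P) * fst w)) (at P)"
    by (rule has_derivative_compose[where f=fst, OF _ d]) (auto intro!: derivative_eq_intros)
  have 2: "((\<lambda>P::plane. oroot n (snd P) ^ (2 * n)) has_derivative (\<lambda>w. dual_exponent n * oroot n (snd P) * snd w)) (at P)"
    by (rule has_derivative_compose[where f=snd, OF _ d]) (auto intro!: derivative_eq_intros)
  have "dual_gauge n = (\<lambda>P. oroot n (fst P) ^ (2 * n) + oroot n (snd P) ^ (2 * n))" by (auto simp: dual_gauge_def)
  then show ?thesis using has_derivative_add[OF 1 2]
    by (simp add: dual_vec_def inner_prod_def algebra_simps)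
qed

lemma continuous_gauge: "n > 1 \<Longrightarrow> continuous_on S (dual_gauge n)"
  by (meson continuous_at_imp_continuous_on gauge_deriv has_derivative_continuous)

text \<open>Convexity follows from the supporting planes at the intermediate point \<open>c\<close>, whose linear
  parts cancel in the convex combination.\<close>

lemma gauge_convex_comb:
  assumes "n > 1" "0 \<le> s" "s \<le> 1"
  shows "dual_gauge n ((1 - s) *\<^sub>R a + s *\<^sub>R b) \<le> (1 - s) * dual_gauge n a + s * dual_gauge n b"
    and "0 < s \<Longrightarrow> s < 1 \<Longrightarrow> a \<noteq> b \<Longrightarrow>
      dual_gauge n ((1 - s) *\<^sub>R a + s *\<^sub>R b) < (1 - s) * dual_gauge n a + s * dual_gauge n b"
proof -
  define c where "c = (1 - s) *\<^sub>R a + s *\<^sub>R b"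
  have z: "(1 - s) *\<^sub>R (a - c) + s *\<^sub>R (b - c) = 0" by (simp add: c_def algebra_simps)
  have "(1 - s) * (dual_vec n c \<bullet> (a - c)) + s * (dual_vec n c \<bullet> (b - c)) = dual_vec n c \<bullet> ((1 - s) *\<^sub>R (a - c) + s *\<^sub>R (b - c))"
    by (simp add: inner_add_right)
  then have "(1 - s) * (dual_vec n c \<bullet> (a - c)) + s * (dual_vec n c \<bullet> (b - c)) = 0" using z by simp
  moreover have "(1 - s) * (g + p * d1) + s * (g + p * d2) = g + p * ((1 - s) * d1 + s * d2)" for g p d1 d2 :: real
    by (simp add: algebra_simps)
  note e0 = this
  ultimately have e: "(1 - s) * (dual_gauge n c + dual_exponent n * (dual_vec n c \<bullet> (a - c))) + s * (dual_gauge n c + dual_exponent n * (dual_vec n c \<bullet> (b - c))) = dual_gauge n c"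
    by (simp only: e0 mult_zero_right add_0_right)
  have "(1 - s) * (dual_gauge n c + dual_exponent n * (dual_vec n c \<bullet> (a - c))) \<le> (1 - s) * dual_gauge n a"
    by (rule mult_left_mono) (use gauge_support[OF assms(1)] assms in auto)
  moreover have "s * (dual_gauge n c + dual_exponent n * (dual_vec n c \<bullet> (b - c))) \<le> s * dual_gauge n b"
    by (rule mult_left_mono) (use gauge_support[OF assms(1)] assms in auto)
  ultimately show "dual_gauge n ((1 - s) *\<^sub>R a + s *\<^sub>R b) \<le> (1 - s) * dual_gauge n a + s * dual_gauge n b"
    using e unfolding c_def[symmetric] by linarith
  assume s: "0 < s" "s < 1" "a \<noteq> b"
  then have "a - c = s *\<^sub>R (a - b)" "b - c = (1 - s) *\<^sub>R (b - a)" by (simp_all add: c_def algebra_simps)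
  with s have "a \<noteq> c" "b \<noteq> c" by auto
  have "(1 - s) * (dual_gauge n c + dual_exponent n * (dual_vec n c \<bullet> (a - c))) < (1 - s) * dual_gauge n a"
    by (rule mult_strict_left_mono) (use gauge_support[OF assms(1)] s \<open>a \<noteq> c\<close> in auto)
  moreover have "s * (dual_gauge n c + dual_exponent n * (dual_vec n c \<bullet> (b - c))) < s * dual_gauge n b"
    by (rule mult_strict_left_mono) (use gauge_support[OF assms(1)] s \<open>b \<noteq> c\<close> in auto)
  ultimately show "dual_gauge n ((1 - s) *\<^sub>R a + s *\<^sub>R b) < (1 - s) * dual_gauge n a + s * dual_gauge n b"
    using e unfolding c_def[symmetric] by linarith
qed

lemma gauge_zero: "n > 1 \<Longrightarrow> dual_gauge n 0 = 0"
  by (simp add: dual_gauge_def oroot_def)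

lemma gauge_le_1_bound:
  assumes "n > 1" "dual_gauge n P \<le> 1"
  shows "\<bar>fst P\<bar> \<le> 1" "\<bar>snd P\<bar> \<le> 1"
proof -
  have b: "\<bar>x\<bar> \<le> 1" if "oroot n x ^ (2 * n) \<le> 1" for x
  proof -
    have "\<bar>oroot n x\<bar> ^ (2 * n) \<le> 1" using that by (simp add: power_even_abs)
    then have "\<bar>oroot n x\<bar> \<le> 1" using assms(1)
      by (subst (asm) power_le_one_iff) auto
    moreover have "\<bar>x\<bar> = \<bar>oroot n x\<bar> ^ (2 * n - 1)"
      using opow_oroot[OF assms(1), of x] by (metis opow_def power_abs)
    ultimately show ?thesis by (simp add: power_le_one)
  qed
  have "0 \<le> oroot n (fst P) ^ (2 * n)" "0 \<le> oroot n (snd P) ^ (2 * n)" by (simp_all add: zero_le_even_power)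
  then show "\<bar>fst P\<bar> \<le> 1" "\<bar>snd P\<bar> \<le> 1" using assms(2) b unfolding dual_gauge_def by (smt (verit))+
qed

lemma compact_gauge_le: "n > 1 \<Longrightarrow> compact {P. dual_gauge n P \<le> 1}"
proof -
  assume n: "n > 1"
  have "closed {P. dual_gauge n P \<le> 1}"
    by (intro closed_Collect_le continuous_intros continuous_gauge n)
  moreover have "bounded {P. dual_gauge n P \<le> 1}"
  proof (rule boundedI)
    fix P assume "P \<in> {P. dual_gauge n P \<le> 1}"
    then have "\<bar>fst P\<bar> \<le> 1" "\<bar>snd P\<bar> \<le> 1" using gauge_le_1_bound[OF n] by auto
    moreover have "norm P \<le> norm (fst P) + norm (snd P)" using norm_Pair_le[of "fst P" "snd P"] by simp
    ultimately show "norm P \<le> 2" by simp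
  qed
  ultimately show ?thesis by (simp add: compact_eq_bounded_closed)
qed

lemma convex_gauge_le: "n > 1 \<Longrightarrow> convex {P. dual_gauge n P \<le> 1}"
  unfolding convex_alt mem_Collect_eq
proof safe
  fix a b :: plane and s :: real
  assume n: "n > 1" and g: "dual_gauge n a \<le> 1" "dual_gauge n b \<le> 1" and s: "0 \<le> s" "s \<le> 1"
  have "(1 - s) * dual_gauge n a + s * dual_gauge n b \<le> (1 - s) * 1 + s * 1"
    using g s by (intro add_mono mult_left_mono) auto
  then show "dual_gauge n ((1 - s) *\<^sub>R a + s *\<^sub>R b) \<le> 1"
    using gauge_convex_comb(1)[OF n s, of a b] by simp
qed

lemma dual_vec_nz: "n > 1 \<Longrightarrow> dual_gauge n P = 1 \<Longrightarrow> dual_vec n P \<noteq> 0"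
  using dual_vec_inner[of n P] by auto

lemma gauge_outward:
  assumes "n > 1" "dual_gauge n P = 1" "s > 0"
  shows "dual_gauge n (P + s *\<^sub>R dual_vec n P) > 1"
proof -
  have "0 < dual_exponent n * (dual_vec n P \<bullet> (P + s *\<^sub>R dual_vec n P - P))"
    using dual_vec_nz[OF assms(1,2)] assms dual_exponent_pos by simp
  then show ?thesis using gauge_support(1)[OF assms(1), of P "P + s *\<^sub>R dual_vec n P"] assms by linarith
qed

text \<open>The derivative of the gauge in the direction \<open>w\<close> is negative.\<close>

lemma gauge_inward:
  assumes "n > 1" "dual_gauge n P = 1" "dual_vec n P \<bullet> w < 0"
  shows "\<exists>e>0. \<forall>s\<in>{0<..<e}. dual_gauge n (P + s *\<^sub>R w) < 1"
proof -
  have "((\<lambda>s. dual_gauge n (P + s *\<^sub>R w)) has_derivative (\<lambda>h. dual_exponent n * (dual_vec n P \<bullet> (h *\<^sub>R w)))) (at 0)"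
    by (rule has_derivative_compose[where g="dual_gauge n" and f="\<lambda>s. P + s *\<^sub>R w", of "\<lambda>h. h *\<^sub>R w"])
       (use gauge_deriv[OF assms(1), of P] in \<open>auto intro!: derivative_eq_intros\<close>)
  then have "((\<lambda>s. dual_gauge n (P + s *\<^sub>R w)) has_real_derivative dual_exponent n * (dual_vec n P \<bullet> w)) (at 0)"
    by (simp add: has_field_derivative_def mult_commute_abs mult.left_commute)
  from DERIV_neg_dec_right[OF this] assms dual_exponent_pos[OF assms(1)]
  show ?thesis by (auto simp: mult_pos_neg)
qed

lemma interior_gauge_le: "n > 1 \<Longrightarrow> interior {P. dual_gauge n P \<le> 1} = {P. dual_gauge n P < 1}"
proof (rule interior_unique)
  assume n: "n > 1"
  show "open {P. dual_gauge n P < 1}" by (intro open_Collect_less continuous_intros continuous_gauge n)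
  fix T assume T: "T \<subseteq> {P. dual_gauge n P \<le> 1}" "open T"
  show "T \<subseteq> {P. dual_gauge n P < 1}"
  proof
    fix P assume P: "P \<in> T"
    show "P \<in> {P. dual_gauge n P < 1}"
    proof (rule ccontr)
      assume "P \<notin> {P. dual_gauge n P < 1}"
      with P T have g: "dual_gauge n P = 1" by force
      let ?r = "dual_vec n P"
      obtain e where e: "e > 0" "ball P e \<subseteq> T" using T(2) P open_contains_ball by blast
      \<comment> \<open>A step along the gradient leaves the level set, so a boundary point is not interior.\<close>
      define s where "s = e / (2 * norm ?r)"
      have nr: "norm ?r > 0" using dual_vec_nz[OF n g] by simp
      have "P + s *\<^sub>R ?r \<in> ball P e" using e nr by (simp add: s_def dist_norm)
      then have "dual_gauge n (P + s *\<^sub>R ?r) \<le> 1" using e T by auto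
      moreover have "s > 0" using e nr by (simp add: s_def)
      ultimately show False using gauge_outward[OF n g] by force
    qed
  qed
qed auto

lemma frontier_gauge_le: "n > 1 \<Longrightarrow> frontier {P. dual_gauge n P \<le> 1} = {P. dual_gauge n P = 1}"
  using compact_gauge_le[of n] interior_gauge_le[of n]
  by (auto simp: frontier_def compact_eq_bounded_closed)

lemma inside_gauge: "n > 1 \<Longrightarrow> inside {P. dual_gauge n P = 1} = {P. dual_gauge n P < 1}"
  using inside_frontier_eq_interior[of "{P. dual_gauge n P \<le> 1}"] frontier_gauge_le interior_gauge_le
    compact_gauge_le convex_gauge_le by (simp add: compact_eq_bounded_closed)

lemma outside_gauge: "n > 1 \<Longrightarrow> outside {P. dual_gauge n P = 1} = {P. dual_gauge n P > 1}"
  using outside_frontier_eq_complement_closure[of "{P. dual_gauge n P \<le> 1}"] frontier_gauge_le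
    compact_gauge_le convex_gauge_le by (auto simp: compact_eq_bounded_closed)

lemma strictly_convex_gauge: "n > 1 \<Longrightarrow> strictly_convex_curve {P. dual_gauge n P = 1}"
  unfolding strictly_convex_curve_def
proof (intro exI[of _ "{P. dual_gauge n P \<le> 1}"] conjI ballI impI)
  assume n: "n > 1"
  show "compact {P. dual_gauge n P \<le> 1}" "convex {P. dual_gauge n P \<le> 1}"
    using n compact_gauge_le convex_gauge_le by auto
  have "0 \<in> {P. dual_gauge n P < 1}" using gauge_zero[OF n] by simp
  then show "interior {P. dual_gauge n P \<le> 1} \<noteq> {}" unfolding interior_gauge_le[OF n] by blast
  show "{P. dual_gauge n P = 1} = frontier {P. dual_gauge n P \<le> 1}" using frontier_gauge_le[OF n] by simp
  fix a b assume ab: "a \<in> {P. dual_gauge n P = 1}" "b \<in> {P. dual_gauge n P = 1}" "a \<noteq> b"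
  show "open_segment a b \<subseteq> interior {P. dual_gauge n P \<le> 1}"
    unfolding interior_gauge_le[OF n]
  proof
    fix c assume "c \<in> open_segment a b"
    then obtain s where "0 < s" "s < 1" "c = (1 - s) *\<^sub>R a + s *\<^sub>R b" by (auto simp: in_segment)
    then show "c \<in> {P. dual_gauge n P < 1}" using gauge_convex_comb(2)[OF n, of s a b] ab by simp
  qed
qed

lemma gauge_scale: "n > 1 \<Longrightarrow> c > 0 \<Longrightarrow> dual_gauge n (c *\<^sub>R P) = c powr dual_exponent n * dual_gauge n P"
  unfolding dual_gauge_def powr_eq_oroot[symmetric]
  by (simp add: abs_mult powr_mult dual_exponent_def algebra_simps)

lemma gauge_pos: "n > 1 \<Longrightarrow> P \<noteq> 0 \<Longrightarrow> dual_gauge n P > 0"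
  using gauge_support(2)[of n P 0] gauge_zero[of n]
  by (simp add: dual_vec_def oroot_def flip: zero_prod_def)


section \<open>Tangent lines and duality\<close>

lemma gauge_one_nonzero: "n > 1 \<Longrightarrow> dual_gauge n P = 1 \<Longrightarrow> P \<noteq> 0"
  using gauge_zero by force

text \<open>Polar coordinates: on the ray with direction \<open>e t\<close> the curve is reached at the radius
  \<open>1 / h t\<close>, by homogeneity of the gauge. The parametrisation is regular since its component along
  \<open>e' t\<close> is \<open>1 / h t\<close>.\<close>

lemma C1_closed_curve_gauge:
  assumes n: "n > 1"
  shows "C1_closed_curve {P. dual_gauge n P = 1}"
proof -
  define e e' :: "real \<Rightarrow> plane" where "e = (\<lambda>t. (cos t, sin t))" and "e' = (\<lambda>t. (- sin t, cos t))"
  define h where "h = (\<lambda>t. dual_gauge n (e t) powr (1 / dual_exponent n))"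
  define h' where "h' = (\<lambda>t. dual_gauge n (e t) powr (1 / dual_exponent n - 1) * (dual_vec n (e t) \<bullet> e' t))"
  define c where "c = (\<lambda>t. (1 / h t) *\<^sub>R e t)"
  define c' where "c' = (\<lambda>t. (1 / h t) *\<^sub>R e' t - (h' t / (h t)\<^sup>2) *\<^sub>R e t)"
  have p: "dual_exponent n > 0" by (rule dual_exponent_pos[OF n])
  have ne: "norm (e t) = 1" for t by (simp add: e_def norm_Pair)
  then have "e t \<noteq> 0" for t by (metis norm_zero zero_neq_one)
  then have gp: "dual_gauge n (e t) > 0" for t using gauge_pos[OF n] by blast
  then have hp: "h t > 0" for t by (simp add: h_def powr_def less_imp_neq[THEN not_sym])
  have de: "(e has_vector_derivative e' t) (at t)" for t
    unfolding e_def e'_def by (auto intro!: derivative_eq_intros has_vector_derivative_Pair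
      simp: has_real_derivative_iff_has_vector_derivative[symmetric])
  have dg: "((\<lambda>t. dual_gauge n (e t)) has_real_derivative dual_exponent n * (dual_vec n (e t) \<bullet> e' t)) (at t)" for t
  proof -
    have "((\<lambda>t. dual_gauge n (e t)) has_derivative (\<lambda>k. dual_exponent n * (dual_vec n (e t) \<bullet> (k *\<^sub>R e' t)))) (at t)"
      by (rule has_derivative_compose[where g="dual_gauge n" and f=e, of "\<lambda>h. h *\<^sub>R e' t"])
         (use gauge_deriv[OF n, of "e t"] de[of t] in \<open>auto simp: has_vector_derivative_def\<close>)
    then show ?thesis by (simp add: has_field_derivative_def mult_commute_abs mult.left_commute)
  qed
  have dh: "(h has_real_derivative h' t) (at t)" for t
    unfolding h_def h'_def
    by (rule DERIV_cong[OF DERIV_fun_powr[OF dg gp]]) (use p in simp)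
  have dc: "(c has_vector_derivative c' t) (at t)" for t
  proof -
    have "((\<lambda>t. 1 / h t) has_real_derivative - (h' t / (h t)\<^sup>2)) (at t)"
      by (rule DERIV_cong[OF DERIV_divide[OF DERIV_const dh]]) (use hp[of t] in \<open>auto simp: power2_eq_square field_simps\<close>)
    from has_vector_derivative_scaleR[OF this de] show ?thesis
      unfolding c_def c'_def by simp
  qed
  have orth: "e t \<bullet> e' t = 0" "e' t \<bullet> e' t = 1" for t
    by (simp_all add: e_def e'_def inner_prod_def flip: power2_eq_square)
  have "c' t \<bullet> e' t = 1 / h t" for t by (simp add: c'_def inner_diff_left orth)
  then have c'0: "c' t \<noteq> 0" for t using hp[of t] by (metis divide_eq_0_iff inner_zero_left less_irrefl zero_neq_one)
  have ce: "continuous_on UNIV e" "continuous_on UNIV e'" unfolding e_def e'_def by (auto intro!: continuous_intros)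
  have cg: "continuous_on UNIV (\<lambda>t. dual_gauge n (e t))"
    by (rule continuous_on_compose2[OF continuous_gauge[OF n, of UNIV] ce(1)]) simp
  have cd: "continuous_on UNIV (\<lambda>t. dual_vec n (e t))"
    unfolding dual_vec_def by (intro continuous_on_Pair continuous_on_compose2[OF continuous_on_oroot[of UNIV]] continuous_intros ce) auto
  have ch: "continuous_on UNIV h" unfolding h_def
    by (intro continuous_intros cg) (use gp in \<open>force dest: less_imp_neq\<close>)
  have ch': "continuous_on UNIV h'" unfolding h'_def
    by (intro continuous_intros cg cd ce) (use gp in \<open>force dest: less_imp_neq\<close>)
  have hn: "h t \<noteq> 0" "(h t)\<^sup>2 \<noteq> 0" for t using hp[of t] by auto
  have "continuous_on UNIV c'" unfolding c'_def
    by (intro continuous_intros ce ch ch') (use hn in auto)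
  moreover have per: "c (t + 2 * pi) = c t" for t
    unfolding c_def h_def e_def by simp
  moreover have "inj_on c {0..<2 * pi}"
  proof (rule inj_onI)
    fix s t assume st: "s \<in> {0..<2 * pi}" "t \<in> {0..<2 * pi}" "c s = c t"
    then have "norm (c s) = norm (c t)" by simp
    then have "h s = h t" using hp[of s] hp[of t] by (simp add: c_def ne)
    with st have "e s = e t" using hn[of t] by (simp add: c_def)
    then have "sin s = sin t \<and> cos s = cos t" by (simp add: e_def)
    then obtain k :: int where k: "s = t + 2 * pi * k" using sin_cos_eq_iff by blast
    have "2 * pi * k < 2 * pi * 1" "2 * pi * (-1) < 2 * pi * k"
      using k st(1,2) by (simp_all only: atLeastLessThan_iff) linarith+
    then have "real_of_int k < 1" "-1 < real_of_int k"
      using mult_less_cancel_left_pos[of "2 * pi"] pi_gt_zero by (metis mult_pos_pos zero_less_numeral)+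
    then have "k = 0" by linarith
    with k show "s = t" by simp
  qed
  moreover have "{P. dual_gauge n P = 1} = range c"
  proof (intro set_eqI iffI)
    fix P assume "P \<in> range c"
    then obtain t where P: "P = (1 / h t) *\<^sub>R e t" by (auto simp: c_def)
    have "h t powr dual_exponent n = dual_gauge n (e t)" using p gp[of t] by (simp add: h_def powr_powr)
    then show "P \<in> {P. dual_gauge n P = 1}" using gauge_scale[OF n, of "1 / h t" "e t"] hp[of t] gp[of t]
      by (simp add: P powr_divide)
  next
    fix P assume P: "P \<in> {P. dual_gauge n P = 1}"
    define r where "r = norm P"
    have r: "r > 0" using P gauge_one_nonzero[OF n] by (auto simp: r_def)
    have "(fst P)\<^sup>2 + (snd P)\<^sup>2 = r\<^sup>2" by (simp add: r_def norm_prod_def)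
    then have "(fst P / r)\<^sup>2 + (snd P / r)\<^sup>2 = 1" using r by (simp add: power_divide field_simps)
    then obtain t where "fst P / r = cos t" "snd P / r = sin t" using sincos_total_2pi_le by blast
    then have Pe: "P = r *\<^sub>R e t" using r by (simp add: e_def prod_eq_iff field_simps)
    have "r powr dual_exponent n * dual_gauge n (e t) = 1" using P gauge_scale[OF n r, of "e t"] Pe by simp
    then have "dual_gauge n (e t) = (1 / r) powr dual_exponent n" using r by (simp add: powr_divide field_simps)
    then have "h t = 1 / r" using r p by (simp add: h_def powr_powr)
    then have "c t = P" using r Pe by (simp add: c_def)
    then show "P \<in> range c" by blast
  qed
  ultimately show ?thesis unfolding C1_closed_curve_def
    using dc c'0 pi_gt_zero by (intro exI[of _ c] exI[of _ c'] exI[of _ "2 * pi"]) auto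
qed

lemma connected_gauge: "n > 1 \<Longrightarrow> connected {P. dual_gauge n P = 1}"
proof -
  assume "n > 1"
  then obtain c :: "real \<Rightarrow> plane" and c' where d: "\<And>t. (c has_vector_derivative c' t) (at t)"
    and S: "{P. dual_gauge n P = 1} = range c"
    using C1_closed_curve_gauge[of n] unfolding C1_closed_curve_def by metis
  have "continuous_on UNIV c"
    by (meson continuous_at_imp_continuous_on d has_vector_derivative_continuous)
  then show ?thesis unfolding S by (rule connected_continuous_image) simp
qed

lemma fermat_oval_iff_gauge: "n > 1 \<Longrightarrow> q \<in> fermat_oval n \<longleftrightarrow> dual_gauge n (pow_map n q) = 1"
  by (cases q) (simp add: fermat_oval_def dual_gauge_def pow_map_def oroot_opow)

lemma fermat_oval_eq_image: "n > 1 \<Longrightarrow> fermat_oval n = dual_vec n ` {P. dual_gauge n P = 1}"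
proof (intro set_eqI iffI)
  fix q assume n: "1 < n" and q: "q \<in> fermat_oval n"
  show "q \<in> dual_vec n ` {P. dual_gauge n P = 1}"
    by (rule image_eqI[of _ _ "pow_map n q"]) (use q fermat_oval_iff_gauge[OF n] dual_vec_pow_map[OF n] in auto)
next
  fix q assume n: "1 < n" and "q \<in> dual_vec n ` {P. dual_gauge n P = 1}"
  then show "q \<in> fermat_oval n"
    using fermat_oval_iff_gauge[OF n] pow_map_dual_vec[OF n] by auto
qed

lemma oroot_simps: "n > 1 \<Longrightarrow> oroot n 0 = 0" "n > 1 \<Longrightarrow> oroot n 1 = 1" "n > 1 \<Longrightarrow> oroot n (- x) = - oroot n x"
  by (simp_all add: oroot_def real_root_minus)

lemma gauge_islimpt: "n > 1 \<Longrightarrow> dual_gauge n P = 1 \<Longrightarrow> P islimpt {P. dual_gauge n P = 1}"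
proof (rule connected_imp_perfect)
  assume n: "n > 1"
  show "connected {P. dual_gauge n P = 1}" by (rule connected_gauge[OF n])
  have "(1, 0) \<in> {P. dual_gauge n P = 1}" "(0, 1) \<in> {P. dual_gauge n P = 1}"
    using n by (auto simp: dual_gauge_def oroot_simps power_0_left)
  then show "{P. dual_gauge n P = 1} \<noteq> {a}" for a by (metis prod.inject singletonD zero_neq_one)
qed auto

lemma fermat_oval_islimpt: "n > 1 \<Longrightarrow> q \<in> fermat_oval n \<Longrightarrow> q islimpt fermat_oval n"
proof (rule connected_imp_perfect)
  assume n: "n > 1"
  have "continuous_on {P. dual_gauge n P = 1} (dual_vec n)"
    unfolding dual_vec_def by (intro continuous_on_Pair continuous_on_compose2[OF continuous_on_oroot[of UNIV]] continuous_intros) auto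
  then show "connected (fermat_oval n)" unfolding fermat_oval_eq_image[OF n]
    by (rule connected_continuous_image) (rule connected_gauge[OF n])
  have "(1, 0) \<in> fermat_oval n" "(0, 1) \<in> fermat_oval n"
    using n by (auto simp: fermat_oval_def power_0_left)
  then show "fermat_oval n \<noteq> {a}" for a by (metis prod.inject singletonD zero_neq_one)
qed auto

text \<open>On a level set the linear part of the function is negligible, which is the definition of a
  tangent line.\<close>

lemma tangent_line_gradient:
  assumes f: "(f has_derivative (\<lambda>w. G \<bullet> w)) (at q)" and G: "G \<noteq> 0"
    and q: "q \<in> S" "q islimpt S" and c: "\<And>X. X \<in> S \<Longrightarrow> f X = f q"
  shows "tangent_line S q {X. G \<bullet> (X - q) = 0}"
  unfolding tangent_line_def
proof (intro conjI q exI[of _ "(1 / norm G) *\<^sub>R G"])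
  show "norm ((1 / norm G) *\<^sub>R G) = 1" using G by simp
  show "{X. G \<bullet> (X - q) = 0} = {X. (1 / norm G) *\<^sub>R G \<bullet> (X - q) = 0}" using G by auto
  have "((\<lambda>X. (f X - f q - G \<bullet> (X - q)) / norm (X - q)) \<longlongrightarrow> 0) (at q within S)"
    using has_derivative_at_withinI[OF f, of S]
    by (simp add: has_derivative_within divide_inverse mult.commute diff_diff_eq)
  from tendsto_mult[OF tendsto_const[of "- (1 / norm G)"] this]
  have "((\<lambda>X. - (1 / norm G) * ((f X - f q - G \<bullet> (X - q)) / norm (X - q))) \<longlongrightarrow> 0) (at q within S)"
    by simp
  then show "((\<lambda>X. (1 / norm G) *\<^sub>R G \<bullet> (X - q) / norm (X - q)) \<longlongrightarrow> 0) (at q within S)"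
    by (rule Lim_transform_eventually) (auto simp: eventually_at_filter c)
qed

lemma orthogonal_unit_plane:
  fixes \<nu> e Y :: plane
  assumes "\<nu> \<bullet> e = 0" "norm \<nu> = 1" "norm e = 1"
  shows "\<nu> \<bullet> Y = 0 \<longleftrightarrow> Y = (Y \<bullet> e) *\<^sub>R e"
proof
  assume "Y = (Y \<bullet> e) *\<^sub>R e"
  then have "\<nu> \<bullet> Y = (Y \<bullet> e) * (\<nu> \<bullet> e)" by (metis inner_scaleR_right)
  then show "\<nu> \<bullet> Y = 0" using assms by simp
next
  assume Y: "\<nu> \<bullet> Y = 0"
  obtain a b where nu: "\<nu> = (a, b)" by (cases \<nu>)
  obtain c d where e: "e = (c, d)" by (cases e)
  obtain y z where yz: "Y = (y, z)" by (cases Y)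
  have 1: "a * c + b * d = 0" "a * y + b * z = 0" using assms Y by (simp_all add: nu e yz inner_prod_def)
  have 2: "a\<^sup>2 + b\<^sup>2 = 1" "c\<^sup>2 + d\<^sup>2 = 1" using assms by (simp_all add: nu e norm_Pair)
  have "(a * d - b * c)\<^sup>2 = (a\<^sup>2 + b\<^sup>2) * (c\<^sup>2 + d\<^sup>2) - (a * c + b * d)\<^sup>2" by algebra
  then have "(a * d - b * c)\<^sup>2 = 1" using 1 2 by simp
  moreover have "(a * d - b * c) * (d * y - c * z) = 0"
    using 1 2 by algebra
  ultimately have 3: "d * y = c * z" by auto
  have "y = (y * c + z * d) * c" using 2 3 by algebra
  moreover have "z = (y * c + z * d) * d" using 2 3 by algebra
  ultimately show "Y = (Y \<bullet> e) *\<^sub>R e" by (simp add: yz e inner_prod_def)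
qed

text \<open>Some sequence of unit secants converges by compactness; its limit is orthogonal to the
  normal of every tangent line.\<close>

lemma tangent_line_unique:
  assumes "tangent_line S q L" "tangent_line S q L'"
  shows "L = L'"
proof -
  obtain \<nu> where q: "q islimpt S" and nu: "norm \<nu> = 1" "L = {X. \<nu> \<bullet> (X - q) = 0}"
    "((\<lambda>X. \<nu> \<bullet> (X - q) / norm (X - q)) \<longlongrightarrow> 0) (at q within S)"
    using assms(1) unfolding tangent_line_def by blast
  obtain \<mu> where mu: "norm \<mu> = 1" "L' = {X. \<mu> \<bullet> (X - q) = 0}"
    "((\<lambda>X. \<mu> \<bullet> (X - q) / norm (X - q)) \<longlongrightarrow> 0) (at q within S)"
    using assms(2) unfolding tangent_line_def by blast
  obtain f where f: "\<And>k::nat. f k \<in> S - {q}" "f \<longlonglongrightarrow> q"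
    using q unfolding islimpt_sequential by blast
  define d where "d = (\<lambda>k. (1 / norm (f k - q)) *\<^sub>R (f k - q))"
  have "norm (d k) = 1" for k using f(1)[of k] by (simp add: d_def)
  then have "\<forall>k. d k \<in> sphere 0 1" by simp
  then obtain e r where e: "e \<in> sphere 0 1" "strict_mono (r :: nat \<Rightarrow> nat)" "(d \<circ> r) \<longlonglongrightarrow> e"
    using compact_sphere[of "0::plane" 1] unfolding compact_def by meson
  have fl: "filterlim f (at q within S) sequentially"
    using f by (auto simp: filterlim_at)
  have *: "\<xi> \<bullet> e = 0" if "((\<lambda>X. \<xi> \<bullet> (X - q) / norm (X - q)) \<longlongrightarrow> 0) (at q within S)" for \<xi> :: plane
  proof -
    have "(\<lambda>k. \<xi> \<bullet> d k) \<longlonglongrightarrow> 0"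
      using filterlim_compose[OF that fl] by (simp add: d_def divide_inverse mult.commute)
    then have "(\<lambda>k. \<xi> \<bullet> (d \<circ> r) k) \<longlonglongrightarrow> 0"
      using e(2) LIMSEQ_subseq_LIMSEQ[of "\<lambda>k. \<xi> \<bullet> d k"] by (simp add: o_def)
    moreover have "(\<lambda>k. \<xi> \<bullet> (d \<circ> r) k) \<longlonglongrightarrow> \<xi> \<bullet> e" by (intro tendsto_intros e)
    ultimately show ?thesis using LIMSEQ_unique by blast
  qed
  have "norm e = 1" using e(1) by simp
  then show ?thesis unfolding nu(2) mu(2)
    using orthogonal_unit_plane[OF *[OF nu(3)] nu(1)] orthogonal_unit_plane[OF *[OF mu(3)] mu(1)] by simp
qed

text \<open>The line \<open>a \<bullet> X = 1\<close> passes through \<open>a / \<bar>a\<bar>\<^sup>2\<close>; using this point for both normal vectors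
  gives \<open>\<bar>a - b\<bar>\<^sup>2 = 0\<close>.\<close>

lemma line_normal_form_unique:
  fixes a b :: plane
  assumes "{X. a \<bullet> X = 1} = {X. b \<bullet> X = 1}" "a \<noteq> 0" "b \<noteq> 0"
  shows "a = b"
proof -
  have "(1 / (a \<bullet> a)) *\<^sub>R a \<in> {X. a \<bullet> X = 1}" "(1 / (b \<bullet> b)) *\<^sub>R b \<in> {X. b \<bullet> X = 1}"
    using assms(2,3) by auto
  then have "b \<bullet> ((1 / (a \<bullet> a)) *\<^sub>R a) = 1" "a \<bullet> ((1 / (b \<bullet> b)) *\<^sub>R b) = 1"
    using assms(1) by blast+
  then have "b \<bullet> a = a \<bullet> a" "a \<bullet> b = b \<bullet> b"
    using assms(2,3) by (simp_all add: divide_eq_eq split: if_splits)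
  then have "(a - b) \<bullet> (a - b) = 0" by (simp add: inner_diff_left inner_diff_right inner_commute)
  then show ?thesis by simp
qed

lemma dual_point_iff:
  assumes "G \<noteq> 0"
  shows "dual_point {X. G \<bullet> X = 1} P \<longleftrightarrow> P = G"
proof
  assume "dual_point {X. G \<bullet> X = 1} P"
  then obtain \<nu> p where nu: "norm \<nu> = 1" "p > 0" "{X. G \<bullet> X = 1} = {X. \<nu> \<bullet> X = p}" "P = (1 / p) *\<^sub>R \<nu>"
    unfolding dual_point_def by blast
  have "{X. \<nu> \<bullet> X = p} = {X. P \<bullet> X = 1}" using nu by auto
  then show "P = G" using nu assms by (intro line_normal_form_unique) auto
next
  assume P: "P = G"
  show "dual_point {X. G \<bullet> X = 1} P" unfolding dual_point_def
    by (intro exI[of _ "(1 / norm G) *\<^sub>R G"] exI[of _ "1 / norm G"]) (use assms in \<open>auto simp: P\<close>)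
qed

lemma opow_mult: "n > 1 \<Longrightarrow> opow n u * u = u ^ (2 * n)"
  unfolding opow_def by (simp flip: power_Suc2)

lemma pow_map_inner: "n > 1 \<Longrightarrow> q \<in> fermat_oval n \<Longrightarrow> pow_map n q \<bullet> q = 1"
  by (cases q) (simp add: pow_map_def inner_prod_def opow_mult fermat_oval_def)

text \<open>The function below is the equation of the oval, scaled so that its gradient is
  \<open>pow_map n q\<close>.\<close>

lemma tangent_line_fermat_oval:
  assumes n: "n > 1" and q: "q \<in> fermat_oval n"
  shows "tangent_line (fermat_oval n) q {X. pow_map n q \<bullet> X = 1}"
proof -
  let ?f = "\<lambda>X::plane. (fst X) ^ (2 * n) / (2 * n) + (snd X) ^ (2 * n) / (2 * n)"
  have "(?f has_derivative (\<lambda>w. pow_map n q \<bullet> w)) (at q)"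
    unfolding pow_map_def opow_def inner_prod_def
    using n by (auto intro!: derivative_eq_intros simp: mult.commute)
  moreover have "pow_map n q \<noteq> 0" using pow_map_inner[OF assms] by auto
  moreover have "?f X = ?f q" if "X \<in> fermat_oval n" for X
  proof -
    have "?f X = 1 / (2 * n)" if "X \<in> fermat_oval n" for X
      using that by (cases X) (simp add: fermat_oval_def flip: add_divide_distrib)
    then show ?thesis using that q by metis
  qed
  ultimately have "tangent_line (fermat_oval n) q {X. pow_map n q \<bullet> (X - q) = 0}"
    using q fermat_oval_islimpt[OF assms] by (intro tangent_line_gradient[of ?f])
  then show ?thesis using pow_map_inner[OF assms] by (simp add: inner_diff_right)
qed

lemma corresponds_fermat_oval:
  assumes n: "n > 1"
  shows "corresponds (fermat_oval n) q P \<longleftrightarrow> q \<in> fermat_oval n \<and> P = pow_map n q"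
proof (cases "q \<in> fermat_oval n")
  case True
  have nz: "pow_map n q \<noteq> 0" using pow_map_inner[OF assms True] by auto
  show ?thesis unfolding corresponds_def
    using tangent_line_fermat_oval[OF n True] tangent_line_unique dual_point_iff[OF nz] True by metis
next
  case False
  then show ?thesis unfolding corresponds_def tangent_line_def by blast
qed

lemma dual_curve_fermat_oval:
  assumes n: "n > 1"
  shows "dual_curve (fermat_oval n) = {P. dual_gauge n P = 1}"
  unfolding dual_curve_def corresponds_fermat_oval[OF n]
  using fermat_oval_iff_gauge[OF n] dual_vec_pow_map[OF n] pow_map_dual_vec[OF n]
  by (metis (no_types, lifting))

lemma tangent_line_gauge:
  assumes n: "n > 1" and P: "dual_gauge n P = 1"
  shows "tangent_line {P. dual_gauge n P = 1} P {X. dual_vec n P \<bullet> (X - P) = 0}"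
proof -
  have "(dual_gauge n has_derivative (\<lambda>w. (dual_exponent n *\<^sub>R dual_vec n P) \<bullet> w)) (at P)"
    using gauge_deriv[OF n, of P] by simp
  then have "tangent_line {P. dual_gauge n P = 1} P {X. (dual_exponent n *\<^sub>R dual_vec n P) \<bullet> (X - P) = 0}"
    by (rule tangent_line_gradient) (use n P gauge_islimpt[OF n P] dual_exponent_pos[OF n] dual_vec_nz[OF n P] in auto)
  then show ?thesis using dual_exponent_pos[OF n] by simp
qed

lemma outward_normal_gauge:
  assumes n: "n > 1" and P: "dual_gauge n P = 1"
  shows "outward_normal {P. dual_gauge n P = 1} P ((1 / norm (dual_vec n P)) *\<^sub>R dual_vec n P)"
proof -
  let ?d = "dual_vec n P"
  have nz: "norm ?d > 0" using dual_vec_nz[OF n P] by simp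
  have "{X. (1 / norm ?d) *\<^sub>R ?d \<bullet> (X - P) = 0} = {X. ?d \<bullet> (X - P) = 0}" using nz by auto
  then have 1: "tangent_line {P. dual_gauge n P = 1} P {X. (1 / norm ?d) *\<^sub>R ?d \<bullet> (X - P) = 0}"
    using tangent_line_gauge[OF assms] by simp
  have "?d \<bullet> (- ((1 / norm ?d) *\<^sub>R ?d)) < 0" using nz by simp
  from gauge_inward[OF n P this] obtain \<epsilon> where e: "\<epsilon> > 0"
    "\<And>s. s \<in> {0<..<\<epsilon>} \<Longrightarrow> dual_gauge n (P + s *\<^sub>R - ((1 / norm ?d) *\<^sub>R ?d)) < 1" by blast
  have "dual_gauge n (P + s *\<^sub>R ((1 / norm ?d) *\<^sub>R ?d)) > 1" if "s > 0" for s
    using gauge_outward[OF n P, of "s * (1 / norm ?d)"] that nz by simp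
  with e 1 nz show ?thesis unfolding outward_normal_def outside_gauge[OF n] inside_gauge[OF n]
    by (auto intro!: exI[of _ \<epsilon>])
qed


section \<open>Singular points of the dual oval\<close>

lemma poly_second_order:
  fixes a :: "real poly"
  shows "\<exists>K\<ge>0. \<forall>h. \<bar>h\<bar> \<le> 1 \<longrightarrow> \<bar>poly a (y + h) - poly a y - h * poly (pderiv a) y\<bar> \<le> K * h\<^sup>2"
proof (induction a)
  case 0
  show ?case by (intro exI[of _ 0]) simp
next
  case (pCons b a)
  then obtain K where K: "K \<ge> 0" "\<And>h. \<bar>h\<bar> \<le> 1 \<Longrightarrow> \<bar>poly a (y + h) - poly a y - h * poly (pderiv a) y\<bar> \<le> K * h\<^sup>2" by blast
  let ?g = "poly (pderiv a) y"
  show ?case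
  proof (intro exI[of _ "\<bar>?g\<bar> + (\<bar>y\<bar> + 1) * K"] conjI allI impI)
    show "0 \<le> \<bar>?g\<bar> + (\<bar>y\<bar> + 1) * K" using K by simp
    fix h :: real assume h: "\<bar>h\<bar> \<le> 1"
    define r where "r = poly a (y + h) - poly a y - h * ?g"
    have "poly (pCons b a) (y + h) - poly (pCons b a) y - h * poly (pderiv (pCons b a)) y = h\<^sup>2 * ?g + (y + h) * r"
      by (simp add: pderiv_pCons r_def power2_eq_square algebra_simps)
    also have "\<bar>\<dots>\<bar> \<le> \<bar>h\<^sup>2 * ?g\<bar> + \<bar>(y + h) * r\<bar>" by (rule abs_triangle_ineq)
    also have "\<bar>(y + h) * r\<bar> \<le> (\<bar>y\<bar> + 1) * (K * h\<^sup>2)"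
      unfolding abs_mult by (intro mult_mono) (use K(2)[OF h] h in \<open>auto simp: r_def\<close>)
    finally show "\<bar>poly (pCons b a) (y + h) - poly (pCons b a) y - h * poly (pderiv (pCons b a)) y\<bar> \<le> (\<bar>?g\<bar> + (\<bar>y\<bar> + 1) * K) * h\<^sup>2"
      by (simp add: abs_mult algebra_simps)
  qed
qed

lemma eval2_0 [simp]: "eval2 0 q = 0"
  and eval2_pCons: "eval2 (pCons a F) q = poly a (snd q) + fst q * eval2 F q"
  and eval2_add [simp]: "eval2 (F + G) q = eval2 F q + eval2 G q"
  and eval2_monom: "eval2 (monom a i) q = fst q ^ i * poly a (snd q)"
  by (cases q; simp add: eval2_def poly_monom poly_const_pow)+

lemma eval2_sum: "eval2 (\<Sum>i\<in>I. f i) q = (\<Sum>i\<in>I. eval2 (f i) q)"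
  by (induction I rule: infinite_finite_induct) auto

lemma gradient2_pCons:
  "gradient2 (pCons a F) q = (eval2 F q, poly (pderiv a) (snd q)) + fst q *\<^sub>R gradient2 F q"
  by (simp add: gradient2_def pderiv_pCons map_poly_pCons eval2_pCons)

text \<open>First-order Taylor expansion with a quadratic bound on the remainder; the linear part is the
  formal gradient, which links the algebraic definitions to analysis.\<close>

lemma eval2_second_order:
  "\<exists>K\<ge>0. \<forall>z. norm z \<le> 1 \<longrightarrow> \<bar>eval2 F (q + z) - eval2 F q - gradient2 F q \<bullet> z\<bar> \<le> K * (norm z)\<^sup>2"
proof (induction F)
  case 0
  show ?case by (intro exI[of _ 0]) (simp add: gradient2_def zero_prod_def[symmetric])
next
  case (pCons a F)
  then obtain K where K: "K \<ge> 0" "\<And>z. norm z \<le> 1 \<Longrightarrow> \<bar>eval2 F (q + z) - eval2 F q - gradient2 F q \<bullet> z\<bar> \<le> K * (norm z)\<^sup>2" by blast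
  obtain L where L: "L \<ge> 0" "\<And>h. \<bar>h\<bar> \<le> 1 \<Longrightarrow> \<bar>poly a (snd q + h) - poly a (snd q) - h * poly (pderiv a) (snd q)\<bar> \<le> L * h\<^sup>2"
    using poly_second_order by blast
  let ?G = "gradient2 F q"
  show ?case
  proof (intro exI[of _ "L + (norm ?G + (\<bar>fst q\<bar> + 1) * K)"] conjI allI impI)
    show "0 \<le> L + (norm ?G + (\<bar>fst q\<bar> + 1) * K)" using K L by simp
    fix z :: plane assume z: "norm z \<le> 1"
    have z12: "\<bar>fst z\<bar> \<le> norm z" "\<bar>snd z\<bar> \<le> norm z" using norm_fst_le[of "fst z" "snd z"] norm_snd_le[of "snd z" "fst z"] by simp_all
    define r where "r = eval2 F (q + z) - eval2 F q - ?G \<bullet> z"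
    define s where "s = poly a (snd q + snd z) - poly a (snd q) - snd z * poly (pderiv a) (snd q)"
    have "eval2 (pCons a F) (q + z) - eval2 (pCons a F) q - gradient2 (pCons a F) q \<bullet> z
        = s + (fst z * (?G \<bullet> z) + (fst q + fst z) * r)"
      by (simp add: eval2_pCons gradient2_pCons r_def s_def inner_add_left inner_Pair_0 inner_prod_def algebra_simps)
    also have "\<bar>\<dots>\<bar> \<le> \<bar>s\<bar> + (\<bar>fst z * (?G \<bullet> z)\<bar> + \<bar>(fst q + fst z) * r\<bar>)"
      by (meson abs_triangle_ineq add_left_mono order_trans)
    also have "\<dots> \<le> L * (norm z)\<^sup>2 + (norm ?G * (norm z)\<^sup>2 + (\<bar>fst q\<bar> + 1) * (K * (norm z)\<^sup>2))"
    proof (intro add_mono)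
      have "\<bar>s\<bar> \<le> L * (snd z)\<^sup>2" unfolding s_def by (rule L(2)) (use z12 z in linarith)
      also have "\<dots> \<le> L * (norm z)\<^sup>2" using L(1) z12(2) by (intro mult_left_mono) (auto simp: abs_le_square_iff[symmetric])
      finally show "\<bar>s\<bar> \<le> L * (norm z)\<^sup>2" .
      have "\<bar>fst z * (?G \<bullet> z)\<bar> \<le> norm z * (norm ?G * norm z)"
        unfolding abs_mult by (intro mult_mono z12 Cauchy_Schwarz_ineq2) auto
      then show "\<bar>fst z * (?G \<bullet> z)\<bar> \<le> norm ?G * (norm z)\<^sup>2" by (simp add: power2_eq_square mult_ac)
      show "\<bar>(fst q + fst z) * r\<bar> \<le> (\<bar>fst q\<bar> + 1) * (K * (norm z)\<^sup>2)"
        unfolding abs_mult by (intro mult_mono) (use K(2)[OF z] z z12 in \<open>auto simp: r_def\<close>)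
    qed
    finally show "\<bar>eval2 (pCons a F) (q + z) - eval2 (pCons a F) q - gradient2 (pCons a F) q \<bullet> z\<bar>
        \<le> (L + (norm ?G + (\<bar>fst q\<bar> + 1) * K)) * (norm z)\<^sup>2"
      by (simp add: algebra_simps)
  qed
qed

lemma eval2_has_derivative: "(eval2 F has_derivative (\<lambda>w. gradient2 F q \<bullet> w)) (at q)"
proof -
  obtain K where K: "K \<ge> 0" "\<And>z. norm z \<le> 1 \<Longrightarrow> \<bar>eval2 F (q + z) - eval2 F q - gradient2 F q \<bullet> z\<bar> \<le> K * (norm z)\<^sup>2"
    using eval2_second_order by blast
  show ?thesis unfolding has_derivative_at
  proof (intro conjI)
    show "bounded_linear ((\<bullet>) (gradient2 F q))" by (rule bounded_linear_inner_right)
    have "((\<lambda>z::plane. K * norm z) \<longlongrightarrow> K * norm (0::plane)) (at 0)" by (intro tendsto_intros)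
    then have l: "((\<lambda>z::plane. K * norm z) \<longlongrightarrow> 0) (at 0)" by simp
    have ev: "eventually (\<lambda>z::plane. norm z < 1) (at 0)" by (auto simp: eventually_at intro!: exI[of _ 1])
    show "(\<lambda>h. norm (eval2 F (q + h) - eval2 F q - gradient2 F q \<bullet> h) / norm h) \<midarrow>0\<rightarrow> 0"
    proof (rule Lim_null_comparison[OF _ l])
      show "eventually (\<lambda>z. norm (norm (eval2 F (q + z) - eval2 F q - gradient2 F q \<bullet> z) / norm z) \<le> K * norm z) (at 0)"
        using ev
      proof eventually_elim
        case (elim z)
        then show ?case using K(2)[of z] K(1) by (cases "z = 0") (auto simp: divide_le_eq power2_eq_square mult_ac)
      qed
    qed
  qed
qed

lemma linear_bound_imp_zero:
  fixes a C :: real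
  assumes "a \<ge> 0" "\<And>v. 0 < v \<Longrightarrow> v < 1 / 2 \<Longrightarrow> a \<le> C * v"
  shows "a = 0"
proof (rule ccontr)
  assume "a \<noteq> 0"
  then have a: "a > 0" using assms by simp
  define v where "v = min (1 / 4) (a / (2 * (\<bar>C\<bar> + 1)))"
  have v: "0 < v" "v < 1 / 2" using a by (auto simp: v_def)
  have "C * v \<le> (\<bar>C\<bar> + 1) * v" using v by (intro mult_right_mono) auto
  also have "\<dots> \<le> (\<bar>C\<bar> + 1) * (a / (2 * (\<bar>C\<bar> + 1)))" by (intro mult_left_mono) (auto simp: v_def)
  also have "\<dots> = a / 2" by (simp add: field_simps)
  finally show False using assms(2)[OF v] a by simp
qed

text \<open>How closely the oval and the dual curve touch the line \<open>x = 1\<close> at height \<open>v\<close> and \<open>v\<^bsup>2n-1\<^esup>\<close>.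
  All bounds come from \<open>u\<^bsup>2n\<^esup> \<le> u\<^bsup>2n-1\<^esup> \<le> u\<close>.\<close>

lemma oval_height:
  assumes n: "n > 1" and v: "0 < v" "v < (1::real)"
  obtains u where "0 < u" "u \<le> 1" "u ^ (2 * n) + v ^ (2 * n) = 1"
    "1 - u \<le> v ^ (2 * n)" "v ^ (2 * n) / 2 \<le> 1 - u ^ (2 * n - 1)" "1 - u ^ (2 * n - 1) \<le> v ^ (2 * n)"
proof -
  define u where "u = root (2 * n) (1 - v ^ (2 * n))"
  have vp: "0 < v ^ (2 * n)" "v ^ (2 * n) < 1" using v n by (simp_all add: power_less_one_iff)
  have u: "0 < u" "u ^ (2 * n) = 1 - v ^ (2 * n)" "u \<le> 1" using vp n by (simp_all add: u_def)
  have e: "u ^ (2 * n) = u * u ^ (2 * n - 1)" using n by (simp flip: power_Suc)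
  have m1: "u ^ (2 * n - 1) \<le> 1" using u by (intro power_le_one) auto
  have m2: "u ^ (2 * n) \<le> u ^ (2 * n - 1)" unfolding e using u by (simp add: mult_left_le_one_le)
  have m3: "u ^ (2 * n - 1) \<le> u" using u n power_decreasing[of 1 "2 * n - 1" u] by simp
  have "u ^ (2 * n - 1) * (1 - u) \<le> 1 * (1 - u)" using m1 u by (intro mult_right_mono) auto
  then have "1 - u ^ (2 * n) \<le> 2 * (1 - u ^ (2 * n - 1))" unfolding e using m3 by (simp add: algebra_simps)
  then show thesis using that[of u] u m2 m3 by simp
qed

text \<open>With \<open>N = 2n\<close> and \<open>t = 1 - u\<^bsup>N-1\<^esup>\<close>, of the exact order \<open>v\<^sup>N\<close>, the linear part of \<open>F\<close> at \<open>a\<close>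
  contributes \<open>- t A + v\<^bsup>N-1\<^esup> B\<close>, and the remainder is of order \<open>v\<^bsup>2N-2\<^esup>\<close>. The term of the lowest
  order \<open>N - 1\<close> gives \<open>B = 0\<close>; then the term of order \<open>N < 2N - 2\<close> gives \<open>A = 0\<close>.\<close>

lemma vanishing_gradient_at_cusp:
  fixes a b :: plane
  assumes n: "n > 1" and ab: "norm a = 1" "norm b = 1"
    and z: "\<And>u v. 0 < v \<Longrightarrow> v < 1 \<Longrightarrow> 0 < u \<Longrightarrow> u ^ (2 * n) + v ^ (2 * n) = 1 \<Longrightarrow>
      eval2 F (u ^ (2 * n - 1) *\<^sub>R a + v ^ (2 * n - 1) *\<^sub>R b) = 0"
    and q: "eval2 F a = 0"
  shows "gradient2 F a \<bullet> a = 0" "gradient2 F a \<bullet> b = 0"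
proof -
  obtain K where K: "K \<ge> 0" "\<And>z. norm z \<le> 1 \<Longrightarrow> \<bar>eval2 F (a + z) - eval2 F a - gradient2 F a \<bullet> z\<bar> \<le> K * (norm z)\<^sup>2"
    using eval2_second_order by blast
  let ?A = "gradient2 F a \<bullet> a" and ?B = "gradient2 F a \<bullet> b"
  have main: "\<exists>t. v ^ (2 * n) / 2 \<le> t \<and> t \<le> v ^ (2 * n) \<and> \<bar>- t * ?A + v ^ (2 * n - 1) * ?B\<bar> \<le> 4 * K * (v ^ (2 * n - 1))\<^sup>2"
    if v: "0 < v" "v < 1 / 2" for v
  proof -
    obtain u where u: "0 < u" "u ^ (2 * n) + v ^ (2 * n) = 1" "v ^ (2 * n) / 2 \<le> 1 - u ^ (2 * n - 1)" "1 - u ^ (2 * n - 1) \<le> v ^ (2 * n)"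
      using oval_height[OF n, of v] v by auto
    define t where "t = 1 - u ^ (2 * n - 1)"
    let ?m = "v ^ (2 * n - 1)"
    define z where "z = (- t) *\<^sub>R a + ?m *\<^sub>R b"
    have vm: "?m > 0" using v by simp
    have vv: "v ^ (2 * n) \<le> ?m" using v by (intro power_decreasing) auto
    have "0 \<le> v ^ (2 * n) / 2" using v by simp
    then have t: "0 \<le> t" "t \<le> ?m" using u(3,4) vv unfolding t_def by linarith+
    have "norm z \<le> t + ?m"
      using norm_triangle_ineq[of "(- t) *\<^sub>R a" "?m *\<^sub>R b"] ab t vm by (simp add: z_def)
    then have nz: "norm z \<le> 2 * ?m" using t by simp
    have "?m \<le> v" using v n power_decreasing[of 1 "2 * n - 1" v] by simp
    then have "norm z \<le> 1" using nz v by simp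
    from K(2)[OF this] have "\<bar>eval2 F (a + z) - gradient2 F a \<bullet> z\<bar> \<le> K * (norm z)\<^sup>2" by (simp add: q)
    moreover have "a + z = u ^ (2 * n - 1) *\<^sub>R a + ?m *\<^sub>R b" by (simp add: z_def t_def algebra_simps)
    then have "eval2 F (a + z) = 0" using assms(4)[of v u] v u by simp
    moreover have "gradient2 F a \<bullet> z = - t * ?A + ?m * ?B" by (simp only: z_def inner_add_right inner_scaleR_right)
    moreover have "K * (norm z)\<^sup>2 \<le> K * (2 * ?m)\<^sup>2" using K nz by (intro mult_left_mono power_mono) auto
    moreover have "K * (2 * ?m)\<^sup>2 = 4 * K * ?m\<^sup>2" by (simp add: power_mult_distrib)
    ultimately have "\<bar>- t * ?A + ?m * ?B\<bar> \<le> 4 * K * ?m\<^sup>2" by linarith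
    then show ?thesis using u t_def by blast
  qed
  have e: "v ^ (2 * n) = v * v ^ (2 * n - 1)" for v :: real using n by (simp flip: power_Suc)
  have "\<bar>?B\<bar> \<le> (\<bar>?A\<bar> + 4 * K) * v" if v: "0 < v" "v < 1 / 2" for v
  proof -
    obtain t where t: "v ^ (2 * n) / 2 \<le> t" "t \<le> v ^ (2 * n)" "\<bar>- t * ?A + v ^ (2 * n - 1) * ?B\<bar> \<le> 4 * K * (v ^ (2 * n - 1))\<^sup>2"
      using main[OF v] by blast
    let ?m = "v ^ (2 * n - 1)"
    have m: "?m > 0" "?m \<le> v" using v n power_decreasing[of 1 "2 * n - 1" v] by simp_all
    have "t \<ge> 0" using t(1) v by (smt (verit) zero_le_power divide_nonneg_pos)
    have "?m * \<bar>?B\<bar> = \<bar>(- t * ?A + ?m * ?B) + t * ?A\<bar>" using m by (simp add: abs_mult)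
    also have "\<dots> \<le> 4 * K * ?m\<^sup>2 + t * \<bar>?A\<bar>"
      using t(3) abs_triangle_ineq[of "- t * ?A + ?m * ?B" "t * ?A"] \<open>t \<ge> 0\<close> by (simp add: abs_mult)
    also have "\<dots> \<le> 4 * K * (?m * v) + (v * ?m) * \<bar>?A\<bar>"
      unfolding power2_eq_square using m t(2) K v by (intro add_mono mult_left_mono mult_right_mono) (auto simp: e)
    also have "\<dots> = ?m * ((\<bar>?A\<bar> + 4 * K) * v)" by (simp add: algebra_simps)
    finally show ?thesis using m by simp
  qed
  then show B: "?B = 0" using linear_bound_imp_zero[of "\<bar>?B\<bar>"] by force
  have "\<bar>?A\<bar> \<le> 8 * K * v" if v: "0 < v" "v < 1 / 2" for v
  proof -
    obtain t where t: "v ^ (2 * n) / 2 \<le> t" "t \<le> v ^ (2 * n)" "\<bar>- t * ?A + v ^ (2 * n - 1) * ?B\<bar> \<le> 4 * K * (v ^ (2 * n - 1))\<^sup>2"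
      using main[OF v] by blast
    let ?m = "v ^ (2 * n - 1)"
    have m: "?m > 0" using v by simp
    have m2: "?m \<le> v * v" using v n power_decreasing[of 2 "2 * n - 1" v] by (simp add: power2_eq_square)
    have "v * ?m / 2 * \<bar>?A\<bar> \<le> t * \<bar>?A\<bar>" using t(1) unfolding e by (intro mult_right_mono) auto
    also have "\<dots> = \<bar>t * ?A\<bar>" using t(1) v by (simp add: abs_mult) (smt (verit) zero_le_power divide_nonneg_pos)
    also have "\<dots> \<le> 4 * K * (?m * ?m)" using t(3) unfolding B by (simp add: power2_eq_square)
    also have "\<dots> \<le> 4 * K * (?m * (v * v))" using m m2 K by (intro mult_left_mono) auto
    also have "\<dots> = v * ?m / 2 * (8 * K * v)" by simp
    finally show ?thesis using m v by simp
  qed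
  then show "?A = 0" using linear_bound_imp_zero[of "\<bar>?A\<bar>"] by force
qed

abbreviation (input) axis_points :: "plane set" where
  "axis_points \<equiv> {(1, 0), (-1, 0), (0, 1), (0, -1)}"

lemma gauge_pow_map:
  assumes n: "n > 1" and uv: "u ^ (2 * n) + v ^ (2 * n) = 1"
  shows "dual_gauge n (u ^ (2 * n - 1), v ^ (2 * n - 1)) = 1"
  using fermat_oval_iff_gauge[OF n, of "(u, v)"] uv by (simp add: pow_map_def opow_def fermat_oval_def)

text \<open>The four points are treated at once: \<open>q\<close> is the radial and \<open>b\<close> the tangential direction.\<close>

lemma dual_singular_at_axis_points:
  assumes n: "n > 1" and q: "q \<in> axis_points" and F: "F \<in> vanishing_ideal {P. dual_gauge n P = 1}"
  shows "gradient2 F q = 0"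
proof -
  define b where "b = (snd q, fst q)"
  have odd: "(- u) ^ (2 * n - Suc 0) = - (u ^ (2 * n - Suc 0))" for u :: real
    using n by (intro power_minus_odd) simp
  have F0: "eval2 F P = 0" if "dual_gauge n P = 1" for P using F that unfolding vanishing_ideal_def by blast
  have 1: "eval2 F q = 0"
    by (rule F0) (use q n in \<open>auto simp: dual_gauge_def oroot_simps power_0_left\<close>)
  have 2: "eval2 F (u ^ (2 * n - 1) *\<^sub>R q + v ^ (2 * n - 1) *\<^sub>R b) = 0" if "u ^ (2 * n) + v ^ (2 * n) = 1" for u v
  proof (rule F0)
    have s: "v ^ (2 * n) + u ^ (2 * n) = 1" using that by simp
    show "dual_gauge n (u ^ (2 * n - 1) *\<^sub>R q + v ^ (2 * n - 1) *\<^sub>R b) = 1"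
      using q gauge_pow_map[OF n that] gauge_pow_map[OF n s] gauge_pow_map[OF n, of "- u" "- v"] gauge_pow_map[OF n, of "- v" "- u"] that s
      by (auto simp: b_def odd)
  qed
  have "norm q = 1" "norm b = 1" using q by (auto simp: b_def norm_Pair)
  from vanishing_gradient_at_cusp[OF n this 2 1]
  have "gradient2 F q \<bullet> q = 0" "gradient2 F q \<bullet> b = 0" by auto
  then show ?thesis using q by (cases "gradient2 F q") (auto simp: b_def zero_prod_def)
qed

lemma oval_axis_points:
  assumes n: "n > 1" and q: "(u, v) \<in> fermat_oval n" and uv: "u = 0 \<or> v = 0"
  shows "(u, v) \<in> axis_points"
proof -
  have e: "u ^ (2 * n) + v ^ (2 * n) = 1" using q by (simp add: fermat_oval_def)
  have r: "x = 1 \<or> x = -1" if "x ^ (2 * n) = 1" for x :: real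
  proof -
    have "\<bar>x\<bar> ^ (2 * n) = 1 ^ (2 * n)" using that by (simp add: power_even_abs)
    then have "\<bar>x\<bar> = 1" by (rule power_eq_imp_eq_base) (use n in auto)
    then show ?thesis by linarith
  qed
  show ?thesis using uv
  proof
    assume "u = 0"
    then show ?thesis using e n r[of v] by (auto simp: power_0_left)
  next
    assume "v = 0"
    then show ?thesis using e n r[of u] by (auto simp: power_0_left)
  qed
qed

definition unity_roots :: "nat \<Rightarrow> complex set" where "unity_roots m = {z. z ^ m = 1}"

text \<open>In coordinates \<open>x\<^bsup>2n\<^esup> = A\<^sup>m\<close> and \<open>y\<^bsup>2n\<^esup> = Y\<close> with \<open>m = 2n - 1\<close>, the dual curve is
  \<open>Y = (1 - A)\<^sup>m\<close>. To get rid of the choice of the root \<open>A\<close>, multiply the equations for all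
  choices \<open>\<zeta>A\<close>. The outer variable is \<open>A\<close>, the inner one is \<open>Y\<close>.\<close>

definition dual_norm_poly :: "nat \<Rightarrow> complex poly poly" where
  "dual_norm_poly m = (\<Prod>\<zeta>\<in>unity_roots m. [:[:0, 1:]:] - [:1, [:- \<zeta>:]:] ^ m)"

lemma finite_unity_roots: "m > 0 \<Longrightarrow> finite (unity_roots m)"
  unfolding unity_roots_def using finite_nth_roots[of m 1] by simp

lemma poly_dual_norm_poly:
  "poly (poly (dual_norm_poly m) [:a:]) y = (\<Prod>\<zeta>\<in>unity_roots m. y - (1 - \<zeta> * a) ^ m)"
  by (simp add: dual_norm_poly_def poly_prod algebra_simps)

lemma pcompose_power: "pcompose (p ^ k) q = (pcompose p q) ^ k"
  by (induction k) (simp_all add: pcompose_mult pcompose_1)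

text \<open>The product does not change under \<open>A \<mapsto> \<omega>A\<close> for a primitive root of unity \<open>\<omega>\<close>, so only powers
  of \<open>A\<^sup>m\<close> occur.\<close>

lemma dual_norm_poly_lacunary:
  assumes m: "m > 0" and i: "\<not> m dvd i"
  shows "coeff (dual_norm_poly m) i = 0"
proof -
  define \<omega> where "\<omega> = cis (2 * pi / m)"
  have w: "\<omega> ^ m = 1" using m by (simp add: \<omega>_def Complex.DeMoivre)
  have w0: "\<omega> \<noteq> 0" by (simp add: \<omega>_def)
  have wi: "\<omega> ^ i \<noteq> 1"
  proof
    assume "\<omega> ^ i = 1"
    then have "cos (2 * pi * (real i / m)) = 1" by (simp add: \<omega>_def Complex.DeMoivre complex_eq_iff mult_ac)
    then obtain k :: int where "2 * pi * (real i / m) = of_int k * 2 * pi" by (auto simp: cos_one_2pi_int)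
    then have "real i = of_int k * real m" using m by (simp add: field_simps)
    then have "int i = k * int m" by (metis of_int_eq_iff of_int_mult of_int_of_nat_eq)
    then have "int m dvd int i" by simp
    then show False using i by simp
  qed
  have "bij_betw ((*) \<omega>) (unity_roots m) (unity_roots m)"
    by (rule bij_betwI[of _ _ _ "\<lambda>z. z / \<omega>"]) (use w w0 in \<open>auto simp: unity_roots_def power_mult_distrib power_divide\<close>)
  then have "(\<Prod>\<zeta>\<in>unity_roots m. [:[:0, 1:]:] - [:1, [:- (\<omega> * \<zeta>):]:] ^ m) = dual_norm_poly m"
    unfolding dual_norm_poly_def by (rule prod.reindex_bij_betw)
  moreover have "pcompose ([:[:0, 1:]:] - [:1, [:- \<zeta>:]:] ^ m) [:0, [:\<omega>:]:] = [:[:0, 1:]:] - [:1, [:- (\<omega> * \<zeta>):]:] ^ m" for \<zeta>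
    by (simp add: pcompose_diff pcompose_power pcompose_pCons)
  then have "pcompose (dual_norm_poly m) [:0, [:\<omega>:]:] = (\<Prod>\<zeta>\<in>unity_roots m. [:[:0, 1:]:] - [:1, [:- (\<omega> * \<zeta>):]:] ^ m)"
    unfolding dual_norm_poly_def pcompose_prod by simp
  ultimately have "pcompose (dual_norm_poly m) [:0, [:\<omega>:]:] = dual_norm_poly m" by simp
  then have "[:\<omega>:] ^ i * coeff (dual_norm_poly m) i = coeff (dual_norm_poly m) i"
    by (metis coeff_pcompose_linear)
  then have "[:\<omega> ^ i - 1:] * coeff (dual_norm_poly m) i = 0"
    by (simp add: poly_const_pow smult_diff_left)
  then show ?thesis using wi by auto
qed

lemma poly_lacunary:
  fixes Q :: "'a :: comm_ring_1 poly poly"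
  assumes m: "m > 0" and l: "\<And>i. \<not> m dvd i \<Longrightarrow> coeff Q i = 0"
  shows "poly (poly Q [:a:]) y = (\<Sum>k\<le>degree Q. poly (coeff Q (m * k)) y * (a ^ m) ^ k)"
proof -
  have "poly (poly Q [:a:]) y = (\<Sum>i\<le>degree Q. poly (coeff Q i) y * a ^ i)"
    by (simp add: poly_altdef[of Q] poly_sum poly_const_pow mult.commute)
  also have "\<dots> = (\<Sum>i\<in>(*) m ` {..degree Q}. poly (coeff Q i) y * a ^ i)"
  proof (rule sum.mono_neutral_cong)
    fix i assume "i \<in> {..degree Q} - (*) m ` {..degree Q}"
    then have i: "i \<le> degree Q" "i \<notin> (*) m ` {..degree Q}" by auto
    have "\<not> m dvd i"
    proof
      assume "m dvd i"
      then obtain k where k: "i = m * k" by blast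
      then have "k \<in> {..degree Q}" using m i(1) by (simp add: order_trans[of k "m * k"])
      then show False using i(2) k by blast
    qed
    then show "poly (coeff Q i) y * a ^ i = 0" using l by simp
  next
    fix i assume "i \<in> (*) m ` {..degree Q} - {..degree Q}"
    then show "poly (coeff Q i) y * a ^ i = 0" by (auto simp: coeff_eq_0)
  qed auto
  also have "\<dots> = (\<Sum>k\<le>degree Q. poly (coeff Q (m * k)) y * (a ^ m) ^ k)"
    using m by (subst sum.reindex) (auto simp: inj_on_def power_mult)
  finally show ?thesis .
qed

lemma poly_map_Re:
  "poly (map_poly (\<lambda>c. Re (\<kappa> * c)) p) y = Re (\<kappa> * poly p (of_real y))"
proof (induction p)
  case (pCons a p)
  have "Re (\<kappa> * (of_real y * poly p (of_real y))) = y * Re (\<kappa> * poly p (of_real y))"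
    by (simp add: algebra_simps)
  then show ?case using pCons.IH
    by (simp add: map_poly_pCons distrib_left del: times_complex.simps)
qed simp

lemma Re_mult_of_real: "Re (\<kappa> * (z * of_real r)) = r * Re (\<kappa> * z)"
  by (simp add: algebra_simps)

text \<open>Substituting \<open>A\<^sup>m = x\<^bsup>2n\<^esup>\<close> and \<open>Y = y\<^bsup>2n\<^esup>\<close> and taking real parts of the coefficients gives a
  real polynomial in \<open>x, y\<close>. The complex factor \<open>\<kappa>\<close> is free, so that a given non-zero value can be
  turned into a positive one.\<close>

lemma real_dual_polynomial_exists:
  assumes n: "n > 1"
  shows "\<exists>F. \<forall>u y. eval2 F (u ^ (2 * n - 1), y) =
    Re (\<kappa> * (\<Prod>\<zeta>\<in>unity_roots (2 * n - 1). of_real (y ^ (2 * n)) - (1 - \<zeta> * of_real (u ^ (2 * n))) ^ (2 * n - 1)))"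
proof -
  define m where "m = 2 * n - 1"
  have m: "m > 0" using n by (simp add: m_def)
  define Q where "Q = dual_norm_poly m"
  define F where "F = (\<Sum>k\<le>degree Q. monom (pcompose (map_poly (\<lambda>c. Re (\<kappa> * c)) (coeff Q (m * k))) (monom 1 (2 * n))) (2 * n * k))"
  have "eval2 F (u ^ m, y) = Re (\<kappa> * (\<Prod>\<zeta>\<in>unity_roots m. of_real (y ^ (2 * n)) - (1 - \<zeta> * of_real (u ^ (2 * n))) ^ m))" for u y
  proof -
    let ?a = "complex_of_real (u ^ (2 * n))" and ?y = "complex_of_real (y ^ (2 * n))"
    have "poly (poly Q [:?a:]) ?y = (\<Sum>k\<le>degree Q. poly (coeff Q (m * k)) ?y * (?a ^ m) ^ k)"
      unfolding Q_def by (rule poly_lacunary[OF m dual_norm_poly_lacunary[OF m]])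
    then have "Re (\<kappa> * poly (poly Q [:?a:]) ?y) = (\<Sum>k\<le>degree Q. Re (\<kappa> * (poly (coeff Q (m * k)) ?y * (?a ^ m) ^ k)))"
      by (simp only: sum_distrib_left Re_sum)
    also have "\<dots> = eval2 F (u ^ m, y)"
      unfolding F_def eval2_sum
    proof (intro sum.cong refl)
      fix k
      have "(?a ^ m) ^ k = complex_of_real ((u ^ m) ^ (2 * n * k))"
        by (simp flip: power_mult) (simp add: mult_ac)
      then have "Re (\<kappa> * (poly (coeff Q (m * k)) ?y * (?a ^ m) ^ k)) = (u ^ m) ^ (2 * n * k) * Re (\<kappa> * poly (coeff Q (m * k)) ?y)"
        by (simp only: Re_mult_of_real)
      then show "Re (\<kappa> * (poly (coeff Q (m * k)) ?y * (?a ^ m) ^ k)) =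
         eval2 (monom (pcompose (map_poly (\<lambda>c. Re (\<kappa> * c)) (coeff Q (m * k))) (monom 1 (2 * n))) (2 * n * k)) (u ^ m, y)"
        by (simp add: eval2_monom poly_pcompose poly_monom poly_map_Re del: times_complex.simps)
    qed
    finally show ?thesis unfolding Q_def poly_dual_norm_poly by (rule sym)
  qed
  then show ?thesis unfolding m_def by blast
qed

text \<open>For \<open>0 < a < 1\<close> the point \<open>1 - \<zeta>a\<close> has the least modulus at \<open>\<zeta> = 1\<close> only.\<close>

lemma unity_root_separation:
  assumes a: "0 < a" "a < 1" and z: "\<zeta> ^ m = 1" "\<zeta> \<noteq> 1" and m: "m > 0"
  shows "complex_of_real ((1 - a) ^ m) \<noteq> (1 - \<zeta> * of_real a) ^ m"
proof
  assume e: "complex_of_real ((1 - a) ^ m) = (1 - \<zeta> * of_real a) ^ m"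
  have "norm \<zeta> ^ m = 1 ^ m" using z(1) by (simp flip: norm_power)
  then have n1: "norm \<zeta> = 1" by (rule power_eq_imp_eq_base) (use m in auto)
  then have s: "(Re \<zeta>)\<^sup>2 + (Im \<zeta>)\<^sup>2 = 1" by (simp add: cmod_def)
  have "Re \<zeta> < 1"
  proof (rule ccontr)
    assume "\<not> Re \<zeta> < 1"
    moreover have "Re \<zeta> \<le> 1" using n1 complex_Re_le_cmod[of \<zeta>] by simp
    ultimately have "Re \<zeta> = 1" by simp
    with s have "Im \<zeta> = 0" by simp
    with \<open>Re \<zeta> = 1\<close> z(2) show False by (simp add: complex_eq_iff)
  qed
  have "norm (complex_of_real ((1 - a) ^ m)) = norm (1 - \<zeta> * of_real a) ^ m" unfolding e by (simp add: norm_power)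
  then have "(1 - a) ^ m = norm (1 - \<zeta> * of_real a) ^ m" using a by (simp only: norm_of_real) simp
  then have "1 - a = norm (1 - \<zeta> * of_real a)" by (rule power_eq_imp_eq_base) (use a m in auto)
  then have "(1 - a)\<^sup>2 = (norm (1 - \<zeta> * of_real a))\<^sup>2" by simp
  also have "\<dots> = (1 - Re \<zeta> * a)\<^sup>2 + (Im \<zeta> * a)\<^sup>2" by (simp add: cmod_power2)
  also have "\<dots> = 1 - 2 * Re \<zeta> * a + a\<^sup>2 * ((Re \<zeta>)\<^sup>2 + (Im \<zeta>)\<^sup>2)" by (simp add: power2_eq_square algebra_simps)
  finally have "2 * a * (1 - Re \<zeta>) = 0" unfolding s by (simp add: power2_eq_square algebra_simps)
  then show False using a \<open>Re \<zeta> < 1\<close> by simp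
qed

text \<open>At a point off the axes only the factor for \<open>\<zeta> = 1\<close> of the equation vanishes, and to first
  order, so the derivative in \<open>y\<close> is that of this factor times the product \<open>R\<close> of the others. The
  choice \<open>\<kappa> = cnj (R y0)\<close> makes its real part \<open>\<bar>R y0\<bar>\<^sup>2\<close> up to a non-zero real factor.\<close>

lemma dual_smooth_off_axes:
  assumes n: "n > 1" and uv: "u ^ (2 * n) + v ^ (2 * n) = 1" "u \<noteq> 0" "v \<noteq> 0"
  shows "\<exists>F\<in>vanishing_ideal {P. dual_gauge n P = 1}. gradient2 F (u ^ (2 * n - 1), v ^ (2 * n - 1)) \<noteq> 0"
proof -
  define m where "m = 2 * n - 1"
  have m: "m > 0" using n by (simp add: m_def)
  define a where "a = u ^ (2 * n)"
  have va: "v ^ (2 * n) = 1 - a" using uv by (simp add: a_def)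
  have "u ^ (2 * n) > 0" "v ^ (2 * n) > 0" using uv(2,3) by (simp_all add: zero_less_power_eq)
  then have a: "0 < a" "a < 1" using va by (simp_all add: a_def)
  have U1: "1 \<in> unity_roots m" by (simp add: unity_roots_def)
  note fU = finite_unity_roots[OF m]
  define R where "R = (\<lambda>t. \<Prod>\<zeta>\<in>unity_roots m - {1}. of_real (t ^ (2 * n)) - (1 - \<zeta> * of_real a) ^ m)"
  define y0 where "y0 = v ^ m"
  have y0: "y0 ^ (2 * n) = (1 - a) ^ m" by (simp add: y0_def va[symmetric] power_mult[symmetric] mult.commute)
  have R0: "R y0 \<noteq> 0"
  proof -
    have "of_real (y0 ^ (2 * n)) - (1 - \<zeta> * of_real a) ^ m \<noteq> 0" if "\<zeta> \<in> unity_roots m - {1}" for \<zeta>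
      unfolding y0 using unity_root_separation[OF a _ _ m, of \<zeta>] that
      by (simp add: unity_roots_def del: of_real_power)
    then show ?thesis unfolding R_def using fU by (subst prod_zero_iff) blast+
  qed
  obtain F where F: "\<And>u y. eval2 F (u ^ m, y) =
    Re (cnj (R y0) * (\<Prod>\<zeta>\<in>unity_roots m. of_real (y ^ (2 * n)) - (1 - \<zeta> * of_real (u ^ (2 * n))) ^ m))"
    using real_dual_polynomial_exists[OF n, of "cnj (R y0)"] unfolding m_def by blast
  have "eval2 F P = 0" if P: "dual_gauge n P = 1" for P
  proof -
    obtain s t where st: "P = (s ^ m, t ^ m)" "s ^ (2 * n) + t ^ (2 * n) = 1"
    proof -
      have "dual_vec n P \<in> fermat_oval n" using P fermat_oval_eq_image[OF n] by blast
      then have "fst (dual_vec n P) ^ (2 * n) + snd (dual_vec n P) ^ (2 * n) = 1"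
        by (simp add: fermat_oval_def case_prod_beta)
      moreover have "P = (fst (dual_vec n P) ^ m, snd (dual_vec n P) ^ m)"
        using pow_map_dual_vec[OF n, of P, symmetric] unfolding pow_map_def opow_def m_def .
      ultimately show thesis by (rule that[rotated])
    qed
    have "(t ^ m) ^ (2 * n) = (1 - s ^ (2 * n)) ^ m"     proof -
      have t: "t ^ (2 * n) = 1 - s ^ (2 * n)" using st(2) by simp
      have "(t ^ m) ^ (2 * n) = (t ^ (2 * n)) ^ m" by (simp only: power_mult[symmetric] mult.commute)
      then show ?thesis unfolding t .
    qed
    then have "complex_of_real ((t ^ m) ^ (2 * n)) = of_real ((1 - s ^ (2 * n)) ^ m)" by (rule arg_cong)
    then have "complex_of_real ((t ^ m) ^ (2 * n)) - (1 - 1 * of_real (s ^ (2 * n))) ^ m = 0"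
      by (simp only: of_real_power of_real_diff of_real_1 mult_1 diff_self)
    then have "(\<Prod>\<zeta>\<in>unity_roots m. of_real ((t ^ m) ^ (2 * n)) - (1 - \<zeta> * of_real (s ^ (2 * n))) ^ m) = 0"
      by (intro prod_zero fU bexI[OF _ U1])
    then show ?thesis unfolding st(1) F by simp
  qed
  then have "F \<in> vanishing_ideal {P. dual_gauge n P = 1}" by (simp add: vanishing_ideal_def)
  moreover have "gradient2 F (u ^ m, y0) \<noteq> 0"
  proof
    assume g: "gradient2 F (u ^ m, y0) = 0"
    have "((\<lambda>t. eval2 F (u ^ m, t)) has_derivative (\<lambda>h. gradient2 F (u ^ m, y0) \<bullet> (0, h))) (at y0)"
      by (rule has_derivative_compose[OF _ eval2_has_derivative]) (auto intro!: derivative_eq_intros)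
    then have d1: "((\<lambda>t. eval2 F (u ^ m, t)) has_real_derivative 0) (at y0)"
      by (simp add: g has_field_derivative_def lambda_zero)
    define g where "g = (\<lambda>t. Re (cnj (R y0) * R t))"
    have e: "eval2 F (u ^ m, t) = (t ^ (2 * n) - (1 - a) ^ m) * g t" for t
    proof -
      have "(\<Prod>\<zeta>\<in>unity_roots m. of_real (t ^ (2 * n)) - (1 - \<zeta> * of_real a) ^ m) = complex_of_real (t ^ (2 * n) - (1 - a) ^ m) * R t"
        unfolding R_def by (subst prod.remove[OF fU U1]) simp
      then show ?thesis
        unfolding F a_def[symmetric] g_def by (simp only: mult.commute[of _ "R t"] Re_mult_of_real)
    qed
    have "(R \<longlongrightarrow> R y0) (at y0)" unfolding R_def by (intro tendsto_intros)
    then have tg: "(g \<longlongrightarrow> g y0) (at y0)" unfolding g_def by (intro tendsto_intros)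
    have "((\<lambda>t. t ^ (2 * n) - (1 - a) ^ m) has_real_derivative 2 * real n * y0 ^ (2 * n - 1)) (at y0)"
      by (rule derivative_eq_intros refl)+ simp
    then have "((\<lambda>t. (t ^ (2 * n) - (1 - a) ^ m) / (t - y0)) \<longlongrightarrow> 2 * real n * y0 ^ (2 * n - 1)) (at y0)"
      unfolding has_field_derivative_iff by (simp add: y0)
    from tendsto_mult[OF this tg]
    have d2: "((\<lambda>t. eval2 F (u ^ m, t)) has_real_derivative 2 * real n * y0 ^ (2 * n - 1) * g y0) (at y0)"
      unfolding has_field_derivative_iff e by (simp add: y0)
    have "g y0 = (norm (R y0))\<^sup>2" by (simp add: g_def cmod_power2) (simp add: power2_eq_square)
    moreover have "y0 \<noteq> 0" using uv(3) by (simp add: y0_def)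
    ultimately have "2 * real n * y0 ^ (2 * n - 1) * g y0 \<noteq> 0" using R0 n by simp
    then show False using DERIV_unique[OF d1 d2] by (metis)
  qed
  ultimately show ?thesis unfolding y0_def m_def by blast
qed

lemma singular_points_gauge:
  assumes n: "n > 1"
  shows "singular_points {P. dual_gauge n P = 1} = axis_points"
proof (intro set_eqI iffI)
  fix P assume P: "P \<in> singular_points {P. dual_gauge n P = 1}"
  then have g: "dual_gauge n P = 1" by (simp add: singular_points_def)
  obtain u v where uv: "dual_vec n P = (u, v)" by (cases "dual_vec n P")
  have P_eq: "P = (u ^ (2 * n - 1), v ^ (2 * n - 1))"
    using pow_map_dual_vec[OF n, of P] by (simp add: uv pow_map_def opow_def)
  have o: "(u, v) \<in> fermat_oval n" using fermat_oval_eq_image[OF n] g uv by force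
  have "u = 0 \<or> v = 0"
  proof (rule ccontr)
    assume "\<not> (u = 0 \<or> v = 0)"
    then have "\<exists>F\<in>vanishing_ideal {P. dual_gauge n P = 1}. gradient2 F P \<noteq> 0"
      unfolding P_eq by (intro dual_smooth_off_axes n) (use o in \<open>auto simp: fermat_oval_def\<close>)
    then show False using P by (auto simp: singular_points_def algebraically_smooth_at_def)
  qed
  from oval_axis_points[OF n o this] show "P \<in> axis_points"
    unfolding P_eq using n by (auto simp: power_0_left)
next
  fix q assume q: "q \<in> axis_points"
  have "dual_gauge n q = 1" using q n by (auto simp: dual_gauge_def oroot_simps power_0_left)
  then show "q \<in> singular_points {P. dual_gauge n P = 1}"
    using dual_singular_at_axis_points[OF n q] by (auto simp: singular_points_def algebraically_smooth_at_def)
qed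


section \<open>Inflection points of the Fermat oval\<close>

lemma real_polynomial_function_poly:
  assumes "real_polynomial_function f"
  shows "real_polynomial_function (\<lambda>x. poly p (f x))"
  by (induction p) (use assms in \<open>auto intro: real_polynomial_function.intros\<close>)

lemma poly_restrict_to_line: "poly (restrict_to_line F q w) t = eval2 F (q + t *\<^sub>R w)"
  unfolding restrict_to_line_def
  by (induction F) (simp_all add: map_poly_pCons eval2_pCons poly_pcompose algebra_simps)

lemma real_polynomial_function_eval2: "real_polynomial_function (eval2 F)"
proof (induction F)
  case 0
  have "eval2 0 = (\<lambda>x. 0)" by auto
  then show ?case by (metis real_polynomial_function.intros(2))
next
  case (pCons a F)
  have "eval2 (pCons a F) = (\<lambda>q. poly a (snd q) + fst q * eval2 F q)" by (auto simp: eval2_pCons)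
  moreover have "real_polynomial_function (\<lambda>q. poly a (snd q) + fst q * eval2 F q)"
    by (intro real_polynomial_function.intros(3,4) real_polynomial_function_poly pCons
        real_polynomial_function.intros(1) bounded_linear_fst bounded_linear_snd)
  ultimately show ?case by simp
qed

lemma real_polynomial_function_lipschitz:
  fixes f :: "plane \<Rightarrow> real"
  assumes "real_polynomial_function f"
  shows "\<exists>K\<ge>0. \<forall>p p'. norm p \<le> 2 \<longrightarrow> norm p' \<le> 2 \<longrightarrow> \<bar>f p - f p'\<bar> \<le> K * norm (p - p')"
  using assms
proof (induction f rule: real_polynomial_function.induct)
  case (linear f)
  then obtain K where "K \<ge> 0" "\<And>x. norm (f x) \<le> norm x * K" using bounded_linear.nonneg_bounded by blast
  then show ?case using linear_diff[OF bounded_linear.linear[OF linear]]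
    by (intro exI[of _ K]) (metis mult.commute real_norm_def)
next
  case (const c)
  show ?case by (intro exI[of _ 0]) simp
next
  case (add f g)
  then obtain K L where KL: "K \<ge> 0" "L \<ge> 0"
    "\<And>p p'. norm p \<le> 2 \<Longrightarrow> norm p' \<le> 2 \<Longrightarrow> \<bar>f p - f p'\<bar> \<le> K * norm (p - p')"
    "\<And>p p'. norm p \<le> 2 \<Longrightarrow> norm p' \<le> 2 \<Longrightarrow> \<bar>g p - g p'\<bar> \<le> L * norm (p - p')" by metis
  show ?case
  proof (intro exI[of _ "K + L"] conjI allI impI)
    fix p p' :: plane assume p: "norm p \<le> 2" "norm p' \<le> 2"
    show "\<bar>f p + g p - (f p' + g p')\<bar> \<le> (K + L) * norm (p - p')"
      using KL(3)[OF p] KL(4)[OF p] by (simp add: distrib_right)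
  qed (use KL in simp)
next
  case (mult f g)
  then obtain K L where KL: "K \<ge> 0" "L \<ge> 0"
    "\<And>p p'. norm p \<le> 2 \<Longrightarrow> norm p' \<le> 2 \<Longrightarrow> \<bar>f p - f p'\<bar> \<le> K * norm (p - p')"
    "\<And>p p'. norm p \<le> 2 \<Longrightarrow> norm p' \<le> 2 \<Longrightarrow> \<bar>g p - g p'\<bar> \<le> L * norm (p - p')" by metis
  define A B where "A = \<bar>f 0\<bar> + K * 2" and "B = \<bar>g 0\<bar> + L * 2"
  have AB: "\<bar>f p\<bar> \<le> A" "\<bar>g p\<bar> \<le> B" if p: "norm p \<le> 2" for p
  proof -
    have "K * norm p \<le> K * 2" "L * norm p \<le> L * 2" using p KL by (auto intro: mult_left_mono)
    then show "\<bar>f p\<bar> \<le> A" "\<bar>g p\<bar> \<le> B" using KL(3)[of p 0] KL(4)[of p 0] p by (auto simp: A_def B_def)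
  qed
  have AB0: "A \<ge> 0" "B \<ge> 0" using KL by (simp_all add: A_def B_def)
  show ?case
  proof (intro exI[of _ "A * L + B * K"] conjI allI impI)
    fix p p' :: plane assume p: "norm p \<le> 2" "norm p' \<le> 2"
    have "f p * g p - f p' * g p' = f p * (g p - g p') + g p' * (f p - f p')" by (simp add: algebra_simps)
    also have "\<bar>\<dots>\<bar> \<le> \<bar>f p * (g p - g p')\<bar> + \<bar>g p' * (f p - f p')\<bar>" by (rule abs_triangle_ineq)
    also have "\<dots> \<le> A * (L * norm (p - p')) + B * (K * norm (p - p'))"
      unfolding abs_mult by (intro add_mono mult_mono AB KL p AB0) auto
    finally show "\<bar>f p * g p - f p' * g p'\<bar> \<le> (A * L + B * K) * norm (p - p')" by (simp add: algebra_simps)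
  qed (use KL AB0 in simp)
qed

text \<open>A power of the variable is split off at a time, since a polynomial that tends to \<open>0\<close> has no
  constant term.\<close>

lemma poly_small_imp_dvd:
  fixes g :: "real poly"
  assumes "\<And>v. 0 < v \<Longrightarrow> v < 1 / 2 \<Longrightarrow> \<bar>poly g v\<bar> \<le> K * v ^ N"
  shows "[:0, 1:] ^ N dvd g"
  using assms
proof (induction N arbitrary: g)
  case (Suc N)
  have "((\<lambda>v. K * v ^ Suc N) \<longlongrightarrow> K * 0 ^ Suc N) (at_right (0::real))" by (intro tendsto_intros)
  then have l: "((\<lambda>v. K * v ^ Suc N) \<longlongrightarrow> 0) (at_right (0::real))" by simp
  have ev: "eventually (\<lambda>v. norm (poly g v) \<le> K * v ^ Suc N) (at_right 0)"
    unfolding real_norm_def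
    by (rule eventually_mono[OF eventually_at_right_real[of 0 "1 / 2"]]) (use Suc.prems in auto)
  have "((\<lambda>v. poly g v) \<longlongrightarrow> 0) (at_right 0)" by (rule Lim_null_comparison[OF ev l])
  moreover have "((\<lambda>v. poly g v) \<longlongrightarrow> poly g 0) (at_right 0)" by (intro tendsto_intros)
  ultimately have "poly g 0 = 0" using tendsto_unique trivial_limit_at_right_real by blast
  then obtain h where h: "g = pCons 0 h" by (cases g) auto
  have "\<bar>poly h v\<bar> \<le> K * v ^ N" if "0 < v" "v < 1 / 2" for v
    using Suc.prems[OF that] that by (simp add: h abs_mult mult.left_commute[of v])
  then have "[:0, 1:] ^ N dvd h" by (rule Suc.IH)
  moreover have "g = [:0, 1:] * h" by (simp add: h)
  ultimately show ?case by (simp only: power_Suc) (rule mult_dvd_mono[OF dvd_refl])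
qed simp

lemma vanishing_order_ge_iff: "3 \<le> vanishing_order g \<longleftrightarrow> [:0, 1:] ^ 3 dvd g"
  using order_divides[of 0 3 g] by (simp add: vanishing_order_def numeral_eq_enat)

definition fermat_poly :: "nat \<Rightarrow> real poly poly" where
  "fermat_poly n = monom 1 (2 * n) + [:monom 1 (2 * n) - 1:]"

lemma eval2_fermat_poly: "eval2 (fermat_poly n) q = fst q ^ (2 * n) + snd q ^ (2 * n) - 1"
  by (simp add: fermat_poly_def eval2_monom eval2_pCons poly_monom)

lemma fermat_poly_vanishes: "fermat_poly n \<in> vanishing_ideal (fermat_oval n)"
  by (auto simp: vanishing_ideal_def eval2_fermat_poly fermat_oval_def)

lemma fermat_oval_smooth:
  assumes n: "n > 1" and q: "q \<in> fermat_oval n"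
  shows "algebraically_smooth_at (fermat_oval n) q"
  unfolding algebraically_smooth_at_def
proof (intro conjI q bexI[OF _ fermat_poly_vanishes])
  have "((\<lambda>X. fst X ^ (2 * n) + snd X ^ (2 * n) - 1) has_derivative
     (\<lambda>w. real (2 * n) * (fst q ^ (2 * n - 1) * fst w + snd q ^ (2 * n - 1) * snd w))) (at q)"
    by (auto intro!: derivative_eq_intros simp: algebra_simps)
  then have "(eval2 (fermat_poly n) has_derivative
     (\<lambda>w. real (2 * n) * (fst q ^ (2 * n - 1) * fst w + snd q ^ (2 * n - 1) * snd w))) (at q)"
    by (simp add: eval2_fermat_poly[abs_def])
  from has_derivative_unique[OF this eval2_has_derivative]
  have "gradient2 (fermat_poly n) q \<bullet> q = real (2 * n) * (fst q ^ (2 * n - 1) * fst q + snd q ^ (2 * n - 1) * snd q)"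
    by metis
  also have "\<dots> = 2 * n"
    using pow_map_inner[OF n q] by (simp add: pow_map_def opow_def inner_prod_def)
  finally show "gradient2 (fermat_poly n) q \<noteq> 0" using n by auto
qed

text \<open>On the tangent line at \<open>q\<close> the point \<open>q + v b\<close> is at a distance of order \<open>v\<^bsup>2n\<^esup>\<close> from a
  point of the oval. A polynomial that vanishes on the oval is Lipschitz near \<open>q\<close>, hence vanishes
  to order \<open>2n \<ge> 4\<close> on the line.\<close>

lemma axis_point_is_inflection:
  assumes n: "n > 1" and q: "q \<in> axis_points"
  shows "q \<in> inflection_points (fermat_oval n)"
proof -
  have o: "q \<in> fermat_oval n" using q n by (auto simp: fermat_oval_def power_0_left)
  define b where "b = (snd q, fst q)"
  have nb: "norm q = 1" "norm b = 1" using q by (auto simp: b_def norm_Pair)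
  have oval: "u *\<^sub>R q + v *\<^sub>R b \<in> fermat_oval n" if "u ^ (2 * n) + v ^ (2 * n) = 1" for u v
    using q that by (auto simp: b_def fermat_oval_def add.commute)
  have "3 \<le> intersection_multiplicity (fermat_oval n) q b"
    unfolding intersection_multiplicity_def
  proof (rule INF_greatest)
    fix F assume F: "F \<in> vanishing_ideal (fermat_oval n)"
    obtain K where K: "K \<ge> 0" "\<And>p p'. norm p \<le> 2 \<Longrightarrow> norm p' \<le> 2 \<Longrightarrow> \<bar>eval2 F p - eval2 F p'\<bar> \<le> K * norm (p - p')"
      using real_polynomial_function_lipschitz[OF real_polynomial_function_eval2] by metis
    have "\<bar>poly (restrict_to_line F q b) v\<bar> \<le> K * v ^ (2 * n)" if v: "0 < v" "v < 1 / 2" for v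
    proof -
      obtain u where u: "0 < u" "u \<le> 1" "u ^ (2 * n) + v ^ (2 * n) = 1" "1 - u \<le> v ^ (2 * n)"
        using oval_height[OF n, of v] v by auto
      have 0: "eval2 F (u *\<^sub>R q + v *\<^sub>R b) = 0" using F oval[OF u(3)] unfolding vanishing_ideal_def by blast
      have "norm (q + v *\<^sub>R b) \<le> 2" using norm_triangle_ineq[of q "v *\<^sub>R b"] nb v by simp
      moreover have "norm (u *\<^sub>R q + v *\<^sub>R b) \<le> 2" using norm_triangle_ineq[of "u *\<^sub>R q" "v *\<^sub>R b"] nb u v by simp
      ultimately have "\<bar>eval2 F (q + v *\<^sub>R b) - eval2 F (u *\<^sub>R q + v *\<^sub>R b)\<bar> \<le> K * norm (q + v *\<^sub>R b - (u *\<^sub>R q + v *\<^sub>R b))"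
        by (rule K(2))
      also have "q + v *\<^sub>R b - (u *\<^sub>R q + v *\<^sub>R b) = (1 - u) *\<^sub>R q" by (simp add: algebra_simps)
      also have "K * norm ((1 - u) *\<^sub>R q) \<le> K * v ^ (2 * n)" using nb u K(1) by (intro mult_left_mono) auto
      finally show ?thesis by (simp add: poly_restrict_to_line 0)
    qed
    then have "[:0, 1:] ^ (2 * n) dvd restrict_to_line F q b" by (rule poly_small_imp_dvd)
    moreover have "[:0, 1:] ^ 3 dvd ([:0, 1:] ^ (2 * n) :: real poly)" using n by (intro le_imp_power_dvd) simp
    ultimately show "3 \<le> vanishing_order (restrict_to_line F q b)"
      unfolding vanishing_order_ge_iff using dvd_trans by blast
  qed
  moreover have "q + b \<in> {X. pow_map n q \<bullet> X = 1}"
    using q n by (auto simp: b_def pow_map_def opow_def inner_prod_def power_0_left)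
  moreover have "b \<noteq> 0" using nb by auto
  ultimately show ?thesis unfolding inflection_points_def
    using fermat_oval_smooth[OF n o] tangent_line_fermat_oval[OF n o] by blast
qed

text \<open>Off the axes the second derivative of \<open>x\<^bsup>2n\<^esup> + y\<^bsup>2n\<^esup>\<close> is positive in every direction, so
  each line meets the oval with multiplicity at most \<open>2\<close>.\<close>

lemma inflection_is_axis_point:
  assumes n: "n > 1" and q: "q \<in> inflection_points (fermat_oval n)"
  shows "q \<in> axis_points"
proof -
  obtain u v where uv: "q = (u, v)" by (cases q)
  obtain w where o: "q \<in> fermat_oval n" and w: "w \<noteq> 0" "3 \<le> intersection_multiplicity (fermat_oval n) q w"
    using q unfolding inflection_points_def algebraically_smooth_at_def by blast
  obtain a b where ab: "w = (a, b)" by (cases w)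
  define g where "g = restrict_to_line (fermat_poly n) q w"
  have "3 \<le> vanishing_order g"
    using w(2) INF_lower[OF fermat_poly_vanishes, of "\<lambda>F. vanishing_order (restrict_to_line F q w)" n]
    unfolding intersection_multiplicity_def g_def by (rule order_trans)
  then obtain h where h: "g = [:0, 1:] ^ 3 * h" unfolding vanishing_order_ge_iff by blast
  have z: "poly (pderiv (pderiv g)) 0 = 0"
    unfolding h power3_eq_cube by (simp add: pderiv_mult pderiv_pCons)
  have g: "g = [:u, a:] ^ (2 * n) + [:v, b:] ^ (2 * n) - 1"
  proof -
    have "poly g t = poly ([:u, a:] ^ (2 * n) + [:v, b:] ^ (2 * n) - 1) t" for t
      by (simp add: g_def poly_restrict_to_line eval2_fermat_poly uv ab)
    then show ?thesis by (simp add: poly_eq_poly_eq_iff[symmetric] fun_eq_iff)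
  qed
  have p: "poly (pderiv (pderiv ([:x, c:] ^ (2 * n)))) 0 = 2 * n * (2 * n - 1) * (x ^ (2 * n - 2) * c\<^sup>2)" for x c :: real
    using n by (simp add: pderiv_power pderiv_smult pderiv_mult pderiv_pCons power2_eq_square of_nat_diff numeral_2_eq_2)
  have "2 * n * (2 * n - 1) * (u ^ (2 * n - 2) * a\<^sup>2 + v ^ (2 * n - 2) * b\<^sup>2) = 0"
    using z unfolding g by (simp add: pderiv_diff pderiv_add p distrib_left)
  then have s: "u ^ (2 * n - 2) * a\<^sup>2 + v ^ (2 * n - 2) * b\<^sup>2 = 0" using n by simp
  have "u = 0 \<or> v = 0"
  proof (rule ccontr)
    assume "\<not> (u = 0 \<or> v = 0)"
    then have "u ^ (2 * n - 2) > 0" "v ^ (2 * n - 2) > 0" "u \<noteq> 0" "v \<noteq> 0"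
      by (simp_all add: zero_less_power_eq)
    moreover have "u ^ (2 * n - 2) * a\<^sup>2 \<ge> 0" "v ^ (2 * n - 2) * b\<^sup>2 \<ge> 0" by (simp_all add: zero_le_even_power)
    then have "u ^ (2 * n - 2) * a\<^sup>2 = 0" "v ^ (2 * n - 2) * b\<^sup>2 = 0"
      using s by (simp_all only: add_nonneg_eq_0_iff)
    ultimately have "a = 0" "b = 0" by simp_all
    then show False using w(1) by (simp add: ab zero_prod_def)
  qed
  then show ?thesis using oval_axis_points[OF n] o unfolding uv by blast
qed

lemma inflection_points_fermat_oval: "n > 1 \<Longrightarrow> inflection_points (fermat_oval n) = axis_points"
  using axis_point_is_inflection inflection_is_axis_point by blast


section \<open>Polynomial functions on lines\<close>

text \<open>In the direction \<open>w\<close> a polynomial function restricts to polynomials of bounded degree whose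
  coefficients are again polynomial functions of the base point. For \<open>w = (0, 1)\<close> these
  coefficients at the points of a graph are the Taylor coefficients transversal to it.\<close>

lemma real_polynomial_function_on_line:
  fixes F :: "plane \<Rightarrow> real"
  assumes "real_polynomial_function F"
  shows "\<exists>K C. (\<forall>p u. F (p + u *\<^sub>R w) = poly (C p) u) \<and> (\<forall>p. degree (C p) \<le> K)
    \<and> (\<forall>j. real_polynomial_function (\<lambda>p. coeff (C p) j))"
  using assms
proof (induction F rule: real_polynomial_function.induct)
  case (linear f)
  interpret f: bounded_linear f by fact
  have "real_polynomial_function (\<lambda>p. coeff [:f p, f w:] j)" for j
    using linear by (cases j; cases "j - 1") (auto simp: real_polynomial_function.intros)
  then show ?case
    by (intro exI[of _ 1] exI[of _ "\<lambda>p. [:f p, f w:]"]) (auto simp: f.add f.scaleR)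
next
  case (const c)
  show ?case
    by (intro exI[of _ 0] exI[of _ "\<lambda>p. [:c:]"]) (auto simp: real_polynomial_function.intros)
next
  case (add f g)
  then obtain K C K' C' where
    "\<forall>p u. f (p + u *\<^sub>R w) = poly (C p) u" "\<forall>p. degree (C p) \<le> K" "\<forall>j. real_polynomial_function (\<lambda>p. coeff (C p) j)"
    "\<forall>p u. g (p + u *\<^sub>R w) = poly (C' p) u" "\<forall>p. degree (C' p) \<le> K'" "\<forall>j. real_polynomial_function (\<lambda>p. coeff (C' p) j)"
    by metis
  then show ?case
    by (intro exI[of _ "max K K'"] exI[of _ "\<lambda>p. C p + C' p"])
       (auto intro!: degree_add_le real_polynomial_function.intros(3) intro: le_max_iff_disj[THEN iffD2])
next
  case (mult f g)
  then obtain K C K' C' where *: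
    "\<forall>p u. f (p + u *\<^sub>R w) = poly (C p) u" "\<forall>p. degree (C p) \<le> K" "\<forall>j. real_polynomial_function (\<lambda>p. coeff (C p) j)"
    "\<forall>p u. g (p + u *\<^sub>R w) = poly (C' p) u" "\<forall>p. degree (C' p) \<le> K'" "\<forall>j. real_polynomial_function (\<lambda>p. coeff (C' p) j)"
    by metis
  have "real_polynomial_function (\<lambda>p. coeff (C p * C' p) j)" for j
    unfolding coeff_mult using * by (intro real_polynomial_function_sum real_polynomial_function.intros(4)) auto
  moreover have "degree (C p * C' p) \<le> K + K'" for p
    using * degree_mult_le[of "C p" "C' p"] by (meson add_mono order_trans)
  ultimately show ?case using *
    by (intro exI[of _ "K + K'"] exI[of _ "\<lambda>p. C p * C' p"]) auto
qed

lemma lagrange_interpolation: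
  fixes X :: "'a :: field set"
  assumes "finite X"
  shows "\<exists>L. \<forall>p. degree p < card X \<longrightarrow> (\<forall>t. poly p t = (\<Sum>x\<in>X. poly (L x) t * poly p x))"
proof -
  define L where "L = (\<lambda>x. smult (1 / (\<Prod>y\<in>X - {x}. x - y)) (\<Prod>y\<in>X - {x}. [:- y, 1:]))"
  have L: "poly (L x) y = (if y = x then 1 else 0)" if "x \<in> X" "y \<in> X" for x y
  proof (cases "y = x")
    case True
    have "(\<Prod>y\<in>X - {x}. x - y) \<noteq> 0" using assms by auto
    then show ?thesis using True by (simp add: L_def poly_prod)
  next
    case False
    then have "(\<Prod>z\<in>X - {x}. y - z) = 0" using assms that by auto
    then show ?thesis using False by (simp add: L_def poly_prod)
  qed
  have dL: "degree (L x) < card X" if "x \<in> X" for x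
  proof -
    have "degree (\<Prod>y\<in>X - {x}. [:- y, 1:]) = card (X - {x})"
      by (subst degree_prod_eq_sum_degree) auto
    then have "degree (L x) \<le> card (X - {x})" unfolding L_def using degree_smult_le by metis
    moreover have "card X > 0" using that assms by (auto simp: card_gt_0_iff)
    ultimately show ?thesis using that by simp
  qed
  have "poly p t = (\<Sum>x\<in>X. poly (L x) t * poly p x)" if d: "degree p < card X" for p t
  proof -
    let ?q = "\<Sum>x\<in>X. smult (poly p x) (L x)"
    have "p = ?q"
    proof (rule poly_eqI_degree)
      fix y assume "y \<in> X"
      then have "poly ?q y = (\<Sum>x\<in>X. if x = y then poly p x else 0)"
        using L by (auto simp: poly_sum intro!: sum.cong)
      also have "\<dots> = poly p y" using assms \<open>y \<in> X\<close> by simp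
      finally show "poly p y = poly ?q y" by simp
    next
      have "degree ?q \<le> card X - 1"
      proof (rule degree_sum_le[OF assms])
        fix x assume "x \<in> X"
        then show "degree (smult (poly p x) (L x)) \<le> card X - 1"
          using degree_smult_le[of "poly p x" "L x"] dL[of x] by linarith
      qed
      then show "degree ?q < card X" using d by linarith
    qed (rule d)
    then have "poly p t = poly ?q t" by simp
    then show ?thesis by (simp add: poly_sum mult.commute)
  qed
  then show ?thesis by blast
qed

text \<open>Polynomials of degree at most \<open>M\<close> in \<open>x\<close> are determined by their values at \<open>M + 1\<close> fixed
  nodes \<open>x > c\<close>, and at these nodes the function is a polynomial in \<open>y\<close>. So Lagrange interpolation
  in \<open>x\<close> writes it as a finite sum of products of polynomials in one variable.\<close>

lemma separately_polynomial:
  fixes F :: "real \<Rightarrow> real \<Rightarrow> real"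
  assumes rows: "\<And>y. y > c \<Longrightarrow> \<exists>p. degree p \<le> M \<and> (\<forall>x. F x y = poly p x)"
    and cols: "\<And>x. x > c \<Longrightarrow> \<exists>p. \<forall>y. F x y = poly p y"
  shows "\<exists>G. real_polynomial_function G \<and> (\<forall>x y. y > c \<longrightarrow> F x y = G (x, y))"
proof -
  define X where "X = (\<lambda>i. c + 1 + real i) ` {..M}"
  have fX: "finite X" by (simp add: X_def)
  have cX: "card X = Suc M" unfolding X_def by (subst card_image) (auto simp: inj_on_def)
  obtain L where L: "\<And>p t. degree p < card X \<Longrightarrow> poly p t = (\<Sum>x\<in>X. poly (L x) t * poly p x)"
    using lagrange_interpolation[OF fX] by blast
  have "\<forall>x\<in>X. \<exists>p. \<forall>y. F x y = poly p y" using cols by (auto simp: X_def)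
  then obtain P where P: "\<And>x y. x \<in> X \<Longrightarrow> F x y = poly (P x) y" by metis
  define G :: "plane \<Rightarrow> real" where "G = (\<lambda>r. \<Sum>x\<in>X. poly (L x) (fst r) * poly (P x) (snd r))"
  have "real_polynomial_function G" unfolding G_def
    by (intro real_polynomial_function_sum fX real_polynomial_function.intros(4) real_polynomial_function_poly
        real_polynomial_function.intros(1) bounded_linear_fst bounded_linear_snd)
  moreover have "F x y = G (x, y)" if yc: "y > c" for x y
  proof -
    obtain p where p: "degree p \<le> M" "\<And>x. F x y = poly p x" using rows[OF yc] by blast
    have "F x y = (\<Sum>t\<in>X. poly (L t) x * poly p t)" using L[of p x] p cX by simp
    also have "\<dots> = G (x, y)" unfolding G_def fst_conv snd_conv
      by (intro sum.cong refl arg_cong2[where f="(*)"]) (simp add: P flip: p(2))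
    finally show ?thesis .
  qed
  ultimately show ?thesis by blast
qed

lemma real_polynomial_function_DERIV:
  fixes f :: "plane \<Rightarrow> real"
  assumes "real_polynomial_function f" "(a has_real_derivative a') (at x)" "(b has_real_derivative b') (at x)"
  shows "\<exists>d. ((\<lambda>x. f (a x, b x)) has_real_derivative d) (at x)"
  using assms(1)
proof (induction f rule: real_polynomial_function.induct)
  case (linear f)
  interpret f: bounded_linear f by fact
  have "f (u, v) = u * f (1, 0) + v * f (0, 1)" for u v
    using f.add[of "u *\<^sub>R (1, 0)" "v *\<^sub>R (0, 1)"] f.scaleR[of u "(1,0)"] f.scaleR[of v "(0,1)"] by simp
  then have e: "(\<lambda>x. f (a x, b x)) = (\<lambda>x. a x * f (1, 0) + b x * f (0, 1))" by (intro ext)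
  show ?case unfolding e
    by (rule exI) (rule DERIV_add[OF DERIV_cmult_right[OF assms(2)] DERIV_cmult_right[OF assms(3)]])
next
  case (const c)
  show ?case by (rule exI) (rule DERIV_const)
next
  case (add f g)
  then show ?case by (metis DERIV_add)
next
  case (mult f g)
  then show ?case by (metis DERIV_mult)
qed

text \<open>The height of the tangent over a graph, divided by \<open>s\<^sup>2\<close>, is differentiable at the point of
  tangency; by Taylor's theorem its value there is \<open>- Y2 x / 2\<close> and its derivative \<open>- Y3 x / 6\<close>.\<close>

lemma second_order_quotient_DERIV:
  fixes Y :: "real \<Rightarrow> real"
  assumes "e > 0"
    and Y: "\<And>t. \<bar>t - x\<bar> < e \<Longrightarrow> (Y has_real_derivative Y1 t) (at t)"
      "\<And>t. \<bar>t - x\<bar> < e \<Longrightarrow> (Y1 has_real_derivative Y2 t) (at t)"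
      "\<And>t. \<bar>t - x\<bar> < e \<Longrightarrow> (Y2 has_real_derivative Y3 t) (at t)"
    and c: "isCont Y3 x"
  defines "U \<equiv> (\<lambda>s. if s = 0 then - Y2 x / 2 else (Y x + s * Y1 x - Y (x + s)) / s\<^sup>2)"
  shows "(U has_real_derivative - Y3 x / 6) (at 0)"
  unfolding has_field_derivative_iff LIM_eq
proof (intro allI impI)
  fix r :: real assume "r > 0"
  then obtain d where d: "d > 0" "\<And>t. \<bar>t - x\<bar> < d \<Longrightarrow> \<bar>Y3 t - Y3 x\<bar> < r"
    using c unfolding continuous_at_eps_delta dist_real_def by blast
  show "\<exists>s>0. \<forall>h. h \<noteq> 0 \<and> norm (h - 0) < s \<longrightarrow> norm ((U h - U 0) / (h - 0) - - Y3 x / 6) < r"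
  proof (intro exI[of _ "min d e"] conjI allI impI)
    fix h :: real assume h: "h \<noteq> 0 \<and> norm (h - 0) < min d e"
    define diff where "diff = (\<lambda>m::nat. if m = 0 then Y else if m = 1 then Y1 else if m = 2 then Y2 else Y3)"
    have "\<exists>t. (if x + h < x then x + h < t \<and> t < x else x < t \<and> t < x + h) \<and>
      Y (x + h) = (\<Sum>m<3. diff m x / fact m * (x + h - x) ^ m) + diff 3 t / fact 3 * (x + h - x) ^ 3"
    proof (rule Taylor[where a = "x - \<bar>h\<bar>" and b = "x + \<bar>h\<bar>"])
      show "\<forall>(m::nat) t. m < 3 \<and> x - \<bar>h\<bar> \<le> t \<and> t \<le> x + \<bar>h\<bar> \<longrightarrow> (diff m has_real_derivative diff (Suc m) t) (at t)"
      proof (intro allI impI)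
        fix m :: nat and t assume t: "m < 3 \<and> x - \<bar>h\<bar> \<le> t \<and> t \<le> x + \<bar>h\<bar>"
        then have "\<bar>t - x\<bar> < e" using h by auto
        moreover have "m = 0 \<or> m = 1 \<or> m = 2" using t by auto
        ultimately show "(diff m has_real_derivative diff (Suc m) t) (at t)"
          using Y[of t] by (elim disjE) (simp_all add: diff_def numeral_2_eq_2)
      qed
    qed (use h in \<open>auto simp: diff_def\<close>)
    then obtain t where t': "if x + h < x then x + h < t \<and> t < x else x < t \<and> t < x + h"
      and Yh: "Y (x + h) = (\<Sum>m<3. diff m x / fact m * h ^ m) + diff 3 t / fact 3 * h ^ 3"
      unfolding add_diff_cancel_left' by blast
    from t' have t: "\<bar>t - x\<bar> < \<bar>h\<bar>" by (auto split: if_split_asm)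
    from Yh have e: "Y (x + h) = Y x + Y1 x * h + Y2 x / 2 * h\<^sup>2 + Y3 t / 6 * h ^ 3"
      by (simp add: diff_def numeral_3_eq_3 fact_numeral numeral_2_eq_2)
    have "U h = - (Y2 x / 2 * h\<^sup>2 + Y3 t / 6 * h ^ 3) / h\<^sup>2"
      using h by (simp add: U_def e)
    also have "\<dots> = - Y2 x / 2 - Y3 t / 6 * h"
      using h by (simp add: divide_simps) (simp add: power2_eq_square power3_eq_cube algebra_simps)
    finally have "(U h - U 0) / (h - 0) = - Y3 t / 6"
      using h by (simp add: U_def)
    moreover have "\<bar>Y3 t - Y3 x\<bar> < r" using d t h by auto
    ultimately show "norm ((U h - U 0) / (h - 0) - - Y3 x / 6) < r" by (simp add: abs_minus_commute)
  qed (use d assms in auto)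
qed

text \<open>The map \<open>s \<mapsto> - s / (1 + 2\<kappa>s)\<close> has derivative \<open>- 1\<close> at \<open>0\<close>, so differentiating the symmetry
  gives \<open>2 R' = 2\<kappa>(j - i) R 0\<close>.\<close>

lemma reflection_symmetric_derivative:
  fixes R :: "real \<Rightarrow> real"
  assumes R: "(R has_real_derivative R') (at 0)"
    and ev: "eventually (\<lambda>s. (1 + 2 * \<kappa> * s) ^ i * R s = (1 + 2 * \<kappa> * s) ^ j * R (- s / (1 + 2 * \<kappa> * s))) (nhds 0)"
  shows "R' = \<kappa> * (real j - real i) * R 0"
proof -
  have p: "((\<lambda>s. (1 + 2 * \<kappa> * s) ^ i) has_real_derivative 2 * \<kappa> * real i) (at 0)" for i
    by (rule derivative_eq_intros refl)+ simp
  have 1: "((\<lambda>s. (1 + 2 * \<kappa> * s) ^ i * R s) has_real_derivative 2 * \<kappa> * real i * R 0 + R') (at 0)"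
    by (rule DERIV_cong[OF DERIV_mult[OF p R]]) simp
  have l: "((\<lambda>s. 1 + 2 * \<kappa> * s) has_real_derivative 2 * \<kappa>) (at 0)"
    by (rule derivative_eq_intros refl)+ simp
  have "((\<lambda>s. - s / (1 + 2 * \<kappa> * s)) has_real_derivative - 1) (at 0)"
    by (rule DERIV_cong[OF DERIV_divide[OF DERIV_minus[OF DERIV_ident] l]]) simp_all
  moreover have "(R has_real_derivative R') (at (- 0 / (1 + 2 * \<kappa> * 0)))" using R by simp
  ultimately have q: "((\<lambda>s. R (- s / (1 + 2 * \<kappa> * s))) has_real_derivative R' * (- 1)) (at 0)"
    by (rule DERIV_chain2[rotated])
  have "((\<lambda>s. (1 + 2 * \<kappa> * s) ^ j * R (- s / (1 + 2 * \<kappa> * s))) has_real_derivative 2 * \<kappa> * real j * R 0 - R') (at 0)"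
    by (rule DERIV_cong[OF DERIV_mult[OF p q]]) simp
  from DERIV_unique[OF 1 DERIV_cong_ev[OF refl ev refl, THEN iffD2, OF this]]
  have "2 * \<kappa> * real i * R 0 + R' = 2 * \<kappa> * real j * R 0 - R'" .
  then show ?thesis by (simp add: algebra_simps)
qed


section \<open>Polynomials symmetric under reflection along an arc\<close>

lemma poly_as_sum_upto:
  fixes p :: "'a :: comm_semiring_1 poly"
  assumes "degree p \<le> N"
  shows "poly p x = (\<Sum>i\<le>N. coeff p i * x ^ i)"
  unfolding poly_altdef by (rule sum.mono_neutral_left) (use assms in \<open>auto simp: coeff_eq_0\<close>)

text \<open>A graph \<open>y = Y(x)\<close> over \<open>(0, 1)\<close> with non-vanishing curvature, together with the first three
  derivatives of \<open>Y\<close>.\<close>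

locale smooth_arc =
  fixes Y Y1 Y2 Y3 :: "real \<Rightarrow> real"
  assumes arc_deriv: "\<And>x. 0 < x \<Longrightarrow> x < 1 \<Longrightarrow> (Y has_real_derivative Y1 x) (at x)"
    and arc_deriv2: "\<And>x. 0 < x \<Longrightarrow> x < 1 \<Longrightarrow> (Y1 has_real_derivative Y2 x) (at x)"
    and arc_deriv3: "\<And>x. 0 < x \<Longrightarrow> x < 1 \<Longrightarrow> (Y2 has_real_derivative Y3 x) (at x)"
    and arc_deriv3_cont: "\<And>x. 0 < x \<Longrightarrow> x < 1 \<Longrightarrow> isCont Y3 x"
    and curved: "\<And>x. 0 < x \<Longrightarrow> x < 1 \<Longrightarrow> Y2 x \<noteq> 0"
begin

definition rho :: "real \<Rightarrow> real" where "rho x = x\<^sup>2 + (Y x)\<^sup>2"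

text \<open>Half the logarithmic derivative of \<open>rho\<close>; for the point \<open>d\<close> of the arc and the tangent
  vector \<open>w = (1, Y')\<close> it is \<open>(w \<bullet> d) / \<bar>d\<bar>\<^sup>2\<close>.\<close>

definition kappa :: "real \<Rightarrow> real" where "kappa x = (x + Y x * Y1 x) / rho x"

text \<open>The billiard reflection in the dual plane. On the tangent line at \<open>d\<close> the points with the
  parameters \<open>s\<close> and \<open>- s / (1 + 2\<kappa>s)\<close> are seen from the origin at equal angles on the two sides
  of \<open>d\<close>, and the ratio of their distances from the origin is \<open>1 + 2\<kappa>s\<close>. The relation says that
  \<open>G(r) / \<bar>r\<bar>\<^bsup>2D\<^esup>\<close> takes the same value at both.\<close>

definition reflection_symmetric :: "nat \<Rightarrow> (plane \<Rightarrow> real) \<Rightarrow> bool" where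
  "reflection_symmetric D G \<longleftrightarrow> (\<forall>x s. 0 < x \<longrightarrow> x < 1 \<longrightarrow> 0 < 1 + 2 * kappa x * s \<longrightarrow>
     G (x + s, Y x + s * Y1 x) =
     (1 + 2 * kappa x * s) ^ (2 * D) *
       G (x + (- s / (1 + 2 * kappa x * s)), Y x + (- s / (1 + 2 * kappa x * s)) * Y1 x))"

lemma rho_pos: "0 < x \<Longrightarrow> rho x > 0"
  unfolding rho_def by (simp add: add_pos_nonneg)

lemma rho_deriv:
  assumes "0 < x" "x < 1"
  shows "(rho has_real_derivative 2 * kappa x * rho x) (at x)"
proof -
  have "(rho has_real_derivative 2 * x + 2 * Y x * Y1 x) (at x)"
    unfolding rho_def[abs_def] by (rule derivative_eq_intros arc_deriv[OF assms] refl)+ simp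
  then show ?thesis using rho_pos[OF assms(1)] by (simp add: kappa_def mult.assoc)
qed

text \<open>If \<open>G\<close> vanishes to order \<open>k\<close> on the arc, then on the tangent line at \<open>x\<close> it is \<open>s\<^bsup>2k\<^esup> R(s)\<close>
  with \<open>R = U\<^sup>k V\<close>, where \<open>s\<^sup>2 U\<close> is the height of the tangent over the arc and \<open>V 0\<close> is the
  \<open>k\<close>-th transversal coefficient. The symmetry of \<open>G\<close> fixes \<open>R' 0\<close> in terms of \<open>R 0\<close>, which is the
  asserted differential equation.\<close>

lemma transversal_coefficient_deriv:
  assumes C: "\<And>p u. G (p + u *\<^sub>R (0, 1)) = poly (C p) u" "\<And>p. degree (C p) \<le> K"
      "\<And>j. real_polynomial_function (\<lambda>p. coeff (C p) j)"
    and sym: "reflection_symmetric D G"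
    and z: "\<And>j t. j < k \<Longrightarrow> 0 < t \<Longrightarrow> t < 1 \<Longrightarrow> coeff (C (t, Y t)) j = 0"
    and x: "0 < x" "x < 1"
  shows "((\<lambda>t. coeff (C (t, Y t)) k) has_real_derivative
     coeff (C (x, Y x)) k * (2 * kappa x * (real D - real k) - real k * Y3 x / (3 * Y2 x))) (at x)"
proof -
  let ?\<kappa> = "kappa x"
  define \<gamma> where "\<gamma> = (\<lambda>j t. coeff (C (t, Y t)) j)"
  have "\<exists>d. (\<gamma> j has_real_derivative d) (at x)" for j
    unfolding \<gamma>_def by (rule real_polynomial_function_DERIV[OF C(3) DERIV_ident arc_deriv[OF x]])
  then obtain d where d: "\<And>j. (\<gamma> j has_real_derivative d j) (at x)" by metis
  define e where "e = min x (1 - x)"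
  have e: "e > 0" "\<And>t. \<bar>t - x\<bar> < e \<Longrightarrow> 0 < t \<and> t < 1" using x by (auto simp: e_def)
  define U where "U = (\<lambda>s. if s = 0 then - Y2 x / 2 else (Y x + s * Y1 x - Y (x + s)) / s\<^sup>2)"
  have dU: "(U has_real_derivative - Y3 x / 6) (at 0)" unfolding U_def
    by (rule second_order_quotient_DERIV[OF e(1) _ _ _ arc_deriv3_cont[OF x]])
       (use e arc_deriv arc_deriv2 arc_deriv3 in auto)
  have U: "Y x + s * Y1 x = Y (x + s) + s\<^sup>2 * U s" for s by (simp add: U_def)
  define V where "V = (\<lambda>s. \<Sum>j\<in>{k..k+K}. \<gamma> j (x + s) * (s\<^sup>2 * U s) ^ (j - k))"
  define R where "R = (\<lambda>s. U s ^ k * V s)"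
  have dq: "((\<lambda>s. s\<^sup>2 * U s) has_real_derivative 0) (at 0)"
    by (rule DERIV_cong[OF DERIV_mult[OF DERIV_power[OF DERIV_ident] dU]]) simp
  have dg: "((\<lambda>s. \<gamma> j (x + s)) has_real_derivative d j) (at 0)" for j
    using DERIV_chain2[of "\<gamma> j" "d j" "\<lambda>s. x + s" 0 1 UNIV] d[of j]
      DERIV_add[OF DERIV_const[of x] DERIV_ident, of 0 UNIV] by simp
  have dt: "((\<lambda>s. \<gamma> j (x + s) * (s\<^sup>2 * U s) ^ (j - k)) has_real_derivative d j * 0 ^ (j - k)) (at 0)" for j
    by (rule DERIV_cong[OF DERIV_mult[OF dg DERIV_power[OF dq]]]) simp
  have "(V has_real_derivative (\<Sum>j\<in>{k..k+K}. d j * 0 ^ (j - k))) (at 0)"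
    unfolding V_def by (rule DERIV_sum) (rule dt)
  also have "(\<Sum>j\<in>{k..k+K}. d j * 0 ^ (j - k)) = (\<Sum>j\<in>{k..k+K}. if j = k then d j else 0)"
    by (rule sum.cong) auto
  also have "\<dots> = d k" by simp
  finally have dV: "(V has_real_derivative d k) (at 0)" .
  have "V 0 = (\<Sum>j\<in>{k..k+K}. if j = k then \<gamma> j x else 0)"
    unfolding V_def by (rule sum.cong) auto
  then have V0: "V 0 = \<gamma> k x" by simp
  \<comment> \<open>The expansion of \<open>G\<close> in powers of the height \<open>s\<^sup>2 U s\<close>; the terms below \<open>k\<close> vanish.\<close>
  have GR: "G (x + s, Y x + s * Y1 x) = s ^ (2 * k) * R s" if s: "\<bar>s\<bar> < e" for s
  proof -
    have "0 < x + s" "x + s < 1" using e(2)[of "x + s"] s by auto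
    then have z': "\<gamma> i (x + s) = 0" if "i < k" for i using z that by (simp add: \<gamma>_def)
    have "G (x + s, Y x + s * Y1 x) = poly (C (x + s, Y (x + s))) (s\<^sup>2 * U s)"
      using C(1)[of "(x + s, Y (x + s))" "s\<^sup>2 * U s"] by (simp add: U)
    also have "\<dots> = (\<Sum>i\<le>k + K. \<gamma> i (x + s) * (s\<^sup>2 * U s) ^ i)"
      unfolding \<gamma>_def by (rule poly_as_sum_upto) (use C(2) in \<open>simp add: trans_le_add2\<close>)
    also have "\<dots> = (\<Sum>i\<in>{k..k+K}. \<gamma> i (x + s) * (s\<^sup>2 * U s) ^ i)"
      by (rule sum.mono_neutral_right) (use z' in auto)
    also have "\<dots> = (s\<^sup>2 * U s) ^ k * V s"
      unfolding V_def sum_distrib_left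
      by (rule sum.cong) (auto simp: mult.left_commute simp flip: power_add)
    finally show ?thesis by (simp add: R_def power_mult_distrib power_mult mult.assoc)
  qed
  have dR: "(R has_real_derivative real k * (U 0 ^ (k - 1) * (- Y3 x / 6)) * V 0 + U 0 ^ k * d k) (at 0)"
    unfolding R_def
    by (rule DERIV_cong[OF DERIV_mult[OF DERIV_power[OF dU] dV]]) (simp add: algebra_simps)
  have tl: "((\<lambda>s. 1 + 2 * ?\<kappa> * s) \<longlongrightarrow> 1 + 2 * ?\<kappa> * 0) (nhds 0)" by (intro tendsto_intros) (simp add: filterlim_ident)
  have "((\<lambda>s. - s / (1 + 2 * ?\<kappa> * s)) \<longlongrightarrow> - 0 / (1 + 2 * ?\<kappa> * 0)) (nhds 0)"
    by (intro tendsto_divide tendsto_minus tl) (simp_all add: filterlim_ident)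
  then have tq: "((\<lambda>s. - s / (1 + 2 * ?\<kappa> * s)) \<longlongrightarrow> 0) (nhds 0)" by simp
  have ev1: "eventually (\<lambda>s. 0 < 1 + 2 * ?\<kappa> * s) (nhds 0)"
    using order_tendstoD(1)[OF tl, of 0] by simp
  have ev2: "eventually (\<lambda>s. \<bar>- s / (1 + 2 * ?\<kappa> * s)\<bar> < e) (nhds 0)"
    using tendstoD[OF tq e(1)] by (simp add: dist_real_def)
  have ev3: "eventually (\<lambda>s. \<bar>s\<bar> < e) (nhds 0)"
    using e(1) by (auto simp: eventually_nhds_metric dist_real_def)
  have "eventually (\<lambda>s. (1 + 2 * ?\<kappa> * s) ^ (2 * k) * R s
      = (1 + 2 * ?\<kappa> * s) ^ (2 * D) * R (- s / (1 + 2 * ?\<kappa> * s))) (nhds 0)"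
    using ev1 ev2 ev3
  proof eventually_elim
    case (elim s)
    let ?l = "1 + 2 * ?\<kappa> * s"
    show ?case
    proof (cases "s = 0")
      case False
      have "s ^ (2 * k) * R s = ?l ^ (2 * D) * ((- s / ?l) ^ (2 * k) * R (- s / ?l))"
        using sym x elim unfolding reflection_symmetric_def GR[OF elim(2), symmetric] GR[OF elim(3), symmetric]
        by blast
      also have "(- s / ?l) ^ (2 * k) = s ^ (2 * k) / ?l ^ (2 * k)" by (simp add: power_divide)
      finally have "s ^ (2 * k) * (?l ^ (2 * k) * R s) = s ^ (2 * k) * (?l ^ (2 * D) * R (- s / ?l))"
        using elim(1) by (simp add: field_simps)
      then show ?thesis using False by simp
    qed simp
  qed
  from reflection_symmetric_derivative[OF dR this]
  have "real k * (U 0 ^ (k - 1) * (- Y3 x / 6)) * V 0 + U 0 ^ k * d k = ?\<kappa> * (real (2 * D) - real (2 * k)) * (U 0 ^ k * V 0)"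
    unfolding R_def .
  moreover have a: "real k * (U 0 ^ (k - 1) * (- Y3 x / 6)) = U 0 ^ k * (real k * Y3 x / (3 * Y2 x))"
    using curved[OF x] by (cases k) (auto simp: U_def field_simps)
  ultimately have "U 0 ^ k * (real k * Y3 x / (3 * Y2 x) * V 0 + d k) = U 0 ^ k * (?\<kappa> * 2 * (real D - real k) * V 0)"
    unfolding a by (simp add: algebra_simps)
  moreover have "U 0 ^ k \<noteq> 0" using curved[OF x] by (simp add: U_def)
  ultimately have "real k * Y3 x / (3 * Y2 x) * V 0 + d k = ?\<kappa> * 2 * (real D - real k) * V 0"
    using mult_left_cancel by blast
  then have "d k = \<gamma> k x * (2 * ?\<kappa> * (real D - real k) - real k * Y3 x / (3 * Y2 x))"
    unfolding V0 by (simp add: algebra_simps)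
  then show ?thesis using d[of k] by (simp add: \<gamma>_def)
qed

text \<open>The differential equation says that \<open>Z = \<gamma>\<^sup>3 Y''\<^sup>k \<rho>\<^bsup>3(k - D)\<^esup>\<close> is constant. For \<open>k > 0\<close>
  this constant is \<open>0\<close> because \<open>Y''\<close> tends to \<open>0\<close> at the inflection point over \<open>x = 0\<close>.\<close>

lemma transversal_coefficient_zero:
  assumes C: "\<And>p u. G (p + u *\<^sub>R (0, 1)) = poly (C p) u" "\<And>p. degree (C p) \<le> K"
      "\<And>j. real_polynomial_function (\<lambda>p. coeff (C p) j)"
    and sym: "reflection_symmetric D G"
    and z: "\<And>j t. j < k \<Longrightarrow> 0 < t \<Longrightarrow> t < 1 \<Longrightarrow> coeff (C (t, Y t)) j = 0"
    and k: "k > 0"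
    and lim: "(Y \<longlongrightarrow> 1) (at_right 0)" "(Y2 \<longlongrightarrow> 0) (at_right 0)"
    and x: "0 < x" "x < 1"
  shows "coeff (C (x, Y x)) k = 0"
proof -
  define \<gamma> where "\<gamma> = (\<lambda>t. coeff (C (t, Y t)) k)"
  \<comment> \<open>The exponent is chosen so that the terms with \<open>kappa\<close> in the logarithmic derivative cancel.\<close>
  define Z where "Z = (\<lambda>t. \<gamma> t ^ 3 * Y2 t ^ k * rho t powr (3 * (real k - real D)))"
  have "(Z has_real_derivative 0) (at t within {0<..<1})" if "t \<in> {0<..<1}" for t
  proof -
    have t: "0 < t" "t < 1" using that by auto
    have dg: "(\<gamma> has_real_derivative \<gamma> t * (2 * kappa t * (real D - real k) - real k * Y3 t / (3 * Y2 t))) (at t)"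
      unfolding \<gamma>_def by (rule transversal_coefficient_deriv[OF C sym z t])
    have dr: "((\<lambda>t. rho t powr (3 * (real k - real D))) has_real_derivative
        6 * (real k - real D) * kappa t * rho t powr (3 * (real k - real D))) (at t)"
      by (rule DERIV_cong[OF DERIV_fun_powr[OF rho_deriv[OF t] rho_pos[OF t(1)]]])
         (use rho_pos[OF t(1)] in \<open>simp add: powr_diff\<close>)
    have dY: "((\<lambda>t. Y2 t ^ k) has_real_derivative Y2 t ^ k * (real k * Y3 t / Y2 t)) (at t)"
      by (rule DERIV_cong[OF DERIV_power[OF arc_deriv3[OF t]]]) (use curved[OF t] in \<open>cases k; simp\<close>)
    have dg3: "((\<lambda>t. \<gamma> t ^ 3) has_real_derivative \<gamma> t ^ 3 * (6 * kappa t * (real D - real k) - real k * Y3 t / Y2 t)) (at t)"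
      by (rule DERIV_cong[OF DERIV_power[OF dg]])
         (use curved[OF t] in \<open>simp add: field_simps power2_eq_square power3_eq_cube\<close>)
    have "(Z has_real_derivative 0) (at t)" unfolding Z_def
      by (rule DERIV_cong[OF DERIV_mult[OF DERIV_mult[OF dg3 dY] dr]]) (simp add: algebra_simps)
    then show ?thesis by (rule has_field_derivative_at_within)
  qed
  then obtain c where c: "\<And>t. t \<in> {0<..<1} \<Longrightarrow> Z t = c"
    using has_field_derivative_zero_constant[of "{0<..<1::real}" Z] by (meson convex_real_interval(8))
  have ev: "eventually (\<lambda>t. t \<in> {0<..<1}) (at_right (0::real))"
    by (rule eventually_at_right_real) simp
  have "isCont (\<lambda>p. coeff (C p) k) (0, 1)"
    using C(3)[of k] by (rule continuous_real_polymonial_function)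
  moreover have "((\<lambda>t. (t, Y t)) \<longlongrightarrow> (0, 1)) (at_right 0)"
    by (intro tendsto_Pair lim) simp
  ultimately have lg: "(\<gamma> \<longlongrightarrow> coeff (C (0, 1)) k) (at_right 0)"
    unfolding \<gamma>_def by (rule isCont_tendsto_compose)
  have "(rho \<longlongrightarrow> 0\<^sup>2 + 1\<^sup>2) (at_right 0)" unfolding rho_def[abs_def] by (intro tendsto_intros lim)
  then have "((\<lambda>t. rho t powr (3 * (real k - real D))) \<longlongrightarrow> (0\<^sup>2 + 1\<^sup>2) powr (3 * (real k - real D))) (at_right 0)"
    by (intro tendsto_powr tendsto_const) auto
  then have "(Z \<longlongrightarrow> coeff (C (0, 1)) k ^ 3 * 0 ^ k * (0\<^sup>2 + 1\<^sup>2) powr (3 * (real k - real D))) (at_right 0)"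
    unfolding Z_def by (intro tendsto_mult tendsto_power lg lim(2))
  moreover have "(0::real) ^ k = 0" using k by simp
  ultimately have "(Z \<longlongrightarrow> 0) (at_right 0)" by (simp del: power_eq_0_iff)
  moreover have "(Z \<longlongrightarrow> c) (at_right 0)"
    by (rule tendsto_eventually) (use ev in \<open>auto elim!: eventually_mono simp: c\<close>)
  ultimately have "c = 0" using tendsto_unique trivial_limit_at_right_real by blast
  then have "Z x = 0" using c x by simp
  then show ?thesis using curved[OF x] rho_pos[OF x(1)] by (simp add: Z_def \<gamma>_def)
qed

lemma reflection_symmetric_norm_power:
  "reflection_symmetric D (\<lambda>q. c * (q \<bullet> q) ^ D)"
  unfolding reflection_symmetric_def
proof (intro allI impI)
  fix x s assume x: "0 < x" "x < 1" and l: "0 < 1 + 2 * kappa x * s"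
  define l where "l = 1 + 2 * kappa x * s"
  define y y1 where "y = Y x" and "y1 = Y1 x"
  have r: "x * x + y * y > 0" using x by (simp add: add_pos_nonneg)
  have k: "(l - 1) * (x * x + y * y) = 2 * s * (x + y * y1)"
  proof -
    have "kappa x * (x * x + y * y) = x + y * y1"
      using rho_pos[OF x(1)] x(1) by (simp add: kappa_def rho_def y_def y1_def flip: power2_eq_square)
    then show ?thesis by (simp add: l_def mult.assoc mult.left_commute[of s])
  qed
  have "l\<^sup>2 * ((x + (- s / l)) * (x + (- s / l)) + (y + (- s / l) * y1) * (y + (- s / l) * y1))
    = (l * x - s) * (l * x - s) + (l * y - s * y1) * (l * y - s * y1)"
    using l unfolding l_def[symmetric] by (simp add: field_simps power2_eq_square)
  also have "\<dots> = (x + s) * (x + s) + (y + s * y1) * (y + s * y1)"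
    using k by algebra
  finally have "((x + s) * (x + s) + (y + s * y1) * (y + s * y1)) ^ D
    = l ^ (2 * D) * ((x + (- s / l)) * (x + (- s / l)) + (y + (- s / l) * y1) * (y + (- s / l) * y1)) ^ D"
    by (metis power_mult power_mult_distrib)
  then show "c * ((x + s, Y x + s * Y1 x) \<bullet> (x + s, Y x + s * Y1 x)) ^ D =
       (1 + 2 * kappa x * s) ^ (2 * D) *
       (c * ((x + - s / (1 + 2 * kappa x * s), Y x + - s / (1 + 2 * kappa x * s) * Y1 x) \<bullet>
         (x + - s / (1 + 2 * kappa x * s), Y x + - s / (1 + 2 * kappa x * s) * Y1 x)) ^ D)"
    unfolding l_def[symmetric] y_def[symmetric] y1_def[symmetric] inner_Pair inner_real_def by simp
qed

text \<open>For \<open>k = 0\<close> the differential equation gives \<open>G = c \<rho>\<^sup>D\<close> on the arc. The difference of \<open>G\<close>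
  and \<open>c \<bar>q\<bar>\<^bsup>2D\<^esup>\<close> has the same symmetry, so all its transversal coefficients vanish, one after the
  other.\<close>

theorem reflection_symmetric_imp_radial:
  assumes G: "real_polynomial_function G" and sym: "reflection_symmetric D G"
    and lim: "(Y \<longlongrightarrow> 1) (at_right 0)" "(Y2 \<longlongrightarrow> 0) (at_right 0)"
  shows "\<exists>c. \<forall>q. G q = c * (q \<bullet> q) ^ D"
proof -
  obtain K C where C: "\<And>p u. G (p + u *\<^sub>R (0, 1)) = poly (C p) u" "\<And>p. degree (C p) \<le> K"
      "\<And>j. real_polynomial_function (\<lambda>p. coeff (C p) j)"
    using real_polynomial_function_on_line[OF G, of "(0, 1)"] by metis
  have G0: "coeff (C p) 0 = G p" for p using C(1)[of p 0] by (simp add: poly_0_coeff_0 flip: zero_prod_def)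
  have "((\<lambda>t. G (t, Y t) / rho t ^ D) has_real_derivative 0) (at t within {0<..<1})" if "t \<in> {0<..<1}" for t
  proof -
    have t: "0 < t" "t < 1" using that by auto
    have dG: "((\<lambda>t. G (t, Y t)) has_real_derivative G (t, Y t) * (2 * kappa t * real D)) (at t)"
      using transversal_coefficient_deriv[OF C sym _ t, of 0] by (simp add: G0)
    have dr: "((\<lambda>t. rho t ^ D) has_real_derivative 2 * real D * kappa t * rho t ^ D) (at t)"
      by (rule DERIV_cong[OF DERIV_power[OF rho_deriv[OF t]]]) (cases D; simp)
    have "((\<lambda>t. G (t, Y t) / rho t ^ D) has_real_derivative 0) (at t)"
      by (rule DERIV_cong[OF DERIV_divide[OF dG dr]]) (use rho_pos[OF t(1)] in \<open>simp_all add: algebra_simps\<close>)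
    then show ?thesis by (rule has_field_derivative_at_within)
  qed
  then obtain c where "\<And>t. t \<in> {0<..<1} \<Longrightarrow> G (t, Y t) / rho t ^ D = c"
    using has_field_derivative_zero_constant[of "{0<..<1::real}" "\<lambda>t. G (t, Y t) / rho t ^ D"]
    by (meson convex_real_interval(8))
  then have c: "G (t, Y t) = c * rho t ^ D" if "0 < t" "t < 1" for t
    using that rho_pos[of t] by (force simp: field_simps)
  define G1 where "G1 = (\<lambda>q. G q - c * (q \<bullet> q) ^ D)"
  have "real_polynomial_function (\<lambda>q::plane. q \<bullet> q)"
    unfolding inner_prod_def inner_real_def
    by (intro real_polynomial_function.intros(3,4) real_polynomial_function.intros(1) bounded_linear_fst bounded_linear_snd)
  then have G1: "real_polynomial_function G1" unfolding G1_def
    by (intro real_polynomial_function_diff G real_polynomial_function.intros(4) real_polynomial_function_power real_polynomial_function.intros(2))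
  have sym1: "reflection_symmetric D G1"
    using sym reflection_symmetric_norm_power[of D c]
    unfolding reflection_symmetric_def G1_def right_diff_distrib by metis
  obtain K' C' where C': "\<And>p u. G1 (p + u *\<^sub>R (0, 1)) = poly (C' p) u" "\<And>p. degree (C' p) \<le> K'"
      "\<And>j. real_polynomial_function (\<lambda>p. coeff (C' p) j)"
    using real_polynomial_function_on_line[OF G1, of "(0, 1)"] by metis
  have zero: "\<forall>t. 0 < t \<longrightarrow> t < 1 \<longrightarrow> coeff (C' (t, Y t)) k = 0" for k
  proof (induction k rule: less_induct)
    case (less k)
    show ?case
    proof (cases "k = 0")
      case True
      have "coeff (C' p) 0 = G1 p" for p using C'(1)[of p 0] by (simp add: poly_0_coeff_0 flip: zero_prod_def)
      then show ?thesis using True c by (simp add: G1_def rho_def power2_eq_square)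
    next
      case False
      then show ?thesis using transversal_coefficient_zero[OF C' sym1 _ _ lim] less by blast
    qed
  qed
  have strip: "G1 (t, y) = 0" if "0 < t" "t < 1" for t y
  proof -
    have "C' (t, Y t) = 0" using zero that by (intro poly_eqI) simp
    then show ?thesis using C'(1)[of "(t, Y t)" "y - Y t"] by simp
  qed
  have "G1 (t, y) = 0" for t y
  proof -
    obtain B where B: "\<And>p u. G1 (p + u *\<^sub>R (1, 0)) = poly (B p) u"
      using real_polynomial_function_on_line[OF G1, of "(1, 0)"] by metis
    have e: "G1 (t, y) = poly (B (0, y)) t" for t using B[of "(0, y)" t] by simp
    have "infinite {0<..<1::real}" by simp
    moreover have "{0<..<1} \<subseteq> {t. poly (B (0, y)) t = 0}" using strip[of _ y] unfolding e by auto
    ultimately have "B (0, y) = 0" using poly_roots_finite finite_subset by blast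
    then show ?thesis using e by simp
  qed
  then have "G q = c * (q \<bullet> q) ^ D" for q by (cases q) (simp add: G1_def)
  then show ?thesis by blast
qed

end


section \<open>Even integrals of the billiard\<close>

text \<open>The upper right quarter of the Fermat oval as a graph, with its derivatives. The second one
  is brought to a form that shows that it vanishes only over \<open>x = 0\<close>.\<close>

definition oval_arc :: "nat \<Rightarrow> real \<Rightarrow> real" where
  "oval_arc n x = (1 - x ^ (2 * n)) powr (1 / (2 * n))"
definition oval_arc1 :: "nat \<Rightarrow> real \<Rightarrow> real" where
  "oval_arc1 n x = - (x ^ (2 * n - 1)) * (1 - x ^ (2 * n)) powr (1 / (2 * n) - 1)"
definition oval_arc2 :: "nat \<Rightarrow> real \<Rightarrow> real" where
  "oval_arc2 n x = - (2 * real n - 1) * (x ^ (2 * n - 2) * (1 - x ^ (2 * n)) powr (1 / (2 * n) - 2))"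
definition oval_arc3 :: "nat \<Rightarrow> real \<Rightarrow> real" where
  "oval_arc3 n x = - (2 * real n - 1) *
     ((2 * real n - 2) * x ^ (2 * n - 3) * (1 - x ^ (2 * n)) powr (1 / (2 * n) - 2)
      + x ^ (2 * n - 2) * ((1 / (2 * n) - 2) * (1 - x ^ (2 * n)) powr (1 / (2 * n) - 3) * (- (2 * real n * x ^ (2 * n - 1)))))"

lemma oval_arc_base_pos: "n > 1 \<Longrightarrow> 0 < x \<Longrightarrow> x < 1 \<Longrightarrow> 1 - x ^ (2 * n) > (0::real)"
  by (simp add: power_less_one_iff)

lemma oval_arc_power:
  assumes "n > 1" "0 < x" "x < 1"
  shows "oval_arc n x ^ (2 * n) = 1 - x ^ (2 * n)" "oval_arc n x > 0"
proof -
  note h = oval_arc_base_pos[OF assms]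
  show "oval_arc n x > 0" using h by (simp add: oval_arc_def powr_def)
  have "oval_arc n x ^ (2 * n) = (1 - x ^ (2 * n)) powr (1 / (2 * n) * (2 * n))"
    unfolding oval_arc_def by (subst powr_powr[symmetric]) (use h in \<open>simp add: powr_realpow[symmetric] powr_def[of _ "_ / _"]\<close>)
  then show "oval_arc n x ^ (2 * n) = 1 - x ^ (2 * n)" using h assms by simp
qed

lemma oval_arc_smooth: 
  assumes n: "n > 1"
  shows "smooth_arc (oval_arc n) (oval_arc1 n) (oval_arc2 n) (oval_arc3 n)"
proof
  fix x :: real assume x: "0 < x" "x < 1"
  note h = oval_arc_base_pos[OF n x]
  define a where "a = 1 / (2 * real n)"
  have a: "a * (2 * real n) = 1" using n by (simp add: a_def)
  have e: "oval_arc n = (\<lambda>x. (1 - x ^ (2 * n)) powr a)"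
    "oval_arc1 n = (\<lambda>x. - (x ^ (2 * n - 1)) * (1 - x ^ (2 * n)) powr (a - 1))"
    "oval_arc2 n = (\<lambda>x. - (2 * real n - 1) * (x ^ (2 * n - 2) * (1 - x ^ (2 * n)) powr (a - 2)))"
    "oval_arc3 n = (\<lambda>x. - (2 * real n - 1) *
     ((2 * real n - 2) * x ^ (2 * n - 3) * (1 - x ^ (2 * n)) powr (a - 2)
      + x ^ (2 * n - 2) * ((a - 2) * (1 - x ^ (2 * n)) powr (a - 3) * (- (2 * real n * x ^ (2 * n - 1))))))"
    unfolding a_def by (auto simp: oval_arc_def oval_arc1_def oval_arc2_def oval_arc3_def)
  have dh: "((\<lambda>x. 1 - x ^ (2 * n)) has_real_derivative - (2 * real n * x ^ (2 * n - 1))) (at x)"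
    by (rule derivative_eq_intros refl)+ simp
  have dp: "((\<lambda>x. (1 - x ^ (2 * n)) powr r) has_real_derivative
      r * (1 - x ^ (2 * n)) powr (r - 1) * - (2 * real n * x ^ (2 * n - 1))) (at x)" for r
    using DERIV_fun_powr[OF dh h, of r] by simp
  have dx: "((\<lambda>x::real. x ^ i) has_real_derivative real i * x ^ (i - 1)) (at x)" for i
    using DERIV_pow[of i x UNIV] by simp
  have "a * (1 - x ^ (2 * n)) powr (a - 1) * - (2 * real n * x ^ (2 * n - 1))
    = - (a * (2 * real n)) * x ^ (2 * n - 1) * (1 - x ^ (2 * n)) powr (a - 1)" by simp
  also have "\<dots> = oval_arc1 n x" by (simp only: a e)
  finally have e1: "a * (1 - x ^ (2 * n)) powr (a - 1) * - (2 * real n * x ^ (2 * n - 1)) = oval_arc1 n x" .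
  then show "(oval_arc n has_real_derivative oval_arc1 n x) (at x)"
    using dp[of a] unfolding e(1) by simp
  have p: "(1 - x ^ (2 * n)) powr (a - 1) = (1 - x ^ (2 * n)) * (1 - x ^ (2 * n)) powr (a - 2)"
    using powr_add[of "1 - x ^ (2 * n)" 1 "a - 2"] h by simp
  have q: "x ^ (2 * n - 1) = x * x ^ (2 * n - 2)" "x ^ (2 * n) = x * (x * x ^ (2 * n - 2))"
    using n by (cases n; simp)+
  have "(oval_arc1 n has_real_derivative
    - (real (2 * n - 1) * x ^ (2 * n - 1 - 1)) * (1 - x ^ (2 * n)) powr (a - 1)
    + (a - 1) * (1 - x ^ (2 * n)) powr (a - 1 - 1) * - (2 * real n * x ^ (2 * n - 1)) * - (x ^ (2 * n - 1))) (at x)"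
    unfolding e(2) by (rule DERIV_mult[OF DERIV_minus[OF dx] dp])
  also have "- (real (2 * n - 1) * x ^ (2 * n - 1 - 1)) * (1 - x ^ (2 * n)) powr (a - 1)
    + (a - 1) * (1 - x ^ (2 * n)) powr (a - 1 - 1) * - (2 * real n * x ^ (2 * n - 1)) * - (x ^ (2 * n - 1))
    = oval_arc2 n x"
  proof -
    define H where "H = (1 - x ^ (2 * n)) powr (a - 2)"
    define X where "X = x ^ (2 * n - 2)"
    have pw: "2 * n - 1 - 1 = 2 * n - 2" "a - 1 - 1 = a - 2" "real (2 * n - 1) = 2 * real n - 1"
      using n by (simp_all add: of_nat_diff)
    have 1: "(a - 1) * (2 * real n) = - (2 * real n - 1)" using a by (simp add: algebra_simps)
    have "- (real (2 * n - 1) * x ^ (2 * n - 1 - 1)) * (1 - x ^ (2 * n)) powr (a - 1)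
    + (a - 1) * (1 - x ^ (2 * n)) powr (a - 1 - 1) * - (2 * real n * x ^ (2 * n - 1)) * - (x ^ (2 * n - 1))
     = - ((2 * real n - 1) * X) * ((1 - x * (x * X)) * H) + (a - 1) * H * - (2 * real n * (x * X)) * - (x * X)"
      unfolding pw p H_def[symmetric] unfolding q X_def[symmetric] by (rule refl)
    also have "\<dots> = - ((2 * real n - 1) * X) * ((1 - x * (x * X)) * H) + ((a - 1) * (2 * real n)) * (x * (x * X)) * X * H"
      by (simp add: algebra_simps)
    also have "\<dots> = - (2 * real n - 1) * (X * H)" unfolding 1 by (simp add: algebra_simps)
    finally show ?thesis unfolding e X_def H_def .
  qed
  finally show "(oval_arc1 n has_real_derivative oval_arc2 n x) (at x)" .
  have "((\<lambda>x. x ^ (2 * n - 2) * (1 - x ^ (2 * n)) powr (a - 2)) has_real_derivative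
    real (2 * n - 2) * x ^ (2 * n - 2 - 1) * (1 - x ^ (2 * n)) powr (a - 2)
    + (a - 2) * (1 - x ^ (2 * n)) powr (a - 2 - 1) * - (2 * real n * x ^ (2 * n - 1)) * x ^ (2 * n - 2)) (at x)"
    by (rule DERIV_mult[OF dx dp])
  from DERIV_cmult[OF this, of "- (2 * real n - 1)"]
  show "(oval_arc2 n has_real_derivative oval_arc3 n x) (at x)"
    unfolding e by (rule DERIV_cong) (use n in \<open>simp add: of_nat_diff numeral_3_eq_3 algebra_simps\<close>)
  show "isCont (oval_arc3 n) x" unfolding e(4)
    by (intro continuous_intros) (use h in auto)
  show "oval_arc2 n x \<noteq> 0" using x h n by (simp add: oval_arc2_def)
qed

lemma oval_arc_limits:
  assumes n: "n > 1"
  shows "(oval_arc n \<longlongrightarrow> 1) (at_right 0)" "(oval_arc2 n \<longlongrightarrow> 0) (at_right 0)"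
proof -
  have h: "((\<lambda>x::real. 1 - x ^ (2 * n)) \<longlongrightarrow> 1 - 0 ^ (2 * n)) (at_right 0)" by (intro tendsto_intros)
  then have h: "((\<lambda>x::real. 1 - x ^ (2 * n)) \<longlongrightarrow> 1) (at_right 0)" using n by (simp add: power_0_left)
  have p: "((\<lambda>x::real. (1 - x ^ (2 * n)) powr r) \<longlongrightarrow> 1 powr r) (at_right 0)" for r
    by (intro tendsto_powr h tendsto_const) simp
  show "(oval_arc n \<longlongrightarrow> 1) (at_right 0)" unfolding oval_arc_def using p by simp
  have "(oval_arc2 n \<longlongrightarrow> - (2 * real n - 1) * (0 ^ (2 * n - 2) * 1 powr (1 / (2 * real n) - 2))) (at_right 0)"
    unfolding oval_arc2_def by (intro tendsto_mult tendsto_const p tendsto_power tendsto_ident_at)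
  then show "(oval_arc2 n \<longlongrightarrow> 0) (at_right 0)" using n by (simp add: power_0_left)
qed

lemma oroot_abs_less_1: "n > 1 \<Longrightarrow> \<bar>x\<bar> < 1 \<Longrightarrow> oroot n x ^ (2 * n) < 1"
proof -
  assume n: "n > 1" and x: "\<bar>x\<bar> < 1"
  have "\<bar>x\<bar> powr (2 * real n / (2 * real n - 1)) < 1 powr (2 * real n / (2 * real n - 1))"
    by (rule powr_less_mono2) (use n x in auto)
  then show ?thesis using powr_eq_oroot[OF n, of x] by simp
qed

definition perp :: "plane \<Rightarrow> plane" where "perp r = (- snd r, fst r)"

lemma perp_simps [simp]: "perp (r + s) = perp r + perp s" "perp (t *\<^sub>R r) = t *\<^sub>R perp r"
  "norm (perp r) = norm r" "r \<bullet> perp r = 0" "perp r \<bullet> r = 0" "perp (perp r) = - r"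
  by (simp_all add: perp_def prod_eq_iff norm_prod_def inner_prod_def add.commute)

definition unit_normal :: "nat \<Rightarrow> plane \<Rightarrow> plane" where
  "unit_normal n P = (1 / norm (dual_vec n P)) *\<^sub>R dual_vec n P"

text \<open>What remains of an integral of the billiard after symmetrising in \<open>v\<close>. The assumption
  \<open>polynomial\<close> says that the extension of \<open>\<Psi> q\<close> from the unit circle to a function homogeneous of
  degree \<open>2D\<close> is a polynomial of degree at most \<open>2D\<close> on each line; this form passes easily to sums
  and products. The last two assumptions are the invariance during free motion and under one
  collision.\<close>

locale even_billiard_integral =
  fixes n D :: nat and \<Psi> :: "plane \<Rightarrow> plane \<Rightarrow> real"
  assumes n: "n > 1"
    and even: "\<And>q v. \<Psi> q (- v) = \<Psi> q v"
    and polynomial: "\<And>q z0 z1. dual_gauge n q < 1 \<Longrightarrow> \<exists>p. degree p \<le> 2 * D \<and>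
       (\<forall>t. z0 + t *\<^sub>R z1 \<noteq> 0 \<longrightarrow> norm (z0 + t *\<^sub>R z1) ^ (2 * D) *
          \<Psi> q ((1 / norm (z0 + t *\<^sub>R z1)) *\<^sub>R (z0 + t *\<^sub>R z1)) = poly p t)"
    and glide: "\<And>q v u. norm v = 1 \<Longrightarrow> dual_gauge n q < 1 \<Longrightarrow> dual_gauge n (q + u *\<^sub>R v) < 1 \<Longrightarrow>
       \<Psi> (q + u *\<^sub>R v) v = \<Psi> q v"
    and bounce: "\<And>P v a b. dual_gauge n P = 1 \<Longrightarrow> norm v = 1 \<Longrightarrow> a > 0 \<Longrightarrow> b > 0 \<Longrightarrow>
       dual_gauge n (P - a *\<^sub>R v) < 1 \<Longrightarrow> dual_gauge n (P + b *\<^sub>R reflection (unit_normal n P) v) < 1 \<Longrightarrow>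
       \<Psi> (P + b *\<^sub>R reflection (unit_normal n P) v) (reflection (unit_normal n P) v) = \<Psi> (P - a *\<^sub>R v) v"
begin

text \<open>The points dual to the lines that meet the table, except for those through the origin.\<close>

definition exterior :: "plane \<Rightarrow> bool" where
  "exterior r \<longleftrightarrow> (\<exists>q. dual_gauge n q < 1 \<and> r \<bullet> q = 1)"

text \<open>The value of the homogeneous extension of \<open>\<Psi>\<close> at the line dual to \<open>r\<close>. The vector \<open>perp r\<close>
  is a direction of this line, of either orientation since \<open>\<Psi>\<close> is even.\<close>

definition line_value :: "plane \<Rightarrow> real" where
  "line_value r = norm r ^ (2 * D) *
     \<Psi> (SOME q. dual_gauge n q < 1 \<and> r \<bullet> q = 1) ((1 / norm r) *\<^sub>R perp r)"

text \<open>Free motion along the line makes the choice of \<open>q\<close> immaterial, and evenness the choice of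
  the orientation.\<close>

lemma line_value_eq:
  assumes q: "dual_gauge n q < 1" "r \<bullet> q = 1" and v: "norm v = 1" "r \<bullet> v = 0"
  shows "line_value r = norm r ^ (2 * D) * \<Psi> q v"
proof -
  define q' where "q' = (SOME q. dual_gauge n q < 1 \<and> r \<bullet> q = 1)"
  have q': "dual_gauge n q' < 1 \<and> r \<bullet> q' = 1" unfolding q'_def by (rule someI[of _ q]) (use q in auto)
  have r: "norm r > 0" using q(2) by auto
  define e where "e = (1 / norm r) *\<^sub>R perp r"
  have e: "norm e = 1" "((1 / norm r) *\<^sub>R r) \<bullet> e = 0" "norm ((1 / norm r) *\<^sub>R r) = 1"
    using r by (simp_all add: e_def)
  note * = orthogonal_unit_plane[OF e(2,3,1)]
  have "((1 / norm r) *\<^sub>R r) \<bullet> (q' - q) = 0" using q q' by (simp add: inner_diff_right)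
  with * have "q' - q = ((q' - q) \<bullet> e) *\<^sub>R e" by blast
  then have qe: "q' = q + ((q' - q) \<bullet> e) *\<^sub>R e" by (simp add: algebra_simps)
  have "\<Psi> q' e = \<Psi> q e" using glide[OF e(1) q(1), of "(q' - q) \<bullet> e"] q' unfolding qe[symmetric] by simp
  moreover have "\<Psi> q v = \<Psi> q e"
  proof -
    have "((1 / norm r) *\<^sub>R r) \<bullet> v = 0" using v by simp
    with * have ve: "v = (v \<bullet> e) *\<^sub>R e" by blast
    then have "\<bar>v \<bullet> e\<bar> = 1" using v(1) e(1) by (metis abs_mult mult.right_neutral norm_scaleR)
    then have "v = e \<or> v = - e" using ve by (metis abs_1 abs_eq_iff scaleR_minus1_left scaleR_one)
    then show ?thesis by (elim disjE) (simp_all only: even)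
  qed
  ultimately show ?thesis by (simp add: line_value_def q'_def e_def)
qed

text \<open>The lines through \<open>q\<close> are dual to the points of a line, along which their directions are
  affine in the parameter.\<close>

lemma line_value_on_line:
  assumes q: "dual_gauge n q < 1" "r \<bullet> q = 1" "w \<bullet> q = 0"
  shows "\<exists>p. degree p \<le> 2 * D \<and> (\<forall>t. line_value (r + t *\<^sub>R w) = poly p t)"
proof -
  obtain p where p: "degree p \<le> 2 * D" "\<And>t. perp r + t *\<^sub>R perp w \<noteq> 0 \<Longrightarrow> norm (perp r + t *\<^sub>R perp w) ^ (2 * D) *
          \<Psi> q ((1 / norm (perp r + t *\<^sub>R perp w)) *\<^sub>R (perp r + t *\<^sub>R perp w)) = poly p t"
    using polynomial[OF q(1), of "perp r" "perp w"] by blast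
  have "line_value (r + t *\<^sub>R w) = poly p t" for t
  proof -
    let ?r = "r + t *\<^sub>R w"
    have r: "?r \<bullet> q = 1" using q by (simp add: inner_add_left)
    then have nz: "norm ?r > 0" by auto
    have pe: "perp r + t *\<^sub>R perp w = perp ?r" by simp
    have "perp ?r \<noteq> 0" using nz by (metis norm_eq_zero less_irrefl perp_simps(3))
    then have "norm ?r ^ (2 * D) * \<Psi> q ((1 / norm ?r) *\<^sub>R perp ?r) = poly p t"
      using p(2)[of t] unfolding pe perp_simps(3) by blast
    moreover have "line_value ?r = norm ?r ^ (2 * D) * \<Psi> q ((1 / norm ?r) *\<^sub>R perp ?r)"
    proof (rule line_value_eq[OF q(1) r])
      show "norm ((1 / norm ?r) *\<^sub>R perp ?r) = 1" using nz by (simp del: perp_simps(1,2))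
      show "?r \<bullet> (1 / norm ?r) *\<^sub>R perp ?r = 0" by (simp del: perp_simps(1,2))
    qed
    ultimately show ?thesis by simp
  qed
  with p(1) show ?thesis by blast
qed

text \<open>For a point \<open>(0, 1 / y)\<close> or \<open>(1 / x, 0)\<close> of the table the dual line is horizontal or
  vertical. So \<open>line_value\<close> is separately polynomial beyond the lines \<open>x = 1\<close> and \<open>y = 1\<close>, hence a
  polynomial on the half-plane \<open>y > 1\<close>. Any other point of the exterior lies on a line that
  reaches the half-plane and on which \<open>line_value\<close> is a polynomial.\<close>

lemma line_value_polynomial:
  "\<exists>G. real_polynomial_function G \<and> (\<forall>r. exterior r \<longrightarrow> line_value r = G r)"
proof -
  have rows: "\<exists>p. degree p \<le> 2 * D \<and> (\<forall>x. line_value (x, y) = poly p x)" if "y > 1" for y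
    using line_value_on_line[of "(0, 1 / y)" "(0, y)" "(1, 0)"] that n oroot_abs_less_1[OF n, of "1 / y"]
    by (simp add: dual_gauge_def oroot_simps inner_prod_def power_0_left)
  have cols: "\<exists>p. \<forall>y. line_value (x, y) = poly p y" if "x > 1" for x
    using line_value_on_line[of "(1 / x, 0)" "(x, 0)" "(0, 1)"] that n oroot_abs_less_1[OF n, of "1 / x"]
    by (auto simp: dual_gauge_def oroot_simps inner_prod_def power_0_left)
  obtain G where G: "real_polynomial_function G" "\<And>x y. y > 1 \<Longrightarrow> line_value (x, y) = G (x, y)"
    using separately_polynomial[of 1 "2 * D" "\<lambda>x y. line_value (x, y)", OF rows cols] by blast
  have "line_value r = G r" if ext: "exterior r" for r
  proof -
    obtain q where q: "dual_gauge n q < 1" "r \<bullet> q = 1" using ext unfolding exterior_def by blast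
    have r: "norm r > 0" using q(2) by auto
    \<comment> \<open>If \<open>q\<close> is on the axis, move it along the line dual to \<open>r\<close>.\<close>
    have "\<exists>q'. dual_gauge n q' < 1 \<and> r \<bullet> q' = 1 \<and> fst q' \<noteq> 0"
    proof (cases "fst q = 0")
      case True
      have "open {P. dual_gauge n P < 1}"
        by (intro open_Collect_less continuous_intros continuous_gauge n)
      then obtain \<epsilon> where e: "\<epsilon> > 0" "ball q \<epsilon> \<subseteq> {P. dual_gauge n P < 1}"
        using q(1) open_contains_ball by blast
      define s where "s = \<epsilon> / (2 * norm r)"
      have s: "s > 0" using e r by (simp add: s_def)
      have "dist q (q + s *\<^sub>R perp r) < \<epsilon>" using e r by (simp add: dist_norm s_def)
      then have "dual_gauge n (q + s *\<^sub>R perp r) < 1" using e by auto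
      moreover have "r \<bullet> (q + s *\<^sub>R perp r) = 1" using q by (simp add: inner_add_right)
      moreover have "snd r \<noteq> 0" using q(2) True by (auto simp: inner_prod_def)
      then have "fst (q + s *\<^sub>R perp r) \<noteq> 0" using True s by (simp add: perp_def)
      ultimately show ?thesis by blast
    qed (use q in blast)
    then obtain q' where q': "dual_gauge n q' < 1" "r \<bullet> q' = 1" "fst q' \<noteq> 0" by blast
    \<comment> \<open>The line dual to \<open>q'\<close> through \<open>r\<close> has direction \<open>w\<close>. It is not horizontal, so it reaches
      the half-plane \<open>y > 1\<close>.\<close>
    define w :: plane where "w = (- (snd q' / fst q'), 1)"
    have "w \<bullet> q' = 0" using q'(3) by (simp add: w_def inner_prod_def)
    then obtain p where p: "\<And>t. line_value (r + t *\<^sub>R w) = poly p t"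
      using line_value_on_line[OF q'(1,2)] by blast
    obtain C where C: "\<And>p u. G (p + u *\<^sub>R w) = poly (C p) u"
      using real_polynomial_function_on_line[OF G(1), of w] by metis
    have "{t. t > 1 - snd r} \<subseteq> {t. poly (p - C r) t = 0}"
    proof
      fix t assume "t \<in> {t. t > 1 - snd r}"
      then have "snd (r + t *\<^sub>R w) > 1" by (simp add: w_def)
      then have "line_value (r + t *\<^sub>R w) = G (r + t *\<^sub>R w)" using G(2) by (metis prod.collapse)
      then show "t \<in> {t. poly (p - C r) t = 0}" using p C by simp
    qed
    moreover have "infinite {t. t > 1 - snd r}" using infinite_Ioi[of "1 - snd r"] by (simp add: greaterThan_def)
    ultimately have "p - C r = 0" using poly_roots_finite finite_subset by blast
    then have "line_value (r + 0 *\<^sub>R w) = G (r + 0 *\<^sub>R w)" unfolding p C by simp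
    then show ?thesis by simp
  qed
  with G(1) show ?thesis by blast
qed

text \<open>The lines through the boundary point \<open>P\<close> are dual to the points of the tangent line of the
  oval at \<open>d\<close>. The trajectory that arrives along the line dual to \<open>r = d + s w\<close> leaves along the
  line dual to \<open>r' = d - (s / l) w\<close>, because \<open>r'\<close> is orthogonal to the reflected velocity; the
  factor \<open>l\<^bsup>2D\<^esup>\<close> compares the degree of homogeneity at the two points, where \<open>\<bar>r\<bar> = l \<bar>r'\<bar>\<close>.\<close>

lemma line_value_reflect:
  fixes P w :: plane and s :: real
  assumes P: "dual_gauge n P = 1" and w: "w \<bullet> P = 0" "w \<noteq> 0" and s: "s \<noteq> 0"
  defines "d \<equiv> dual_vec n P"
  defines "l \<equiv> 1 + 2 * ((w \<bullet> d) / (d \<bullet> d)) * s"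
  assumes l: "l > 0"
  shows "exterior (d + s *\<^sub>R w)" "exterior (d + (- s / l) *\<^sub>R w)"
    "line_value (d + s *\<^sub>R w) = l ^ (2 * D) * line_value (d + (- s / l) *\<^sub>R w)"
proof -
  define r where "r = d + s *\<^sub>R w"
  define r' where "r' = d + (- s / l) *\<^sub>R w"
  define N where "N = unit_normal n P"
  have dP: "d \<bullet> P = 1" using dual_vec_inner[OF n, of P] P by (simp add: d_def)
  then have d: "d \<bullet> d > 0" "norm d > 0" by auto
  have rP: "r \<bullet> P = 1" "r' \<bullet> P = 1" using dP w by (simp_all add: r_def r'_def inner_add_left inner_diff_left)
  then have nr: "norm r > 0" by auto
  define e where "e = (1 / norm r) *\<^sub>R perp r"
  have e1: "norm e = 1" using nr by (simp add: e_def)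
  have re: "r \<bullet> e = 0" by (simp add: e_def)
  have "perp w \<bullet> d \<noteq> 0"
  proof
    assume 0: "perp w \<bullet> d = 0"
    obtain w1 w2 d1 d2 p1 p2 where c: "w = (w1, w2)" "d = (d1, d2)" "P = (p1, p2)" by (metis prod.exhaust)
    have "w1 * d2 = w2 * d1" "w1 * p1 + w2 * p2 = 0" "d1 * p1 + d2 * p2 = 1"
      using 0 w(1) dP unfolding c by (simp_all add: perp_def inner_prod_def)
    then have "w1 = 0" "w2 = 0" by algebra+
    then show False using w(2) by (simp add: c zero_prod_def)
  qed
  then have ed: "e \<bullet> d \<noteq> 0" using s nr by (simp add: e_def r_def inner_add_left)
  \<comment> \<open>The direction of the line for which the particle runs towards the boundary.\<close>
  define v where "v = (if e \<bullet> d > 0 then e else - e)"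
  have v: "norm v = 1" "r \<bullet> v = 0" "d \<bullet> v > 0"
    using e1 re ed by (auto simp: v_def inner_commute)
  define v' where "v' = reflection N v"
  have N: "norm N = 1" "N \<bullet> N = 1" using d by (simp_all add: N_def unit_normal_def d_def[symmetric] flip: power2_norm_eq_inner)
  have vN: "(2 * (v \<bullet> N)) *\<^sub>R N = (2 * (d \<bullet> v) / (d \<bullet> d)) *\<^sub>R d"
    using d by (simp add: N_def unit_normal_def d_def[symmetric] inner_commute power2_norm_eq_inner[symmetric] power2_eq_square)
  have v'_eq: "v' = v - (2 * (d \<bullet> v) / (d \<bullet> d)) *\<^sub>R d"
    unfolding v'_def reflection_def vN ..
  have "v' \<bullet> v' = v \<bullet> v" using N(2)
    by (simp add: v'_def reflection_def inner_diff_left inner_diff_right inner_commute algebra_simps)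
  then have v'1: "norm v' = 1" using v(1) by (simp add: norm_eq_sqrt_inner)
  have v'd: "d \<bullet> v' = - (d \<bullet> v)" using d by (simp add: v'_eq inner_diff_right)
  obtain a where a: "a > 0" "dual_gauge n (P - a *\<^sub>R v) < 1"
  proof -
    have "dual_vec n P \<bullet> (- v) < 0" using v by (simp add: d_def[symmetric])
    from gauge_inward[OF n P this] obtain \<epsilon> where "\<epsilon> > 0" "\<forall>s\<in>{0<..<\<epsilon>}. dual_gauge n (P + s *\<^sub>R - v) < 1" by blast
    then show thesis using that[of "\<epsilon> / 2"] by simp
  qed
  obtain b where b: "b > 0" "dual_gauge n (P + b *\<^sub>R v') < 1"
  proof -
    have "dual_vec n P \<bullet> v' < 0" using v v'd by (simp add: d_def[symmetric])
    from gauge_inward[OF n P this] obtain \<epsilon> where "\<epsilon> > 0" "\<forall>s\<in>{0<..<\<epsilon>}. dual_gauge n (P + s *\<^sub>R v') < 1" by blast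
    then show thesis using that[of "\<epsilon> / 2"] by simp
  qed
  define k where "k = (w \<bullet> d) / (d \<bullet> d)"
  have wd: "d \<bullet> w = k * (d \<bullet> d)" using d by (simp add: k_def inner_commute)
  have lk: "l = 1 + 2 * k * s" by (simp add: l_def k_def)
  have sw: "s * (w \<bullet> v) = - (d \<bullet> v)" using v(2) by (simp add: r_def inner_add_left)
  have r'v: "l * (r' \<bullet> v) = (l + 1) * (d \<bullet> v)"
  proof -
    have "l * (r' \<bullet> v) = l * (d \<bullet> v) - s * (w \<bullet> v)" using l by (simp add: r'_def inner_diff_left right_diff_distrib)
    then show ?thesis unfolding sw by (simp add: algebra_simps)
  qed
  have r'd: "l * (r' \<bullet> d) = (l - s * k) * (d \<bullet> d)"
    using l wd by (simp add: r'_def inner_diff_left right_diff_distrib inner_commute algebra_simps)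
  have "(l * (r' \<bullet> v')) * (d \<bullet> d) = (l * (r' \<bullet> v)) * (d \<bullet> d) - 2 * (d \<bullet> v) * (l * (r' \<bullet> d))"
    using d by (simp add: v'_eq inner_diff_right field_simps)
  also have "\<dots> = 0" unfolding r'v r'd by (simp add: lk algebra_simps)
  finally have r'v': "r' \<bullet> v' = 0" using l d by simp
  have "r \<bullet> r = d \<bullet> d + 2 * s * (d \<bullet> w) + s * s * (w \<bullet> w)"
    by (simp add: r_def inner_add_left inner_add_right inner_commute algebra_simps)
  also have "\<dots> = (l *\<^sub>R d - s *\<^sub>R w) \<bullet> (l *\<^sub>R d - s *\<^sub>R w)"
    by (simp add: inner_diff_left inner_diff_right inner_commute[of w d] wd lk algebra_simps)
  also have "l *\<^sub>R d - s *\<^sub>R w = l *\<^sub>R r'" using l by (simp add: r'_def scaleR_diff_right)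
  finally have "norm r = l * norm r'" using l by (simp add: norm_eq_sqrt_inner real_sqrt_mult)
  then have nrr: "norm r ^ (2 * D) = l ^ (2 * D) * norm r' ^ (2 * D)" by (simp add: power_mult_distrib)
  have q: "r \<bullet> (P - a *\<^sub>R v) = 1" using rP v by (simp add: inner_diff_right)
  have q': "r' \<bullet> (P + b *\<^sub>R v') = 1" using rP r'v' by (simp add: inner_add_right)
  show "exterior (d + s *\<^sub>R w)" unfolding r_def[symmetric] exterior_def using a q by blast
  show "exterior (d + (- s / l) *\<^sub>R w)" unfolding r'_def[symmetric] exterior_def using b q' by blast
  have "\<Psi> (P + b *\<^sub>R v') v' = \<Psi> (P - a *\<^sub>R v) v"
    using bounce[OF P v(1) a(1) b(1) a(2)] b(2) by (simp add: v'_def N_def)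
  then show "line_value (d + s *\<^sub>R w) = l ^ (2 * D) * line_value (d + (- s / l) *\<^sub>R w)"
    unfolding r_def[symmetric] r'_def[symmetric]
    using line_value_eq[OF a(2) q v(1,2)] line_value_eq[OF b(2) q' v'1 r'v'] nrr by simp
qed

lemma exterior_line_value_radial:
  "\<exists>c. \<forall>r. exterior r \<longrightarrow> line_value r = c * norm r ^ (2 * D)"
proof -
  interpret arc: smooth_arc "oval_arc n" "oval_arc1 n" "oval_arc2 n" "oval_arc3 n" by (rule oval_arc_smooth[OF n])
  obtain G where G: "real_polynomial_function G" "\<And>r. exterior r \<Longrightarrow> line_value r = G r"
    using line_value_polynomial by blast
  have "arc.reflection_symmetric D G" unfolding arc.reflection_symmetric_def
  proof (intro allI impI)
    fix x s assume x: "0 < x" "x < 1" and l: "0 < 1 + 2 * arc.kappa x * s"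
    let ?q = "(x, oval_arc n x)" and ?w = "(1::real, oval_arc1 n x)"
    let ?P = "pow_map n ?q"
    have q: "?q \<in> fermat_oval n" using oval_arc_power[OF n x] by (simp add: fermat_oval_def)
    have P: "dual_gauge n ?P = 1" using q fermat_oval_iff_gauge[OF n] by blast
    have dP: "dual_vec n ?P = ?q" by (rule dual_vec_pow_map[OF n])
    have d1: "((\<lambda>t. t ^ (2 * n) + oval_arc n t ^ (2 * n)) has_real_derivative
       real (2 * n) * x ^ (2 * n - 1) + real (2 * n) * (oval_arc n x ^ (2 * n - 1) * oval_arc1 n x)) (at x)"
      by (rule DERIV_cong[OF DERIV_add[OF DERIV_power[OF DERIV_ident] DERIV_power[OF arc.arc_deriv[OF x]]]]) simp
    have "eventually (\<lambda>t. t \<in> {0<..<1}) (nhds x)"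
      by (rule eventually_nhds_in_open) (use x in auto)
    then have ev: "eventually (\<lambda>t. t ^ (2 * n) + oval_arc n t ^ (2 * n) = 1) (nhds x)"
      by eventually_elim (simp add: oval_arc_power(1)[OF n])
    have d2: "((\<lambda>t. t ^ (2 * n) + oval_arc n t ^ (2 * n)) has_real_derivative 0) (at x)"
      by (rule DERIV_cong_ev[OF refl ev refl, THEN iffD2]) (rule DERIV_const)
    from DERIV_unique[OF d1 d2]
    have "real (2 * n) * (x ^ (2 * n - 1) + oval_arc n x ^ (2 * n - 1) * oval_arc1 n x) = 0"
      by (simp only: distrib_left)
    then have wP: "?w \<bullet> ?P = 0" using n by (simp add: pow_map_def opow_def inner_prod_def mult.commute)
    have kp: "(?w \<bullet> ?q) / (?q \<bullet> ?q) = arc.kappa x"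
      by (simp add: arc.kappa_def arc.rho_def inner_prod_def power2_eq_square mult.commute)
    show "G (x + s, oval_arc n x + s * oval_arc1 n x) = (1 + 2 * arc.kappa x * s) ^ (2 * D) *
       G (x + (- s / (1 + 2 * arc.kappa x * s)), oval_arc n x + (- s / (1 + 2 * arc.kappa x * s)) * oval_arc1 n x)"
    proof (cases "s = 0")
      case False
      have l': "0 < 1 + 2 * ((?w \<bullet> dual_vec n ?P) / (dual_vec n ?P \<bullet> dual_vec n ?P)) * s"
        using l unfolding dP kp .
      have w0: "?w \<noteq> 0" by (simp add: zero_prod_def)
      note R = line_value_reflect[OF P wP w0 False l', unfolded dP kp]
      show ?thesis using R G(2)[OF R(1)] G(2)[OF R(2)] by simp
    qed simp
  qed
  then obtain c where "\<forall>q. G q = c * (q \<bullet> q) ^ D"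
    using arc.reflection_symmetric_imp_radial[OF G(1) _ oval_arc_limits[OF n]] by blast
  then show ?thesis using G(2) by (auto simp: power_mult power2_norm_eq_inner)
qed

text \<open>Lines that miss the origin are dual to exterior points. For the others use polynomiality in
  \<open>v\<close> at a fixed \<open>q \<noteq> 0\<close>, and for \<open>q = 0\<close> move along the line.\<close>

theorem integral_constant: "\<exists>c. \<forall>q v. dual_gauge n q < 1 \<longrightarrow> norm v = 1 \<longrightarrow> \<Psi> q v = c"
proof -
  obtain c where c: "\<And>r. exterior r \<Longrightarrow> line_value r = c * norm r ^ (2 * D)"
    using exterior_line_value_radial by blast
  have A: "\<Psi> q v = c" if q: "dual_gauge n q < 1" and v: "norm v = 1" and m: "perp v \<bullet> q \<noteq> 0" for q v
  proof -
    define r where "r = (1 / (perp v \<bullet> q)) *\<^sub>R perp v"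
    have r: "r \<bullet> q = 1" "r \<bullet> v = 0" using m by (simp_all add: r_def)
    have "exterior r" using q r(1) unfolding exterior_def by blast
    from c[OF this] have "norm r ^ (2 * D) * \<Psi> q v = c * norm r ^ (2 * D)"
      unfolding line_value_eq[OF q r(1) v r(2)] .
    moreover have "r \<noteq> 0" using r by auto
    ultimately show ?thesis by simp
  qed
  have B: "\<Psi> q v = c" if q: "dual_gauge n q < 1" "q \<noteq> 0" and v: "norm v = 1" for q v
  proof (cases "perp v \<bullet> q = 0")
    case True
    have "q = (q \<bullet> v) *\<^sub>R v"
      using orthogonal_unit_plane[of "perp v" v q] True v by simp
    then have vq: "v \<bullet> q \<noteq> 0" using q(2) by (metis inner_commute scaleR_zero_left)
    obtain p where p: "\<And>t. v + t *\<^sub>R perp v \<noteq> 0 \<Longrightarrow> norm (v + t *\<^sub>R perp v) ^ (2 * D) *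
          \<Psi> q ((1 / norm (v + t *\<^sub>R perp v)) *\<^sub>R (v + t *\<^sub>R perp v)) = poly p t"
      using polynomial[OF q(1), of v "perp v"] by blast
    have nz: "v + t *\<^sub>R perp v \<noteq> 0" for t
    proof
      assume "v + t *\<^sub>R perp v = 0"
      then have "v \<bullet> (v + t *\<^sub>R perp v) = 0" by simp
      then show False using v by (simp add: inner_add_right norm_eq_1)
    qed
    have vv: "v \<bullet> v = 1" "perp v \<bullet> perp v = 1" using v by (simp_all add: norm_eq_1[symmetric])
    have nn: "norm (v + t *\<^sub>R perp v) ^ (2 * D) = (1 + t\<^sup>2) ^ D" for t
    proof -
      have "(norm (v + t *\<^sub>R perp v))\<^sup>2 = 1 + t\<^sup>2"
        unfolding power2_norm_eq_inner
        by (simp add: inner_add_left inner_add_right power2_eq_square vv)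
      then show ?thesis by (simp add: power_mult)
    qed
    have "poly p t = c * (1 + t\<^sup>2) ^ D" if "t \<noteq> 0" for t
    proof -
      let ?z = "v + t *\<^sub>R perp v"
      have "perp ((1 / norm ?z) *\<^sub>R ?z) \<bullet> q = (1 / norm ?z) * (- t * (v \<bullet> q))"
        using True by (simp add: inner_add_left inner_diff_left)
      also have "\<dots> \<noteq> 0" using that vq nz[of t] by simp
      finally have "\<Psi> q ((1 / norm ?z) *\<^sub>R ?z) = c" by (intro A q) (use nz[of t] in auto)
      then show ?thesis using p[OF nz[of t]] nn[of t] by (simp add: mult.commute)
    qed
    then have "{0<..} \<subseteq> {t. poly (p - smult c ([:1, 0, 1:] ^ D)) t = 0}"
      by (auto simp: power2_eq_square)
    moreover have "infinite {0::real<..}" by (rule infinite_Ioi)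
    ultimately have "p - smult c ([:1, 0, 1:] ^ D) = 0" using poly_roots_finite finite_subset by blast
    then have "poly p 0 = c" by simp
    then show ?thesis using p[OF nz[of 0]] v by simp
  qed (rule A[OF q(1) v])
  have "\<Psi> 0 v = c" if v: "norm v = 1" for v
  proof -
    have "open {P. dual_gauge n P < 1}"
      by (intro open_Collect_less continuous_intros continuous_gauge n)
    then obtain \<epsilon> where e: "\<epsilon> > 0" "ball 0 \<epsilon> \<subseteq> {P. dual_gauge n P < 1}"
      using gauge_zero[OF n] open_contains_ball by (metis mem_Collect_eq zero_less_one)
    have "(\<epsilon> / 2) *\<^sub>R v \<in> ball 0 \<epsilon>" using e v by simp
    with e(2) have "dual_gauge n ((\<epsilon> / 2) *\<^sub>R v) < 1" by blast
    then have g: "dual_gauge n (0 + (\<epsilon> / 2) *\<^sub>R v) < 1" by simp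
    have "\<Psi> (0 + (\<epsilon> / 2) *\<^sub>R v) v = \<Psi> 0 v" by (rule glide[OF v _ g]) (simp add: gauge_zero[OF n])
    moreover have "\<Psi> (0 + (\<epsilon> / 2) *\<^sub>R v) v = c" by (rule B[OF g _ v]) (use e v in auto)
    ultimately show ?thesis by simp
  qed
  with B have "\<Psi> q v = c" if "dual_gauge n q < 1" "norm v = 1" for q v
    using that by (cases "q = 0") auto
  then show ?thesis by blast
qed

end


section \<open>Non-integrability\<close>

lemma gauge_open_segment:
  assumes n: "n > 1" and q: "dual_gauge n q < 1" and P: "dual_gauge n P \<le> 1" and s: "0 \<le> s" "s < 1"
  shows "dual_gauge n (q + s *\<^sub>R (P - q)) < 1"
proof -
  have "dual_gauge n ((1 - s) *\<^sub>R q + s *\<^sub>R P) \<le> (1 - s) * dual_gauge n q + s * dual_gauge n P"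
    by (rule gauge_convex_comb(1)[OF n]) (use s in auto)
  also have "\<dots> < (1 - s) * 1 + s * 1"
    by (intro add_less_le_mono mult_strict_left_mono mult_left_mono) (use q P s in auto)
  finally show ?thesis by (simp add: algebra_simps)
qed

lemma reflection_involutive: "norm N = 1 \<Longrightarrow> reflection N (reflection N v) = v"
  by (simp add: reflection_def inner_diff_left norm_eq_1 algebra_simps)

lemma reflection_uminus: "reflection N (- v) = - reflection N v"
  by (simp add: reflection_def)

lemma reflection_norm: "norm N = 1 \<Longrightarrow> norm (reflection N v) = norm v"
  by (simp add: reflection_def norm_eq_sqrt_inner inner_diff_left inner_diff_right inner_commute norm_eq_1 algebra_simps)

lemma norm_unit_normal: "n > 1 \<Longrightarrow> dual_gauge n P = 1 \<Longrightarrow> norm (unit_normal n P) = 1"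
  using dual_vec_nz[of n P] by (simp add: unit_normal_def)

text \<open>The flow is given for positive times only; for negative \<open>u\<close> exchange the two points.\<close>

lemma polynomial_integral_glide:
  assumes n: "n > 1" and I: "polynomial_integral {P. dual_gauge n P = 1} \<Phi>"
    and v: "norm v = 1" and q: "dual_gauge n q < 1" "dual_gauge n (q + u *\<^sub>R v) < 1"
  shows "\<Phi> (q + u *\<^sub>R v) v = \<Phi> q v"
proof -
  have pos: "\<Phi> (q + u *\<^sub>R v) v = \<Phi> q v" if q: "dual_gauge n q < 1" "dual_gauge n (q + u *\<^sub>R v) < 1" and u: "u > 0" for q u
  proof -
    have "q + s *\<^sub>R v \<in> inside {P. dual_gauge n P = 1}" if "s \<in> {0<..u}" for s
    proof (cases "s = u")
      case False
      then have "dual_gauge n (q + (s / u) *\<^sub>R (q + u *\<^sub>R v - q)) < 1"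
        by (intro gauge_open_segment n q) (use q that u in auto)
      then show ?thesis using u by (simp add: inside_gauge[OF n])
    qed (use q in \<open>simp add: inside_gauge[OF n]\<close>)
    then have "billiard_flow {P. dual_gauge n P = 1} (q, v) (0 + u) (q + u *\<^sub>R v, v)"
      using q u by (intro billiard_flow.glide billiard_flow.start) (auto simp: inside_gauge[OF n])
    then show ?thesis using I v q unfolding polynomial_integral_def inside_gauge[OF n] by blast
  qed
  consider "u > 0" | "u = 0" | "u < 0" by linarith
  then show ?thesis
  proof cases
    case 3
    have "\<Phi> (q + u *\<^sub>R v + (- u) *\<^sub>R v) v = \<Phi> (q + u *\<^sub>R v) v"
      by (rule pos) (use q 3 in auto)
    then show ?thesis by simp
  qed (use pos q in auto)
qed

lemma polynomial_integral_bounce: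
  assumes n: "n > 1" and I: "polynomial_integral {P. dual_gauge n P = 1} \<Phi>"
    and P: "dual_gauge n P = 1" and v: "norm v = 1" and ab: "a > 0" "b > 0"
    and q: "dual_gauge n (P - a *\<^sub>R v) < 1"
    and q': "dual_gauge n (P + b *\<^sub>R reflection (unit_normal n P) v) < 1"
  shows "\<Phi> (P + b *\<^sub>R reflection (unit_normal n P) v) (reflection (unit_normal n P) v) = \<Phi> (P - a *\<^sub>R v) v"
proof -
  let ?\<gamma> = "{P. dual_gauge n P = 1}" and ?v' = "reflection (unit_normal n P) v" and ?q = "P - a *\<^sub>R v"
  have 1: "?q + s *\<^sub>R v \<in> inside ?\<gamma>" if "s \<in> {0<..<a}" for s
  proof -
    have "dual_gauge n (?q + (s / a) *\<^sub>R (P - ?q)) < 1"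
      by (intro gauge_open_segment n q) (use P that in auto)
    then show ?thesis using ab by (simp add: inside_gauge[OF n])
  qed
  have Pq: "?q + a *\<^sub>R v = P" by simp
  have "billiard_flow ?\<gamma> (?q, v) (0 + a) (?q + a *\<^sub>R v, ?v')"
    using ab 1 outward_normal_gauge[OF n P] P q
    by (intro billiard_flow.bounce billiard_flow.start) (auto simp: inside_gauge[OF n] unit_normal_def)
  then have 2: "billiard_flow ?\<gamma> (?q, v) (0 + a) (P, ?v')" unfolding Pq .
  have 3: "P + s *\<^sub>R ?v' \<in> inside ?\<gamma>" if "s \<in> {0<..b}" for s
  proof -
    have "dual_gauge n ((P + b *\<^sub>R ?v') + (1 - s / b) *\<^sub>R (P - (P + b *\<^sub>R ?v'))) < 1"
      by (intro gauge_open_segment n q') (use P that ab in auto)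
    moreover have "(P + b *\<^sub>R ?v') + (1 - s / b) *\<^sub>R (P - (P + b *\<^sub>R ?v')) = P + s *\<^sub>R ?v'"
      using ab by (simp add: left_diff_distrib algebra_simps)
    ultimately have "dual_gauge n (P + s *\<^sub>R ?v') < 1" by (simp only:)
    then show ?thesis by (simp add: inside_gauge[OF n])
  qed
  have "billiard_flow ?\<gamma> (?q, v) (0 + a + b) (P + b *\<^sub>R ?v', ?v')"
    by (rule billiard_flow.glide[OF 2 ab(2)]) (use 3 in blast)
  then show ?thesis using I v q' unfolding polynomial_integral_def inside_gauge[OF n] by blast
qed

text \<open>The time-reversed collision: arrive with velocity \<open>- v'\<close> and leave with \<open>- v\<close>.\<close>

lemma polynomial_integral_bounce_reversed:
  assumes n: "n > 1" and I: "polynomial_integral {P. dual_gauge n P = 1} \<Phi>"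
    and P: "dual_gauge n P = 1" and v: "norm v = 1" and ab: "a > 0" "b > 0"
    and q: "dual_gauge n (P - a *\<^sub>R v) < 1"
    and q': "dual_gauge n (P + b *\<^sub>R reflection (unit_normal n P) v) < 1"
  shows "\<Phi> (P + b *\<^sub>R reflection (unit_normal n P) v) (- reflection (unit_normal n P) v) = \<Phi> (P - a *\<^sub>R v) (- v)"
proof -
  let ?w = "- reflection (unit_normal n P) v"
  have N: "norm (unit_normal n P) = 1" by (rule norm_unit_normal[OF n P])
  have r: "reflection (unit_normal n P) ?w = - v"
    by (simp add: reflection_uminus reflection_involutive[OF N])
  show ?thesis
    using polynomial_integral_bounce[OF n I P, of ?w b a] v ab q q'
    unfolding r by (simp add: reflection_norm[OF N])
qed

text \<open>A monomial of degree \<open>i + j\<close> on the unit circle extends to a form of degree \<open>M\<close> when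
  \<open>M - i - j\<close> is even: multiply by a power of \<open>v\<^sub>1\<^sup>2 + v\<^sub>2\<^sup>2\<close>.\<close>

lemma homogenised_monomial_poly:
  fixes z0 z1 :: plane
  assumes "i + j + 2 * e = M"
  shows "\<exists>p. degree p \<le> M \<and> (\<forall>t. z0 + t *\<^sub>R z1 \<noteq> 0 \<longrightarrow>
    norm (z0 + t *\<^sub>R z1) ^ M * (fst ((1 / norm (z0 + t *\<^sub>R z1)) *\<^sub>R (z0 + t *\<^sub>R z1)) ^ i *
      snd ((1 / norm (z0 + t *\<^sub>R z1)) *\<^sub>R (z0 + t *\<^sub>R z1)) ^ j) = poly p t)"
proof -
  define A B where "A = [:fst z0, fst z1:]" and "B = [:snd z0, snd z1:]"
  have dA: "degree A \<le> 1" "degree B \<le> 1" by (simp_all add: A_def B_def)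
  have "degree (A\<^sup>2 + B\<^sup>2) \<le> 2"
    by (rule degree_add_le) (use degree_power_le[of A 2] degree_power_le[of B 2] dA in linarith)+
  then have "degree ((A\<^sup>2 + B\<^sup>2) ^ e) \<le> 2 * e"
    using degree_power_le[of "A\<^sup>2 + B\<^sup>2" e] mult_le_mono1 order_trans by blast
  moreover have "degree (A ^ i) \<le> i" "degree (B ^ j) \<le> j"
    using order_trans[OF degree_power_le[of A i] mult_le_mono1[OF dA(1), of i]]
      order_trans[OF degree_power_le[of B j] mult_le_mono1[OF dA(2), of j]] by simp_all
  ultimately have "degree ((A\<^sup>2 + B\<^sup>2) ^ e * (A ^ i * B ^ j)) \<le> M"
    using degree_mult_le[of "(A\<^sup>2 + B\<^sup>2) ^ e" "A ^ i * B ^ j"] degree_mult_le[of "A ^ i" "B ^ j"] assms by linarith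
  moreover have "norm (z0 + t *\<^sub>R z1) ^ M * (fst ((1 / norm (z0 + t *\<^sub>R z1)) *\<^sub>R (z0 + t *\<^sub>R z1)) ^ i *
      snd ((1 / norm (z0 + t *\<^sub>R z1)) *\<^sub>R (z0 + t *\<^sub>R z1)) ^ j) = poly ((A\<^sup>2 + B\<^sup>2) ^ e * (A ^ i * B ^ j)) t"
    if nz: "z0 + t *\<^sub>R z1 \<noteq> 0" for t
  proof -
    define z where "z = z0 + t *\<^sub>R z1"
    have AB: "poly A t = fst z" "poly B t = snd z" by (simp_all add: A_def B_def z_def)
    have N: "norm z \<noteq> 0" using nz by (simp add: z_def)
    have "(norm z)\<^sup>2 = (fst z)\<^sup>2 + (snd z)\<^sup>2" by (simp add: norm_prod_def)
    then have "norm z ^ M = norm z ^ (i + j) * ((fst z)\<^sup>2 + (snd z)\<^sup>2) ^ e"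
      by (simp add: assms[symmetric] power_add power_mult)
    then show ?thesis unfolding z_def[symmetric] using N
      by (simp add: AB power_divide power_add)
  qed
  ultimately show ?thesis by blast
qed

text \<open>The even (\<open>\<epsilon> = 0\<close>) and the odd (\<open>\<epsilon> = 1\<close>) part of a polynomial in \<open>v\<close> contain only the
  monomials of one parity, so each of them has a homogeneous extension.\<close>

lemma parity_part_poly:
  fixes \<phi> :: "plane \<Rightarrow> real" and za zb :: plane
  assumes \<phi>: "\<And>v. \<phi> v = (\<Sum>i\<le>d. \<Sum>j\<le>d. a i j * fst v ^ i * snd v ^ j)" and \<epsilon>: "\<epsilon> \<le> 1"
  shows "\<exists>p. degree p \<le> 2 * d + \<epsilon> \<and> (\<forall>t. za + t *\<^sub>R zb \<noteq> 0 \<longrightarrow>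
    norm (za + t *\<^sub>R zb) ^ (2 * d + \<epsilon>) *
     (\<phi> ((1 / norm (za + t *\<^sub>R zb)) *\<^sub>R (za + t *\<^sub>R zb))
      + (- 1) ^ \<epsilon> * \<phi> (- ((1 / norm (za + t *\<^sub>R zb)) *\<^sub>R (za + t *\<^sub>R zb)))) = poly p t)"
proof -
  let ?z = "\<lambda>t. za + t *\<^sub>R zb" and ?M = "2 * d + \<epsilon>"
  let ?v = "\<lambda>t. (1 / norm (?z t)) *\<^sub>R ?z t"
  have "\<exists>p. degree p \<le> ?M \<and> (\<forall>t. ?z t \<noteq> 0 \<longrightarrow>
      norm (?z t) ^ ?M * (1 + (- 1) ^ (\<epsilon> + i + j)) * (fst (?v t) ^ i * snd (?v t) ^ j) = poly p t)"
    if ij: "i \<le> d" "j \<le> d" for i j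
  proof (cases "even (\<epsilon> + i + j)")
    case True
    have "i + j \<le> ?M" using ij by simp
    moreover have "even (?M - (i + j))" using True ij by presburger
    ultimately obtain e where "i + j + 2 * e = ?M"
      by (metis evenE le_add_diff_inverse)
    from homogenised_monomial_poly[OF this, of za zb] obtain p where
      p: "degree p \<le> ?M" "\<And>t. ?z t \<noteq> 0 \<Longrightarrow> norm (?z t) ^ ?M * (fst (?v t) ^ i * snd (?v t) ^ j) = poly p t" by blast
    have "norm (?z t) ^ ?M * (1 + (- 1) ^ (\<epsilon> + i + j)) * (fst (?v t) ^ i * snd (?v t) ^ j) = poly (smult 2 p) t" if "?z t \<noteq> 0" for t
      using p(2)[OF that] True by (simp add: mult.assoc mult.left_commute)
    then show ?thesis using p(1) by (intro exI[of _ "smult 2 p"]) auto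
  next
    case False
    then show ?thesis by (intro exI[of _ 0]) auto
  qed
  then obtain p where p: "\<And>i j. i \<le> d \<Longrightarrow> j \<le> d \<Longrightarrow> degree (p i j) \<le> ?M"
    "\<And>i j t. i \<le> d \<Longrightarrow> j \<le> d \<Longrightarrow> ?z t \<noteq> 0 \<Longrightarrow>
      norm (?z t) ^ ?M * (1 + (- 1) ^ (\<epsilon> + i + j)) * (fst (?v t) ^ i * snd (?v t) ^ j) = poly (p i j) t" by metis
  let ?p = "\<Sum>i\<le>d. \<Sum>j\<le>d. smult (a i j) (p i j)"
  have "degree ?p \<le> ?M"
    by (intro degree_sum_le finite_atMost) (use p(1) degree_smult_le order_trans in \<open>meson atMost_iff\<close>)
  moreover have "norm (?z t) ^ ?M * (\<phi> (?v t) + (- 1) ^ \<epsilon> * \<phi> (- ?v t)) = poly ?p t" if z: "?z t \<noteq> 0" for t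
  proof -
    define x y where "x = fst (?v t)" and "y = snd (?v t)"
    have "\<phi> (?v t) + (- 1) ^ \<epsilon> * \<phi> (- ?v t) = (\<Sum>i\<le>d. \<Sum>j\<le>d. a i j * ((1 + (- 1) ^ (\<epsilon> + i + j)) * (x ^ i * y ^ j)))"
      unfolding \<phi> sum_distrib_left sum.distrib[symmetric] fst_uminus snd_uminus x_def[symmetric] y_def[symmetric]
      by (intro sum.cong refl) (simp add: power_minus[of x] power_minus[of y] power_add algebra_simps)
    then have "norm (?z t) ^ ?M * (\<phi> (?v t) + (- 1) ^ \<epsilon> * \<phi> (- ?v t))
      = (\<Sum>i\<le>d. \<Sum>j\<le>d. a i j * (norm (?z t) ^ ?M * (1 + (- 1) ^ (\<epsilon> + i + j)) * (x ^ i * y ^ j)))"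
      unfolding sum_distrib_left by (simp add: sum_distrib_left mult.left_commute mult.assoc)
    also have "\<dots> = poly ?p t" unfolding poly_sum x_def y_def
      by (intro sum.cong refl) (simp only: p(2)[OF _ _ z] atMost_iff poly_smult)
    finally show ?thesis .
  qed
  ultimately show ?thesis by blast
qed

text \<open>The even part and the square of the odd part of an integral are even integrals, hence
  constant. The odd part changes its sign on the circle of directions, so by continuity it has a
  zero, and the constant value of its square is \<open>0\<close>.\<close>

theorem not_birkhoff_integrable_gauge:
  assumes n: "n > 1"
  shows "\<not> birkhoff_integrable {P. dual_gauge n P = 1}"
proof
  assume "birkhoff_integrable {P. dual_gauge n P = 1}"
  then obtain \<Phi> where I: "polynomial_integral {P. dual_gauge n P = 1} \<Phi>"
    and nc: "\<not> (\<exists>c. \<forall>q\<in>inside {P. dual_gauge n P = 1}. \<forall>v. norm v = 1 \<longrightarrow> \<Phi> q v = c)"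
    unfolding birkhoff_integrable_def by blast
  obtain d a where \<Phi>: "\<And>q v. dual_gauge n q < 1 \<Longrightarrow> \<Phi> q v = (\<Sum>i\<le>d. \<Sum>j\<le>d. a i j q * fst v ^ i * snd v ^ j)"
  proof -
    have "polynomial_in_velocity {P. dual_gauge n P < 1} \<Phi>"
      using I unfolding polynomial_integral_def inside_gauge[OF n] by blast
    then show thesis using that unfolding polynomial_in_velocity_def by blast
  qed
  have g': "\<Phi> (q + u *\<^sub>R v) (- v) = \<Phi> q (- v)"
    if "norm v = 1" "dual_gauge n q < 1" "dual_gauge n (q + u *\<^sub>R v) < 1" for q u v
    using polynomial_integral_glide[OF n I, of "- v" q "- u"] that by simp

  interpret E: even_billiard_integral n d "\<lambda>q v. \<Phi> q v + \<Phi> q (- v)"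
  proof
    fix q z0 z1 :: plane assume q: "dual_gauge n q < 1"
    show "\<exists>p. degree p \<le> 2 * d \<and> (\<forall>t. z0 + t *\<^sub>R z1 \<noteq> 0 \<longrightarrow> norm (z0 + t *\<^sub>R z1) ^ (2 * d) *
          (\<Phi> q ((1 / norm (z0 + t *\<^sub>R z1)) *\<^sub>R (z0 + t *\<^sub>R z1)) + \<Phi> q (- ((1 / norm (z0 + t *\<^sub>R z1)) *\<^sub>R (z0 + t *\<^sub>R z1)))) = poly p t)"
      using parity_part_poly[where \<phi> = "\<Phi> q" and d = d and a = "\<lambda>i j. a i j q" and \<epsilon> = 0 and za = z0 and zb = z1, OF \<Phi>[OF q]]
      by simp
  next
    fix q v u assume "norm v = 1" "dual_gauge n q < 1" "dual_gauge n (q + u *\<^sub>R v) < 1"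
    then show "\<Phi> (q + u *\<^sub>R v) v + \<Phi> (q + u *\<^sub>R v) (- v) = \<Phi> q v + \<Phi> q (- v)"
      by (simp only: polynomial_integral_glide[OF n I] g')
  next
    fix P v :: plane and a b :: real
    assume A: "dual_gauge n P = 1" "norm v = 1" "a > 0" "b > 0"
       "dual_gauge n (P - a *\<^sub>R v) < 1" "dual_gauge n (P + b *\<^sub>R reflection (unit_normal n P) v) < 1"
    let ?v' = "reflection (unit_normal n P) v"
    show "\<Phi> (P + b *\<^sub>R ?v') ?v' + \<Phi> (P + b *\<^sub>R ?v') (- ?v') = \<Phi> (P - a *\<^sub>R v) v + \<Phi> (P - a *\<^sub>R v) (- v)"
      by (simp only: polynomial_integral_bounce[OF n I A] polynomial_integral_bounce_reversed[OF n I A])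
  qed (use n in \<open>simp_all add: add.commute\<close>)
  interpret O: even_billiard_integral n "2 * d + 1" "\<lambda>q v. (\<Phi> q v - \<Phi> q (- v))\<^sup>2"
  proof
    fix q z0 z1 :: plane assume q: "dual_gauge n q < 1"
    obtain p where p: "degree p \<le> 2 * d + 1" "\<And>t. z0 + t *\<^sub>R z1 \<noteq> 0 \<Longrightarrow> norm (z0 + t *\<^sub>R z1) ^ (2 * d + 1) *
          (\<Phi> q ((1 / norm (z0 + t *\<^sub>R z1)) *\<^sub>R (z0 + t *\<^sub>R z1)) - \<Phi> q (- ((1 / norm (z0 + t *\<^sub>R z1)) *\<^sub>R (z0 + t *\<^sub>R z1)))) = poly p t"
      using parity_part_poly[where \<phi> = "\<Phi> q" and d = d and a = "\<lambda>i j. a i j q" and \<epsilon> = 1 and za = z0 and zb = z1, OF \<Phi>[OF q]]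
      by (simp only: order_refl power_one_right mult_minus1 add_uminus_conv_diff) blast
    show "\<exists>p. degree p \<le> 2 * (2 * d + 1) \<and> (\<forall>t. z0 + t *\<^sub>R z1 \<noteq> 0 \<longrightarrow> norm (z0 + t *\<^sub>R z1) ^ (2 * (2 * d + 1)) *
          (\<Phi> q ((1 / norm (z0 + t *\<^sub>R z1)) *\<^sub>R (z0 + t *\<^sub>R z1)) - \<Phi> q (- ((1 / norm (z0 + t *\<^sub>R z1)) *\<^sub>R (z0 + t *\<^sub>R z1))))\<^sup>2 = poly p t)"
    proof (intro exI[of _ "p\<^sup>2"] conjI allI impI)
      show "degree (p\<^sup>2) \<le> 2 * (2 * d + 1)" using degree_power_le[of p 2] p(1) by simp
      fix t assume nz: "z0 + t *\<^sub>R z1 \<noteq> 0"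
      then show "norm (z0 + t *\<^sub>R z1) ^ (2 * (2 * d + 1)) *
          (\<Phi> q ((1 / norm (z0 + t *\<^sub>R z1)) *\<^sub>R (z0 + t *\<^sub>R z1)) - \<Phi> q (- ((1 / norm (z0 + t *\<^sub>R z1)) *\<^sub>R (z0 + t *\<^sub>R z1))))\<^sup>2 = poly (p\<^sup>2) t"
        unfolding poly_power p(2)[OF nz, symmetric] power_mult_distrib power_mult[symmetric] by (simp only: mult.commute)
    qed
  next
    fix q v u assume "norm v = 1" "dual_gauge n q < 1" "dual_gauge n (q + u *\<^sub>R v) < 1"
    then show "(\<Phi> (q + u *\<^sub>R v) v - \<Phi> (q + u *\<^sub>R v) (- v))\<^sup>2 = (\<Phi> q v - \<Phi> q (- v))\<^sup>2"
      by (simp only: polynomial_integral_glide[OF n I] g')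
  next
    fix P v :: plane and a b :: real
    assume A: "dual_gauge n P = 1" "norm v = 1" "a > 0" "b > 0"
       "dual_gauge n (P - a *\<^sub>R v) < 1" "dual_gauge n (P + b *\<^sub>R reflection (unit_normal n P) v) < 1"
    let ?v' = "reflection (unit_normal n P) v"
    show "(\<Phi> (P + b *\<^sub>R ?v') ?v' - \<Phi> (P + b *\<^sub>R ?v') (- ?v'))\<^sup>2 = (\<Phi> (P - a *\<^sub>R v) v - \<Phi> (P - a *\<^sub>R v) (- v))\<^sup>2"
      by (simp only: polynomial_integral_bounce[OF n I A] polynomial_integral_bounce_reversed[OF n I A])
  qed (use n in \<open>simp_all add: power2_commute\<close>)
  obtain c where c: "\<And>q v. dual_gauge n q < 1 \<Longrightarrow> norm v = 1 \<Longrightarrow> \<Phi> q v + \<Phi> q (- v) = c"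
    using E.integral_constant by blast
  obtain k where k: "\<And>q v. dual_gauge n q < 1 \<Longrightarrow> norm v = 1 \<Longrightarrow> (\<Phi> q v - \<Phi> q (- v))\<^sup>2 = k"
    using O.integral_constant by blast
  have g0: "dual_gauge n 0 < 1" by (simp add: gauge_zero[OF n])
  define h where "h = (\<lambda>t. \<Phi> 0 (cos t, sin t) - \<Phi> 0 (- (cos t, sin t)))"
  have "continuous_on {0..pi} h" unfolding h_def \<Phi>[OF g0] by (simp, intro continuous_intros)
  moreover have "h pi = - h 0" by (simp add: h_def)
  ultimately obtain t where "h t = 0"
  proof (cases "h 0 \<le> 0")
    case True
    then show thesis using IVT'[of h 0 0 pi] that \<open>continuous_on {0..pi} h\<close> \<open>h pi = - h 0\<close> by fastforce
  next
    case False
    then show thesis using IVT2'[of h pi 0 0] that \<open>continuous_on {0..pi} h\<close> \<open>h pi = - h 0\<close> by fastforce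
  qed
  then have "k = 0" using k[OF g0, of "(cos t, sin t)"] by (simp add: h_def norm_Pair)
  have "\<Phi> q v = c / 2" if "dual_gauge n q < 1" "norm v = 1" for q v
    using c[OF that] k[OF that] \<open>k = 0\<close> by simp
  then show False using nc unfolding inside_gauge[OF n] by blast
qed


section \<open>The corollary\<close>

theorem corollary3:
  fixes n :: nat and \<Gamma> \<gamma> E :: "(real \<times> real) set"
  assumes "n > 1"
  defines "\<Gamma> \<equiv> fermat_oval n"
    and "\<gamma> \<equiv> dual_curve \<Gamma>"
    and "E \<equiv> {(1, 0), (-1, 0), (0, 1), (0, -1)}"
  shows "irreducible_set (projective_closure (fermat_curve n)) \<and>
    nonsingular_curve (projective_closure (fermat_curve n)) \<and>
    \<not> birkhoff_integrable \<gamma> \<and>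
    \<gamma> = {(x, y). \<bar>x\<bar> powr (2 * real n / (2 * real n - 1))
               + \<bar>y\<bar> powr (2 * real n / (2 * real n - 1)) = 1} \<and>
    strictly_convex_curve \<gamma> \<and>
    C1_closed_curve \<gamma> \<and>
    singular_points \<gamma> = E \<and>
    inflection_points \<Gamma> = E \<and>
    (\<forall>q\<in>E. \<forall>P. corresponds \<Gamma> q P \<longleftrightarrow> P = q) \<and>
    (\<forall>P\<in>E. \<forall>q. corresponds \<Gamma> q P \<longleftrightarrow> q = P)"
proof -
  note n = assms(1)
  have \<gamma>: "\<gamma> = {P. dual_gauge n P = 1}"
    unfolding \<gamma>_def \<Gamma>_def by (rule dual_curve_fermat_oval[OF n])
  have fixed: "q \<in> fermat_oval n \<and> pow_map n q = q" if "q \<in> E" for q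
    using that n by (auto simp: E_def fermat_oval_def pow_map_def opow_def power_0_left)
  show ?thesis
  proof (intro conjI ballI allI)
    show "irreducible_set (projective_closure (fermat_curve n))"
      "nonsingular_curve (projective_closure (fermat_curve n))"
      using n by (simp_all add: irreducible_fermat nonsingular_fermat)
    show "\<not> birkhoff_integrable \<gamma>"
      unfolding \<gamma> by (rule not_birkhoff_integrable_gauge[OF n])
    show "\<gamma> = {(x, y). \<bar>x\<bar> powr (2 * real n / (2 * real n - 1))
        + \<bar>y\<bar> powr (2 * real n / (2 * real n - 1)) = 1}"
      unfolding \<gamma> powr_eq_oroot[OF n] dual_gauge_def by auto
    show "strictly_convex_curve \<gamma>" unfolding \<gamma> by (rule strictly_convex_gauge[OF n])
    show "C1_closed_curve \<gamma>" unfolding \<gamma> by (rule C1_closed_curve_gauge[OF n])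
    show "singular_points \<gamma> = E" unfolding \<gamma> E_def by (rule singular_points_gauge[OF n])
    show "inflection_points \<Gamma> = E" unfolding \<Gamma>_def E_def by (rule inflection_points_fermat_oval[OF n])
  next
    fix q P assume "q \<in> E"
    then show "corresponds \<Gamma> q P \<longleftrightarrow> P = q"
      unfolding \<Gamma>_def corresponds_fermat_oval[OF n] using fixed by metis
  next
    fix P q assume "P \<in> E"
    then show "corresponds \<Gamma> q P \<longleftrightarrow> q = P"
      unfolding \<Gamma>_def corresponds_fermat_oval[OF n] using fixed dual_vec_pow_map[OF n] by metis
  qed
qed

end
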